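(* Let $M$ be the real $6$-dimensional nilmanifold underlying the Iwasawa manifold, with left-invariant coframe $e^1,\dots,e^6$ satisfying $de^1=de^2=de^3=de^4=0$, $de^5=e^{13}-e^{24}$, $de^6=e^{14}+e^{23}$. Let $\mathcal{J}$ be the left-invariant generalized-complex structure on $M$ whose canonical bundle is generated by $$\rho:=\exp\left(i\left(-e^{36}-e^{45}\right)\right)\wedge\left(e^1+i\,e^2\right).$$ Then $\mathcal{J}$ is $\mathcal{C}^\infty$-pure-and-full; in particular the natural map from the generalized Bott-Chern cohomology $GH^\bullet_{BC}(M)$ to $GH_{dR}(M)$ is surjective.
   Context: $M=\Gamma\backslash G$, where $G$ is the real Lie group underlying the complex $3$-dimensional Heisenberg group $\mathbb{H}(3;\mathbb{C})$ of upper triangular unipotent $3\times3$ complex matrices, and $\Gamma=\mathbb{H}(3;\mathbb{C})\cap \mathrm{GL}(3;\mathbb{Z}[i])$. The coframe $\{e^k\}$ consists of left-invariant real $1$-forms on $G$ descended to $M$; $e^{ij}:=e^i\wedge e^j$. A generalized-almost-complex structure on a $2n$-dimensional manifold $X$ is an endomorphism $\mathcal{J}$ of $TX\oplus T^*X$, orthogonal for $\langle X+\xi\,|\,Y+\eta\rangle:=\frac12(\xi(Y)+\eta(X))$, with $\mathcal{J}^2=-\mathrm{id}$; it is a generalized-complex structure if its $i$-eigenbundle $L$ is closed under the Courant bracket $[X+\xi,Y+\eta]:=[X,Y]+\mathcal{L}_X\eta-\mathcal{L}_Y\xi-\frac12 d(\iota_X\eta-\iota_Y\xi)$. $TX\oplus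 T^*X$ acts on forms by $(X+\xi)\cdot\varphi:=\iota_X\varphi+\xi\wedge\varphi$ (extended $\mathbb{C}$-bilinearly, inducing a Clifford action). The canonical bundle of $\mathcal{J}$ is the complex line sub-bundle $U\subset\wedge^\bullet X\otimes\mathbb{C}$ generated by a form $\rho$ whose Clifford annihilator $\{v\in(TX\oplus T^*X)\otimes\mathbb{C}: v\cdot\rho=0\}$ is exactly $L$; conversely $\rho$ determines $\mathcal{J}$ as $i$ on $L$ and $-i$ on $\bar L$. For $k\in\mathbb{Z}$ set $U^k:=\wedge^{n-k}\bar L\cdot U$ (also denoting smooth sections). For a generalized-complex structure $dU^k\subseteq U^{k+1}\oplus U^{k-1}$, and $d=\partial+\bar\partial$ with $\partial:U^k\to U^{k+1}$, $\bar\partial:U^k\to U^{k-1}$. $GH_{dR}(X):=\ker d/\operatorname{im} d$ is the total complex de Rham cohomology (mixed-degree complex forms); $GH^\bullet_{BC}(X):=\frac{\ker\partial\cap\ker\bar\partial}{\operatorname{im}\partial\bar\partial}$; $GH^{(k)}_{\mathcal{J}}(X)\subseteq GH_{dR}(X)$ is the subspace of classes that admit a $d$-closed representative in $U^k$. $\mathcal{J}$ is $\mathcal{C}^\infty$-pure-and-full if the sum of these subspaces is direct and equals everything: $\bigoplus_{k\in\mathbb{Z}}GH^{(k)}_{\mathcal{J}}(X)=GH_{dR}(X)$. *)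

theory Defs
  imports
    "HOL-Analysis.Analysis"
    "HOL-Library.Function_Algebras"
    "HOL-Library.Set_Algebras"
begin

text \<open>
  A compact manifold \<open>X = V / \<Delta>\<close> whose universal cover is diffeomorphic to a Euclidean space \<open>V\<close>,
  with deck group \<open>\<Delta>\<close>, is handled through its cover: tensor fields on \<open>X\<close> are the
  \<open>\<Delta>\<close>-invariant tensor fields on \<open>V\<close>. Every notion below that lives on \<open>X\<close> takes \<open>\<Delta>\<close>, a set of
  diffeomorphisms of \<open>V\<close>, as a parameter; all tangent spaces of \<open>V\<close> are identified with \<open>V\<close>.
  Sums and differences of forms are pointwise (\<open>Function_Algebras\<close>); \<open>A + B\<close> for sets of forms is
  the Minkowski sum (\<open>Set_Algebras\<close>).
\<close>

section \<open>Mixed-degree complex forms at a point\<close>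

text \<open>
  A mixed-degree complex form assigns to a list of \<open>p\<close> vectors the value of its degree \<open>p\<close> part.
\<close>

type_synonym 'v form = "'v list \<Rightarrow> complex"

definition alternating :: "('v::euclidean_space) form \<Rightarrow> bool" where
  "alternating \<phi> \<longleftrightarrow>
     (\<forall>vs i. i < length vs \<longrightarrow> linear (\<lambda>v. \<phi> (vs[i := v]))) \<and>
     (\<forall>vs. \<not> distinct vs \<longrightarrow> \<phi> vs = 0)"

definition cscale :: "complex \<Rightarrow> 'v form \<Rightarrow> 'v form" where
  "cscale c \<phi> = (\<lambda>vs. c * \<phi> vs)"

definition cspan :: "'v form set \<Rightarrow> 'v form set" where
  "cspan S = module.span cscale S"

definition covector :: "('v::euclidean_space \<Rightarrow>\<^sub>L real) \<Rightarrow> 'v form" where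
  "covector \<xi> = (\<lambda>vs. case vs of [v] \<Rightarrow> complex_of_real (blinfun_apply \<xi> v) | _ \<Rightarrow> 0)"

text \<open>
  Shuffle formula: \<open>S\<close> is the set of positions fed to \<open>\<phi>\<close>; the sign is that of the shuffle, counted
  by inversions. No factorials occur, so \<open>(\<xi> \<and> \<eta>)(v, w) = \<xi> v \<eta> w - \<xi> w \<eta> v\<close>.
\<close>

definition wedge :: "'v form \<Rightarrow> 'v form \<Rightarrow> 'v form" (infixr "\<and>\<^sub>f" 70) where
  "\<phi> \<and>\<^sub>f \<psi> = (\<lambda>vs. \<Sum>S\<in>Pow {..<length vs}.
     (- 1) ^ card {(i, j). i \<in> S \<and> j \<in> {..<length vs} - S \<and> j < i}
       * \<phi> (nths vs S) * \<psi> (nths vs (- S)))"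

definition unit_form :: "'v form" where
  "unit_form = (\<lambda>vs. if vs = [] then 1 else 0)"

definition form_exp :: "'v form \<Rightarrow> 'v form" where
  "form_exp \<phi> = (\<lambda>vs. \<Sum>k. (((\<lambda>\<psi>. \<phi> \<and>\<^sub>f \<psi>) ^^ k) unit_form) vs / fact k)"

section \<open>Generalized tangent vectors and the Clifford action\<close>

type_synonym 'v gtan = "'v \<times> ('v \<Rightarrow>\<^sub>L real)"

text \<open>The pair \<open>(a, b)\<close> of generalized tangent vectors represents \<open>a + \<i> b\<close>.\<close>

type_synonym 'v gtanC = "'v gtan \<times> 'v gtan"

definition pairing :: "('v::euclidean_space) gtan \<Rightarrow> 'v gtan \<Rightarrow> real" where
  "pairing a b = (blinfun_apply (snd a) (fst b) + blinfun_apply (snd b) (fst a)) / 2"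

definition contract :: "'v \<Rightarrow> 'v form \<Rightarrow> 'v form" where
  "contract X \<phi> = (\<lambda>vs. \<phi> (X # vs))"

definition clifford :: "('v::euclidean_space) gtan \<Rightarrow> 'v form \<Rightarrow> 'v form" where
  "clifford a \<phi> = contract (fst a) \<phi> + covector (snd a) \<and>\<^sub>f \<phi>"

definition cliffordC :: "('v::euclidean_space) gtanC \<Rightarrow> 'v form \<Rightarrow> 'v form" where
  "cliffordC v \<phi> = clifford (fst v) \<phi> + cscale \<i> (clifford (snd v) \<phi>)"

definition annihilator :: "('v::euclidean_space) form \<Rightarrow> 'v gtanC set" where
  "annihilator \<phi> = {v. cliffordC v \<phi> = 0}"

text \<open>\<open>j (a + \<i> b) = \<i> (a + \<i> b)\<close>, split into real and imaginary parts.\<close>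

definition i_eigenspace :: "(('v::euclidean_space) gtan \<Rightarrow> 'v gtan) \<Rightarrow> 'v gtanC set" where
  "i_eigenspace j = {(a, b). j a = - b \<and> j b = a}"

definition conj_gtan :: "('v::euclidean_space) gtanC \<Rightarrow> 'v gtanC" where
  "conj_gtan v = (fst v, - snd v)"

definition canonical_line :: "(('v::euclidean_space) gtan \<Rightarrow> 'v gtan) \<Rightarrow> 'v form set" where
  "canonical_line j =
     {\<phi>. alternating \<phi> \<and> (\<phi> = 0 \<or> annihilator \<phi> = i_eigenspace j)}"

definition half_dim :: "'v::euclidean_space itself \<Rightarrow> int" where
  "half_dim _ = int DIM('v) div 2"

text \<open>
  The space \<open>U\<^sup>k\<close> at a point. As the conjugate \<open>L'\<close> of \<open>L\<close> is isotropic, \<open>\<Lambda>\<^sup>m L'\<close> sits in the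
  Clifford algebra and is spanned there by the products of \<open>m\<close> elements of \<open>L'\<close>; it is zero
  for negative \<open>m\<close>.
\<close>

definition U_space :: "(('v::euclidean_space) gtan \<Rightarrow> 'v gtan) \<Rightarrow> int \<Rightarrow> 'v form set" where
  "U_space j k =
     (if k \<le> half_dim TYPE('v) then
        cspan {foldr cliffordC ls u | ls u.
          set ls \<subseteq> conj_gtan ` i_eigenspace j \<and>
          length ls = nat (half_dim TYPE('v) - k) \<and> u \<in> canonical_line j}
      else {0})"

definition U_component ::
  "(('v::euclidean_space) gtan \<Rightarrow> 'v gtan) \<Rightarrow> int \<Rightarrow> 'v form \<Rightarrow> 'v form" where
  "U_component j k \<phi> =
     (THE c. (\<forall>l. c l \<in> U_space j l) \<and> finite {l. c l \<noteq> 0} \<and> \<phi> = (\<Sum>l | c l \<noteq> 0. c l)) k"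

section \<open>Smooth fields and the exterior derivative\<close>

primrec C_k :: "nat \<Rightarrow> ('a::real_normed_vector \<Rightarrow> 'b::real_normed_vector) \<Rightarrow> bool" where
  "C_k 0 f \<longleftrightarrow> continuous_on UNIV f"
| "C_k (Suc k) f \<longleftrightarrow>
     (\<forall>x. f differentiable (at x)) \<and> (\<forall>v. C_k k (\<lambda>x. frechet_derivative f (at x) v))"

definition smooth :: "('a::real_normed_vector \<Rightarrow> 'b::real_normed_vector) \<Rightarrow> bool" where
  "smooth f \<longleftrightarrow> (\<forall>k. C_k k f)"

type_synonym 'v form_field = "'v \<Rightarrow> 'v form"

definition smooth_form :: "('v::euclidean_space) form_field \<Rightarrow> bool" where
  "smooth_form \<omega> \<longleftrightarrow> (\<forall>x. alternating (\<omega> x)) \<and> (\<forall>vs. smooth (\<lambda>x. \<omega> x vs))"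

definition pullback ::
  "(('v::euclidean_space) \<Rightarrow> 'v) \<Rightarrow> 'v form_field \<Rightarrow> 'v form_field" where
  "pullback F \<omega> = (\<lambda>x vs. \<omega> (F x) (map (frechet_derivative F (at x)) vs))"

definition forms :: "(('v::euclidean_space) \<Rightarrow> 'v) set \<Rightarrow> 'v form_field set" where
  "forms \<Delta> = {\<omega>. smooth_form \<omega> \<and> (\<forall>F\<in>\<Delta>. pullback F \<omega> = \<omega>)}"

text \<open>
  The Koszul formula on constant vector fields, whose brackets vanish.
\<close>

definition ext_d :: "('v::euclidean_space) form_field \<Rightarrow> 'v form_field" where
  "ext_d \<omega> = (\<lambda>x vs. \<Sum>i<length vs.
     (- 1) ^ i * frechet_derivative (\<lambda>y. \<omega> y (take i vs @ drop (Suc i) vs)) (at x) (vs ! i))"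

section \<open>Sections of the generalized tangent bundle and the Courant bracket\<close>

definition push ::
  "(('v::euclidean_space) \<Rightarrow> 'v) \<Rightarrow> 'v \<Rightarrow> 'v gtan \<Rightarrow> 'v gtan" where
  "push F x a =
     (frechet_derivative F (at x) (fst a),
      Blinfun (\<lambda>v. blinfun_apply (snd a) (frechet_derivative (inv F) (at (F x)) v)))"

definition gtan_sections :: "(('v::euclidean_space) \<Rightarrow> 'v) set \<Rightarrow> ('v \<Rightarrow> 'v gtan) set" where
  "gtan_sections \<Delta> = {s. smooth s \<and> (\<forall>F\<in>\<Delta>. \<forall>x. s (F x) = push F x (s x))}"

definition gtanC_sections :: "(('v::euclidean_space) \<Rightarrow> 'v) set \<Rightarrow> ('v \<Rightarrow> 'v gtanC) set" where
  "gtanC_sections \<Delta> = {s. fst \<circ> s \<in> gtan_sections \<Delta> \<and> snd \<circ> s \<in> gtan_sections \<Delta>}"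

definition vf_bracket ::
  "('v::euclidean_space \<Rightarrow> 'v) \<Rightarrow> ('v \<Rightarrow> 'v) \<Rightarrow> 'v \<Rightarrow> 'v" where
  "vf_bracket X Y = (\<lambda>x.
     frechet_derivative Y (at x) (X x) - frechet_derivative X (at x) (Y x))"

definition lie_derivative ::
  "('v::euclidean_space \<Rightarrow> 'v) \<Rightarrow> ('v \<Rightarrow> 'v \<Rightarrow>\<^sub>L real) \<Rightarrow> 'v \<Rightarrow> 'v \<Rightarrow>\<^sub>L real" where
  "lie_derivative X \<eta> = (\<lambda>x. Blinfun (\<lambda>v.
     blinfun_apply (frechet_derivative \<eta> (at x) (X x)) v
     + blinfun_apply (\<eta> x) (frechet_derivative X (at x) v)))"

definition courant ::
  "('v::euclidean_space \<Rightarrow> 'v gtan) \<Rightarrow> ('v \<Rightarrow> 'v gtan) \<Rightarrow> 'v \<Rightarrow> 'v gtan" where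
  "courant s t = (let X = fst \<circ> s; \<xi> = snd \<circ> s; Y = fst \<circ> t; \<eta> = snd \<circ> t in
     (\<lambda>x. (vf_bracket X Y x,
       lie_derivative X \<eta> x - lie_derivative Y \<xi> x
       - (1 / 2) *\<^sub>R Blinfun (frechet_derivative
           (\<lambda>y. blinfun_apply (\<eta> y) (X y) - blinfun_apply (\<xi> y) (Y y)) (at x)))))"

definition courantC ::
  "('v::euclidean_space \<Rightarrow> 'v gtanC) \<Rightarrow> ('v \<Rightarrow> 'v gtanC) \<Rightarrow> 'v \<Rightarrow> 'v gtanC" where
  "courantC s t = (\<lambda>x.
     (courant (fst \<circ> s) (fst \<circ> t) x - courant (snd \<circ> s) (snd \<circ> t) x,
      courant (fst \<circ> s) (snd \<circ> t) x + courant (snd \<circ> s) (fst \<circ> t) x))"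

section \<open>Generalized complex structures\<close>

type_synonym 'v gendo = "'v \<Rightarrow> 'v gtan \<Rightarrow> 'v gtan"

definition invariant_endo :: "(('v::euclidean_space) \<Rightarrow> 'v) set \<Rightarrow> 'v gendo \<Rightarrow> bool" where
  "invariant_endo \<Delta> J \<longleftrightarrow> (\<forall>F\<in>\<Delta>. \<forall>x a. J (F x) (push F x a) = push F x (J x a))"

definition generalized_almost_complex ::
  "(('v::euclidean_space) \<Rightarrow> 'v) set \<Rightarrow> 'v gendo \<Rightarrow> bool" where
  "generalized_almost_complex \<Delta> J \<longleftrightarrow>
     (\<forall>x. linear (J x)) \<and> (\<forall>a. smooth (\<lambda>x. J x a)) \<and> invariant_endo \<Delta> J \<and>
     (\<forall>x a b. pairing (J x a) (J x b) = pairing a b) \<and>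
     (\<forall>x a. J x (J x a) = - a)"

definition generalized_complex ::
  "(('v::euclidean_space) \<Rightarrow> 'v) set \<Rightarrow> 'v gendo \<Rightarrow> bool" where
  "generalized_complex \<Delta> J \<longleftrightarrow>
     generalized_almost_complex \<Delta> J \<and>
     (\<forall>s\<in>gtanC_sections \<Delta>. \<forall>t\<in>gtanC_sections \<Delta>.
        (\<forall>x. s x \<in> i_eigenspace (J x)) \<longrightarrow> (\<forall>x. t x \<in> i_eigenspace (J x)) \<longrightarrow>
        (\<forall>x. courantC s t x \<in> i_eigenspace (J x)))"

definition canonical_bundle_generated_by ::
  "('v::euclidean_space) gendo \<Rightarrow> 'v form_field \<Rightarrow> bool" where
  "canonical_bundle_generated_by J \<rho> \<longleftrightarrow>
     (\<forall>x. annihilator (\<rho> x) = i_eigenspace (J x) \<and>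
          canonical_line (J x) = range (\<lambda>c. cscale c (\<rho> x)))"

definition U_sections ::
  "(('v::euclidean_space) \<Rightarrow> 'v) set \<Rightarrow> 'v gendo \<Rightarrow> int \<Rightarrow> 'v form_field set" where
  "U_sections \<Delta> J k = {\<omega> \<in> forms \<Delta>. \<forall>x. \<omega> x \<in> U_space (J x) k}"

text \<open>
  \<open>shift_d J r\<close> is the part of \<open>d\<close> that maps \<open>U\<^sup>k\<close> to \<open>U\<^sup>k\<^sup>+\<^sup>r\<close>; recall that \<open>U\<^sup>k\<close> vanishes
  for \<open>k\<close> outside of \<open>{-n..n}\<close>.
\<close>

definition shift_d :: "('v::euclidean_space) gendo \<Rightarrow> int \<Rightarrow> 'v form_field \<Rightarrow> 'v form_field" where
  "shift_d J r \<omega> = (\<Sum>k\<in>{- half_dim TYPE('v)..half_dim TYPE('v)}.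
     (\<lambda>x. U_component (J x) (k + r) (ext_d (\<lambda>y. U_component (J y) k (\<omega> y)) x)))"

definition del :: "('v::euclidean_space) gendo \<Rightarrow> 'v form_field \<Rightarrow> 'v form_field" where
  "del J = shift_d J 1"

definition delbar :: "('v::euclidean_space) gendo \<Rightarrow> 'v form_field \<Rightarrow> 'v form_field" where
  "delbar J = shift_d J (- 1)"

section \<open>Cohomologies\<close>

text \<open>Cohomology classes are cosets; the zero class is \<open>dR_class \<Delta> 0\<close>.\<close>

definition dR_class ::
  "(('v::euclidean_space) \<Rightarrow> 'v) set \<Rightarrow> 'v form_field \<Rightarrow> 'v form_field set" where
  "dR_class \<Delta> a = {a + ext_d b | b. b \<in> forms \<Delta>}"

definition GH_dR :: "(('v::euclidean_space) \<Rightarrow> 'v) set \<Rightarrow> 'v form_field set set" where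
  "GH_dR \<Delta> = dR_class \<Delta> ` {a \<in> forms \<Delta>. ext_d a = 0}"

definition BC_class ::
  "(('v::euclidean_space) \<Rightarrow> 'v) set \<Rightarrow> 'v gendo \<Rightarrow> 'v form_field \<Rightarrow> 'v form_field set" where
  "BC_class \<Delta> J a = {a + del J (delbar J b) | b. b \<in> forms \<Delta>}"

definition GH_BC ::
  "(('v::euclidean_space) \<Rightarrow> 'v) set \<Rightarrow> 'v gendo \<Rightarrow> 'v form_field set set" where
  "GH_BC \<Delta> J = BC_class \<Delta> J ` {a \<in> forms \<Delta>. del J a = 0 \<and> delbar J a = 0}"

text \<open>
  The map induced by the identity on representatives; for integrable \<open>J\<close> the image of
  \<open>del J \<circ> delbar J\<close> consists of exact forms, so that the union is over one and the same coset.
\<close>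

definition BC_to_dR ::
  "(('v::euclidean_space) \<Rightarrow> 'v) set \<Rightarrow> 'v form_field set \<Rightarrow> 'v form_field set" where
  "BC_to_dR \<Delta> c = (\<Union>a\<in>c. dR_class \<Delta> a)"

definition GH_sub ::
  "(('v::euclidean_space) \<Rightarrow> 'v) set \<Rightarrow> 'v gendo \<Rightarrow> int \<Rightarrow> 'v form_field set set" where
  "GH_sub \<Delta> J k = {c \<in> GH_dR \<Delta>. \<exists>a\<in>c. ext_d a = 0 \<and> a \<in> U_sections \<Delta> J k}"

text \<open>
  Direct sum: every class is in exactly one way a finitely supported sum of classes in the
  summands. The neutral element of the Minkowski sum is \<open>{0}\<close>, hence the extra zero class, which
  matters for empty support only.
\<close>

definition pure_and_full ::
  "(('v::euclidean_space) \<Rightarrow> 'v) set \<Rightarrow> 'v gendo \<Rightarrow> bool" where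
  "pure_and_full \<Delta> J \<longleftrightarrow>
     (\<forall>c\<in>GH_dR \<Delta>. \<exists>!f :: int \<Rightarrow> 'v form_field set.
        (\<forall>k. f k \<in> GH_sub \<Delta> J k) \<and> finite {k. f k \<noteq> dR_class \<Delta> 0} \<and>
        c = dR_class \<Delta> 0 + (\<Sum>k | f k \<noteq> dR_class \<Delta> 0. f k))"

section \<open>The Iwasawa nilmanifold\<close>

text \<open>The complex Heisenberg group in the global chart given by the matrix entries.\<close>

definition heis :: "complex ^ 3 \<Rightarrow> complex ^ 3 ^ 3" where
  "heis z = vector [vector [1, z $ 1, z $ 3], vector [0, 1, z $ 2], vector [0, 0, 1]]"

definition heis_chart :: "complex ^ 3 ^ 3 \<Rightarrow> complex ^ 3" where
  "heis_chart A = vector [A $ 1 $ 2, A $ 2 $ 3, A $ 1 $ 3]"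

definition left_translation :: "complex ^ 3 \<Rightarrow> complex ^ 3 \<Rightarrow> complex ^ 3" where
  "left_translation g h = heis_chart (heis g ** heis h)"

definition Gauss_ints :: "complex set" where
  "Gauss_ints = {z. Re z \<in> \<int> \<and> Im z \<in> \<int>}"

definition GL3_Gauss :: "(complex ^ 3 ^ 3) set" where
  "GL3_Gauss = {A. (\<forall>i j. A $ i $ j \<in> Gauss_ints) \<and>
     (\<exists>B. (\<forall>i j. B $ i $ j \<in> Gauss_ints) \<and> A ** B = mat 1 \<and> B ** A = mat 1)}"

definition Iwasawa_deck :: "(complex ^ 3 \<Rightarrow> complex ^ 3) set" where
  "Iwasawa_deck = left_translation ` {g. heis g \<in> GL3_Gauss}"

definition left_invariant_coframe ::
  "(nat \<Rightarrow> complex ^ 3 \<Rightarrow> ((complex ^ 3) \<Rightarrow>\<^sub>L real)) \<Rightarrow> bool" where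
  "left_invariant_coframe e \<longleftrightarrow>
     (\<forall>k\<in>{1..6}. (\<lambda>x. covector (e k x)) \<in> forms (range left_translation)) \<and>
     (\<forall>x. inj_on (\<lambda>k. e k x) {1..6} \<and> independent ((\<lambda>k. e k x) ` {1..6}) \<and>
          span ((\<lambda>k. e k x) ` {1..6}) = UNIV)"

end

theory Submission
  imports Defs
begin

text \<open>
  Put \<open>\<theta> = e\<^sup>1 + \<i> e\<^sup>2\<close>, \<open>\<eta> = e\<^sup>3 + \<i> e\<^sup>4\<close>, \<open>\<zeta> = e\<^sup>5 + \<i> e\<^sup>6\<close>, and write \<open>\<theta>'\<close>, \<open>\<eta>'\<close>, \<open>\<zeta>'\<close> for their conjugates.
  The structure equations say \<open>d \<zeta> = \<theta> \<and> \<eta>\<close>, and the pure spinor becomes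
  \<open>\<rho> = exp ((\<eta>' \<and> \<zeta>' - \<eta> \<and> \<zeta>) / 2) \<and> \<theta>\<close>. On invariant forms \<open>d\<close> is the sum of the two operators
  \<open>\<partial> = \<theta> \<and> \<eta> \<and> \<iota>\<^sub>\<zeta>\<close> and \<open>\<partial>' = \<theta>' \<and> \<eta>' \<and> \<iota>\<^sub>\<zeta>\<^sub>'\<close>, each a cubic monomial in fermionic creation and
  annihilation operators. Since \<open>\<eta> \<and> \<iota>\<^sub>\<zeta>\<close> and \<open>\<zeta> \<and> \<iota>\<^sub>\<eta>\<close> are infinitesimally symplectic for
  \<open>\<eta> \<and> \<zeta>\<close>, they preserve the symplectic part of the grading by the \<open>U\<^sup>k\<close>, while \<open>\<theta>\<close> and \<open>\<iota>\<^sub>\<theta>\<close> shift the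
  complex part by one. So \<open>\<partial>\<close> and \<open>\<partial>'\<close> have degree \<open>1\<close> and \<open>-1\<close>, and their adjoints
  \<open>\<zeta> \<and> \<iota>\<^sub>\<eta> \<iota>\<^sub>\<theta>\<close> and \<open>\<zeta>' \<and> \<iota>\<^sub>\<eta>\<^sub>' \<iota>\<^sub>\<theta>\<^sub>'\<close> the opposite degrees.
  The Laplacians \<open>\<partial>\<partial>\<^sup>* + \<partial>\<^sup>*\<partial>\<close> and \<open>\<partial>'\<partial>'\<^sup>* + \<partial>'\<^sup>*\<partial>'\<close> are commuting projections of degree \<open>0\<close>, and
  unprimed operators anticommute with primed ones. The product of the complementary projections,
  \<open>hproj\<close>, is therefore annihilated by \<open>d\<close> from both sides, acts as the identity on cohomology and
  commutes with the projections to the \<open>U\<^sup>k\<close> (\<open>hproj_d0\<close>, \<open>d0_hproj\<close>, \<open>closed_minus_hproj\<close>,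
  \<open>hproj_proj\<close>).

  Arbitrary forms are reduced to invariant ones in the left trivialization of the tangent bundle, in
  the spirit of Nomizu's theorem. The coefficients are averaged along the two central and then the
  four remaining coordinate directions. For each direction \<open>b\<close> Cartan's formula reads
  \<open>d \<iota>\<^sub>b + \<iota>\<^sub>b d = \<partial>\<^sub>b + N\<^sub>b\<close> with a nilpotent constant operator \<open>N\<^sub>b\<close>, and \<open>\<partial>\<^sub>b\<close> is invertible on
  fields of mean zero; hence closed fields of mean zero are exact (\<open>exact_if_mean_zero\<close>). Averaging
  commutes with every constant operator, so it respects the grading too.

  The two steps compose to an operator \<open>H\<close> on all forms of the manifold with \<open>H d = d H = 0\<close> that
  commutes with the projections to the \<open>U\<^sup>k\<close> and moves a closed form by an exact one only. The
  components of \<open>H \<omega>\<close> are closed, which makes \<open>J\<close> full; applying \<open>H\<close> to a relation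
  between closed forms of different degrees separates them, which makes it pure; and \<open>H \<omega>\<close>
  is a representative in the kernels of both parts of \<open>d\<close>, which gives
  surjectivity from Bott-Chern cohomology (\<open>pure_and_full\<close>, \<open>BC_surjective\<close>). What remains is to recognize
  \<open>U\<^sup>k\<close>, defined by words in the conjugate of the annihilator of \<open>\<rho>\<close>, as an eigenspace of an explicit
  quadratic operator \<open>K\<close> (\<open>U_eq_eig\<close>): the forms are a Fock space with vacuum \<open>\<rho>\<close>.
\<close>


section \<open>Contraction and exterior multiplication\<close>

lemma module_cscale: "module cscale"
  by unfold_locales (auto simp: cscale_def fun_eq_iff algebra_simps)

interpretation cform: vector_space cscale
  by (simp add: vector_space_def module_cscale[unfolded module_def])

lemma sum_fun_apply: "(sum f I) x = (\<Sum>i\<in>I. f i x)"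
  by (induction I rule: infinite_finite_induct) auto

lemma cscale_apply: "cscale c \<phi> vs = c * \<phi> vs" by (simp add: cscale_def)

definition grade_sign :: "'v form \<Rightarrow> 'v form" where
  "grade_sign \<phi> = (\<lambda>vs. (- 1) ^ length vs * \<phi> vs)"

lemma wedge_Nil: "(\<phi> \<and>\<^sub>f \<psi>) [] = \<phi> [] * \<psi> []"
  by (simp add: wedge_def)

lemma Pow_lessThan_Suc_shift:
  "Pow {..<Suc n} = (\<lambda>T. insert 0 (Suc ` T)) ` Pow {..<n} \<union> (\<lambda>T. Suc ` T) ` Pow {..<n}"
proof -
  have "Pow {..<Suc n} = Pow (insert 0 (Suc ` {..<n}))"
    by (simp add: lessThan_Suc_eq_insert_0)
  also have "\<dots> = Pow (Suc ` {..<n}) \<union> insert 0 ` Pow (Suc ` {..<n})"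
    by (rule Pow_insert)
  also have "Pow (Suc ` {..<n}) = (\<lambda>T. Suc ` T) ` Pow {..<n}"
    by (rule image_Pow_surj[symmetric]) simp
  finally show ?thesis by (simp add: image_image Un_commute)
qed

text \<open>
  The shuffles are split by whether the first vector is fed to \<open>\<phi>\<close>; in the second case it is
  overtaken by all the positions fed to \<open>\<phi>\<close>, whence the sign. This recursion replaces the shuffle
  formula from here on: identities for wedge products follow by induction on the argument list.
\<close>

lemma wedge_Cons:
  "(\<phi> \<and>\<^sub>f \<psi>) (v # vs) = (contract v \<phi> \<and>\<^sub>f \<psi>) vs + (grade_sign \<phi> \<and>\<^sub>f contract v \<psi>) vs"
proof -
  define n where "n = length vs"
  define inv where "inv m S = card {(i, j). i \<in> S \<and> j \<in> {..<m} - S \<and> j < i}" for m :: nat and S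
  define h where "h S = (- 1) ^ inv (Suc n) S * \<phi> (nths (v # vs) S) * \<psi> (nths (v # vs) (- S))" for S
  have inj: "inj_on (\<lambda>T. insert 0 (Suc ` T)) (Pow {..<n})" "inj_on (\<lambda>T. Suc ` T) (Pow {..<n})"
    by (auto simp: inj_on_def set_eq_iff image_iff)
  have disj: "(\<lambda>T. insert 0 (Suc ` T)) ` Pow {..<n} \<inter> (\<lambda>T. Suc ` T) ` Pow {..<n} = {}"
    by (auto simp: set_eq_iff image_iff)
  have pre: "{j. Suc j \<in> insert 0 (Suc ` T)} = T" "{j. Suc j \<in> Suc ` T} = T"
    "{j. Suc j \<in> - insert 0 (Suc ` T)} = - T" "{j. Suc j \<in> - Suc ` T} = - T"
    "{j. Suc j \<notin> Suc ` T} = - T" for T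
    by auto
  have inv0: "inv (Suc n) (insert 0 (Suc ` T)) = inv n T" if "T \<subseteq> {..<n}" for T
    unfolding inv_def
    by (rule bij_betw_same_card[symmetric, where f = "\<lambda>(i, j). (Suc i, Suc j)"])
       (auto simp: bij_betw_def inj_on_def image_iff Bex_def elim!: less_natE)
  have inv1: "inv (Suc n) (Suc ` T) = inv n T + card T" if T: "T \<subseteq> {..<n}" for T
  proof -
    have fin: "finite T" using T finite_subset by blast
    have eq: "{(i, j). i \<in> Suc ` T \<and> j \<in> {..<Suc n} - Suc ` T \<and> j < i} =
       (\<lambda>(i, j). (Suc i, Suc j)) ` {(i, j). i \<in> T \<and> j \<in> {..<n} - T \<and> j < i} \<union> (\<lambda>i. (Suc i, 0)) ` T"
      (is "?A = ?B \<union> ?C")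
    proof (intro set_eqI iffI)
      fix p assume "p \<in> ?A"
      then obtain i j where p: "p = (Suc i, j)" "i \<in> T" "j < Suc n" "j \<notin> Suc ` T" "j < Suc i" by auto
      then show "p \<in> ?B \<union> ?C" by (cases j) auto
    qed auto
    have f: "finite {(i, j). i \<in> T \<and> j \<in> {..<n} - T \<and> j < i}"
      by (rule finite_subset[of _ "T \<times> {..<n}"]) (use fin in auto)
    have "inv (Suc n) (Suc ` T) = card ?B + card ?C"
      unfolding inv_def eq by (rule card_Un_disjoint) (use f fin in auto)
    also have "card ?B = inv n T" unfolding inv_def by (rule card_image) (auto simp: inj_on_def)
    also have "card ?C = card T" by (rule card_image) (auto simp: inj_on_def)
    finally show ?thesis .
  qed
  have len: "length (nths vs T) = card T" if "T \<subseteq> {..<n}" for T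
    using that by (auto simp: length_nths n_def intro: arg_cong[where f=card])
  have "(\<phi> \<and>\<^sub>f \<psi>) (v # vs) = sum h (Pow {..<Suc n})"
    by (simp add: wedge_def h_def inv_def n_def)
  also have "\<dots> = (\<Sum>T\<in>Pow {..<n}. h (insert 0 (Suc ` T))) + (\<Sum>T\<in>Pow {..<n}. h (Suc ` T))"
    unfolding Pow_lessThan_Suc_shift
    by (subst sum.union_disjoint) (use disj inj in \<open>auto simp: sum.reindex\<close>)
  also have "(\<Sum>T\<in>Pow {..<n}. h (insert 0 (Suc ` T))) = (contract v \<phi> \<and>\<^sub>f \<psi>) vs"
    unfolding wedge_def
    by (rule sum.cong) (auto simp: h_def inv0 nths_Cons pre contract_def n_def[symmetric], simp add: inv_def)
  also have "(\<Sum>T\<in>Pow {..<n}. h (Suc ` T)) = (grade_sign \<phi> \<and>\<^sub>f contract v \<psi>) vs"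
    unfolding wedge_def
    by (rule sum.cong) (auto simp: h_def inv1 nths_Cons pre contract_def n_def[symmetric] grade_sign_def len power_add,
      simp add: inv_def)
  finally show ?thesis .
qed

lemma contract_wedge:
  "contract v (\<phi> \<and>\<^sub>f \<psi>) = contract v \<phi> \<and>\<^sub>f \<psi> + grade_sign \<phi> \<and>\<^sub>f contract v \<psi>"
  by (rule ext) (simp add: contract_def wedge_Cons[unfolded contract_def])

lemma form_eqI:
  assumes "\<phi> [] = \<psi> []" "\<And>v. contract v \<phi> = contract v \<psi>"
  shows "\<phi> = \<psi>"
proof
  fix vs show "\<phi> vs = \<psi> vs"
    using assms(1) fun_cong[OF assms(2)] by (cases vs) (auto simp: contract_def)
qed

lemma wedge_add_left: "(\<phi> + \<phi>') \<and>\<^sub>f \<psi> = \<phi> \<and>\<^sub>f \<psi> + \<phi>' \<and>\<^sub>f \<psi>"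
  by (rule ext) (simp add: wedge_def algebra_simps sum.distrib)
lemma wedge_add_right: "\<phi> \<and>\<^sub>f (\<psi> + \<psi>') = \<phi> \<and>\<^sub>f \<psi> + \<phi> \<and>\<^sub>f \<psi>'"
  by (rule ext) (simp add: wedge_def algebra_simps sum.distrib)
lemma wedge_cscale_left: "cscale c \<phi> \<and>\<^sub>f \<psi> = cscale c (\<phi> \<and>\<^sub>f \<psi>)"
  by (rule ext) (simp add: wedge_def cscale_def sum_distrib_left algebra_simps)
lemma wedge_cscale_right: "\<phi> \<and>\<^sub>f cscale c \<psi> = cscale c (\<phi> \<and>\<^sub>f \<psi>)"
  by (rule ext) (simp add: wedge_def cscale_def sum_distrib_left algebra_simps)
lemma wedge_zero_left: "0 \<and>\<^sub>f \<psi> = 0" by (rule ext) (simp add: wedge_def)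
lemma wedge_zero_right: "\<phi> \<and>\<^sub>f 0 = 0" by (rule ext) (simp add: wedge_def)
lemma wedge_minus_left: "(- \<phi>) \<and>\<^sub>f \<psi> = - (\<phi> \<and>\<^sub>f \<psi>)"
  by (rule ext) (simp add: wedge_def sum_negf)
lemma wedge_minus_right: "\<phi> \<and>\<^sub>f (- \<psi>) = - (\<phi> \<and>\<^sub>f \<psi>)"
  by (rule ext) (simp add: wedge_def sum_negf)

lemma contract_unit_form: "contract v unit_form = 0"
  by (rule ext) (simp add: contract_def unit_form_def)

lemma unit_form_wedge: "unit_form \<and>\<^sub>f \<psi> = \<psi>"
proof
  have [simp]: "grade_sign unit_form = unit_form"
    by (rule ext) (simp add: grade_sign_def unit_form_def)
  fix vs show "(unit_form \<and>\<^sub>f \<psi>) vs = \<psi> vs"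
    by (induction vs arbitrary: \<psi>)
       (simp_all add: wedge_Nil wedge_Cons contract_unit_form wedge_zero_left, simp_all add: unit_form_def contract_def)
qed

lemma contract_covector: "contract v (covector \<xi>) = cscale (complex_of_real (blinfun_apply \<xi> v)) unit_form"
  by (rule ext) (auto simp: contract_def covector_def cscale_def unit_form_def split: list.split)

lemma grade_sign_covector: "grade_sign (covector \<xi>) = - covector \<xi>"
  by (rule ext) (auto simp: grade_sign_def covector_def split: list.split)

lemma covector_wedge_Nil: "(covector \<xi> \<and>\<^sub>f \<phi>) [] = 0"
  by (simp add: wedge_Nil covector_def)

lemma contract_covector_wedge:
  "contract v (covector \<xi> \<and>\<^sub>f \<phi>) =
     cscale (complex_of_real (blinfun_apply \<xi> v)) \<phi> - covector \<xi> \<and>\<^sub>f contract v \<phi>"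
  by (simp add: contract_wedge contract_covector grade_sign_covector wedge_cscale_left unit_form_wedge wedge_minus_left)

lemma contract_add: "contract v (\<phi> + \<psi>) = contract v \<phi> + contract v \<psi>"
  by (rule ext) (simp add: contract_def)
lemma contract_diff: "contract v (\<phi> - \<psi>) = contract v \<phi> - contract v \<psi>"
  by (rule ext) (simp add: contract_def)
lemma contract_cscale: "contract v (cscale c \<phi>) = cscale c (contract v \<phi>)"
  by (rule ext) (simp add: contract_def cscale_def)
lemma contract_zero: "contract v 0 = 0"
  by (rule ext) (simp add: contract_def)
lemma wedge_diff_right: "\<phi> \<and>\<^sub>f (\<psi> - \<psi>') = \<phi> \<and>\<^sub>f \<psi> - \<phi> \<and>\<^sub>f \<psi>'"
  by (rule ext) (simp add: wedge_def algebra_simps sum_subtractf)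
lemma contract_sum: "contract v (sum f I) = (\<Sum>i\<in>I. contract v (f i))"
  by (induction I rule: infinite_finite_induct) (simp_all only: sum.infinite sum.empty sum.insert contract_zero contract_add not_False_eq_True)
lemma wedge_sum_right: "\<phi> \<and>\<^sub>f (sum f I) = (\<Sum>i\<in>I. \<phi> \<and>\<^sub>f f i)"
  by (induction I rule: infinite_finite_induct) (simp_all only: sum.infinite sum.empty sum.insert wedge_zero_right wedge_add_right not_False_eq_True)

lemma covector_wedge_anticommute:
  "covector \<xi> \<and>\<^sub>f (covector \<eta> \<and>\<^sub>f \<phi>) = - (covector \<eta> \<and>\<^sub>f (covector \<xi> \<and>\<^sub>f \<phi>))"
proof
  fix vs show "(covector \<xi> \<and>\<^sub>f (covector \<eta> \<and>\<^sub>f \<phi>)) vs = (- (covector \<eta> \<and>\<^sub>f (covector \<xi> \<and>\<^sub>f \<phi>))) vs"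
  proof (induction vs arbitrary: \<phi>)
    case (Cons v vs)
    have "contract v (covector \<xi> \<and>\<^sub>f (covector \<eta> \<and>\<^sub>f \<phi>)) vs = (- contract v (covector \<eta> \<and>\<^sub>f (covector \<xi> \<and>\<^sub>f \<phi>))) vs"
      using Cons[of "contract v \<phi>"]
      by (simp add: contract_covector_wedge wedge_diff_right wedge_cscale_right)
    then show ?case by (simp add: contract_def)
  qed (simp add: covector_wedge_Nil)
qed

lemma covector_wedge_assoc: "(covector \<xi> \<and>\<^sub>f \<phi>) \<and>\<^sub>f \<psi> = covector \<xi> \<and>\<^sub>f (\<phi> \<and>\<^sub>f \<psi>)"
proof
  have gs: "grade_sign (covector \<xi> \<and>\<^sub>f \<phi>) = - (covector \<xi> \<and>\<^sub>f grade_sign \<phi>)" for \<phi> :: "'a form"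
  proof
    fix vs show "grade_sign (covector \<xi> \<and>\<^sub>f \<phi>) vs = (- (covector \<xi> \<and>\<^sub>f grade_sign \<phi>)) vs"
    proof (induction vs arbitrary: \<phi>)
      case (Cons v vs)
      have *: "contract v (grade_sign \<phi>) = - grade_sign (contract v \<phi>)" for \<phi>
        by (rule ext) (simp add: contract_def grade_sign_def)
      have "contract v (grade_sign (covector \<xi> \<and>\<^sub>f \<phi>)) vs = (- contract v (covector \<xi> \<and>\<^sub>f grade_sign \<phi>)) vs"
        using Cons[of "contract v \<phi>"]
        by (simp add: * contract_covector_wedge wedge_minus_right)
           (simp add: grade_sign_def cscale_def algebra_simps)
      then show ?case by (simp add: contract_def)
    qed (simp add: grade_sign_def covector_wedge_Nil)
  qed
  fix vs show "((covector \<xi> \<and>\<^sub>f \<phi>) \<and>\<^sub>f \<psi>) vs = (covector \<xi> \<and>\<^sub>f (\<phi> \<and>\<^sub>f \<psi>)) vs"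
  proof (induction vs arbitrary: \<phi> \<psi>)
    case Nil then show ?case by (simp add: wedge_Nil covector_def)
  next
    case (Cons v vs)
    have "contract v ((covector \<xi> \<and>\<^sub>f \<phi>) \<and>\<^sub>f \<psi>) =
        cscale (complex_of_real (blinfun_apply \<xi> v)) (\<phi> \<and>\<^sub>f \<psi>)
        + (- ((covector \<xi> \<and>\<^sub>f contract v \<phi>) \<and>\<^sub>f \<psi>) + - ((covector \<xi> \<and>\<^sub>f grade_sign \<phi>) \<and>\<^sub>f contract v \<psi>))"
      unfolding contract_wedge[of v "covector \<xi> \<and>\<^sub>f \<phi>"] contract_covector_wedge gs diff_conv_add_uminus
        wedge_add_left wedge_minus_left wedge_cscale_left add.assoc ..
    moreover have "contract v (covector \<xi> \<and>\<^sub>f (\<phi> \<and>\<^sub>f \<psi>)) =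
        cscale (complex_of_real (blinfun_apply \<xi> v)) (\<phi> \<and>\<^sub>f \<psi>)
        + (- (covector \<xi> \<and>\<^sub>f (contract v \<phi> \<and>\<^sub>f \<psi>)) + - (covector \<xi> \<and>\<^sub>f (grade_sign \<phi> \<and>\<^sub>f contract v \<psi>)))"
      unfolding contract_covector_wedge contract_wedge[of v \<phi>] wedge_add_right by simp
    ultimately have "contract v ((covector \<xi> \<and>\<^sub>f \<phi>) \<and>\<^sub>f \<psi>) vs = contract v (covector \<xi> \<and>\<^sub>f (\<phi> \<and>\<^sub>f \<psi>)) vs"
      using Cons[of "contract v \<phi>" \<psi>] Cons[of "grade_sign \<phi>" "contract v \<psi>"]
      by simp
    then show ?case by (simp add: contract_def)
  qed
qed

section \<open>Alternating forms\<close>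

lemma alternating_linear:
  assumes "alternating \<phi>" "i < length vs" shows "linear (\<lambda>v. \<phi> (vs[i := v]))"
  using assms unfolding alternating_def by blast

lemma alternating_not_distinct:
  assumes "alternating \<phi>" "\<not> distinct vs" shows "\<phi> vs = 0"
  using assms unfolding alternating_def by blast

lemma alternating_linear_append:
  assumes "alternating \<phi>" shows "linear (\<lambda>v. \<phi> (us @ v # ws))"
  using alternating_linear[OF assms, of "length us" "us @ undefined # ws"] by simp

lemma alternating_contract: 
  assumes "alternating \<phi>" shows "alternating (contract X \<phi>)"
  unfolding alternating_def contract_def
proof (intro conjI allI impI)
  fix vs :: "'a list" and i assume "i < length vs"
  then show "linear (\<lambda>v. \<phi> (X # vs[i := v]))"
    using alternating_linear[OF assms, of "Suc i" "X # vs"] by simp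
next
  fix vs :: "'a list" assume "\<not> distinct vs"
  then show "\<phi> (X # vs) = 0" by (intro alternating_not_distinct[OF assms]) simp
qed

lemma alternating_contract_linear:
  assumes "alternating \<phi>"
  shows "contract (X + Y) \<phi> = contract X \<phi> + contract Y \<phi>"
    and "contract (r *\<^sub>R X) \<phi> = cscale (complex_of_real r) (contract X \<phi>)"
    and "contract 0 \<phi> = 0"
  using linear_add[OF alternating_linear_append[OF assms, of "[]"]]
    linear_scale[OF alternating_linear_append[OF assms, of "[]"]]
    linear_0[OF alternating_linear_append[OF assms, of "[]"]]
  by (auto simp: contract_def fun_eq_iff cscale_def scaleR_conv_of_real)

lemma alternating_contract_anticommute:
  assumes "alternating \<phi>"
  shows "contract X (contract Y \<phi>) = - contract Y (contract X \<phi>)"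
proof
  fix vs
  note l1 = linear_add[OF alternating_linear_append[OF assms, of "[]"]]
  note l2 = linear_add[OF alternating_linear_append[OF assms, of "[_]"]]
  have "\<phi> ((X + Y) # (X + Y) # vs) = 0" "\<phi> (X # X # vs) = 0" "\<phi> (Y # Y # vs) = 0"
    by (intro alternating_not_distinct[OF assms]; simp)+
  then have "\<phi> (Y # X # vs) + \<phi> (X # Y # vs) = 0"
    using l1[of "X" "Y"] l2[of _ X Y vs] by (simp add: add.commute)
  then show "contract X (contract Y \<phi>) vs = (- contract Y (contract X \<phi>)) vs"
    by (simp add: contract_def add_eq_0_iff)
qed

text \<open>
  A criterion that survives the recursive computation of \<open>covector \<xi> \<and>\<^sub>f \<phi>\<close>. Vanishing on adjacent equal
  vectors gives antisymmetry under adjacent swaps, which bring equal vectors together.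
\<close>

lemma alternating_iff_adjacent:
  "alternating \<phi> \<longleftrightarrow> (\<forall>us ws. linear (\<lambda>v. \<phi> (us @ v # ws))) \<and> (\<forall>us v ws. \<phi> (us @ v # v # ws) = 0)"
  (is "_ \<longleftrightarrow> ?R")
proof
  assume "alternating \<phi>" then show ?R
    by (auto intro: alternating_linear_append alternating_not_distinct)
next
  assume R: ?R
  have swap: "\<phi> (us @ v # w # ws) = - \<phi> (us @ w # v # ws)" for us v w ws
  proof -
    have l1: "\<phi> (us @ (v + w) # z # ws) = \<phi> (us @ v # z # ws) + \<phi> (us @ w # z # ws)" for z
      using R linear_add by blast
    have l2: "\<phi> (us @ z # (v + w) # ws) = \<phi> (us @ z # v # ws) + \<phi> (us @ z # w # ws)" for z
      using linear_add[of "\<lambda>x. \<phi> ((us @ [z]) @ x # ws)" v w] R by (metis append.assoc append_Cons append_Nil)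
    have "\<phi> (us @ (v + w) # (v + w) # ws) = 0" using R by blast
    then have "\<phi> (us @ v # w # ws) + \<phi> (us @ w # v # ws) = 0"
      using l1[of "v+w"] l2[of v] l2[of w] R by simp
    then show ?thesis by (simp add: add_eq_0_iff)
  qed
  have nd: "\<phi> (us @ v # vs @ v # ws) = 0" for us v vs ws
  proof (induction vs arbitrary: us)
    case Nil then show ?case using R by simp
  next
    case (Cons a vs)
    then show ?case using swap[of us v a "vs @ v # ws"] Cons[of "us @ [a]"] by simp
  qed
  show "alternating \<phi>" unfolding alternating_def
  proof (intro conjI allI impI)
    fix vs :: "'a list" and i assume i: "i < length vs"
    show "linear (\<lambda>v. \<phi> (vs[i := v]))" using R i by (simp add: upd_conv_take_nth_drop)
  next
    fix vs :: "'a list" assume "\<not> distinct vs"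
    then obtain xs ys zs y where "vs = xs @ [y] @ ys @ [y] @ zs" using not_distinct_decomp by blast
    then show "\<phi> vs = 0" using nd by simp
  qed
qed

lemma alternating_zero: "alternating 0"
  by (simp add: alternating_def linear_zero)

lemma alternating_add: "alternating \<phi> \<Longrightarrow> alternating \<psi> \<Longrightarrow> alternating (\<phi> + \<psi>)"
  unfolding alternating_def by (auto intro: linear_compose_add)

lemma alternating_cscale: "alternating \<phi> \<Longrightarrow> alternating (cscale c \<phi>)"
  unfolding alternating_def cscale_def
  by (auto intro: linear_compose[of _ "\<lambda>z. c * z", unfolded o_def] bounded_linear.linear[OF bounded_linear_mult_right])

lemma alternating_minus: "alternating \<phi> \<Longrightarrow> alternating (- \<phi>)"
  using alternating_cscale[of \<phi> "-1"] by (simp add: cscale_def fun_Compl_def)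

lemma alternating_diff: "alternating \<phi> \<Longrightarrow> alternating \<psi> \<Longrightarrow> alternating (\<phi> - \<psi>)"
  using alternating_add[of \<phi> "- \<psi>"] alternating_minus[of \<psi>] by simp


lemma alternating_unit_form: "alternating unit_form"
  by (auto simp: alternating_iff_adjacent unit_form_def linear_zero)

lemma alternating_covector_wedge:
  assumes "alternating \<phi>" shows "alternating (covector \<xi> \<and>\<^sub>f \<phi>)"
proof -
  let ?w = "\<lambda>\<phi>. covector \<xi> \<and>\<^sub>f \<phi>"
  have C: "?w \<phi> (v # vs) = complex_of_real (blinfun_apply \<xi> v) * \<phi> vs - ?w (contract v \<phi>) vs" for v vs \<phi>
    using fun_cong[OF contract_covector_wedge, of v \<xi> \<phi> vs] by (simp add: contract_def cscale_def)
  have D: "?w \<phi> (us @ v # v # ws) = 0" if "alternating \<phi>" for us v ws \<phi>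
    using that
  proof (induction us arbitrary: \<phi>)
    case Nil
    have [simp]: "contract v (contract v \<phi>) = 0"
      by (rule ext) (auto simp: contract_def intro: alternating_not_distinct[OF Nil])
    have "?w (contract v \<phi>) (v # ws) = complex_of_real (blinfun_apply \<xi> v) * \<phi> (v # ws)"
      by (simp add: C wedge_zero_right) (simp add: contract_def)
    then show ?case by (simp add: C)
  next
    case (Cons u us)
    from Cons.IH[OF alternating_contract[OF Cons.prems]] alternating_not_distinct[OF Cons.prems]
    show ?case by (simp add: C)
  qed
  have L: "linear (\<lambda>v. ?w \<phi> (us @ v # ws))" if "alternating \<phi>" for us ws \<phi>
    using that
  proof (induction us arbitrary: \<phi>)
    case Nil
    have a: "contract (x + y) \<phi> = contract x \<phi> + contract y \<phi>"
      "contract (r *\<^sub>R x) \<phi> = cscale (complex_of_real r) (contract x \<phi>)" for x y r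
      using alternating_contract_linear[OF Nil] by auto
    show ?case
      by (rule linearI) (simp_all add: C a wedge_add_right wedge_cscale_right cscale_apply
          blinfun.add_right blinfun.scaleR_right algebra_simps scaleR_conv_of_real)
  next
    case (Cons u us)
    have "linear (\<lambda>v. complex_of_real (blinfun_apply \<xi> u) * \<phi> (us @ v # ws))"
      by (rule linear_compose[OF alternating_linear_append[OF Cons.prems], of "\<lambda>z. _ * z", unfolded o_def])
         (rule bounded_linear.linear[OF bounded_linear_mult_right])
    then show ?case
      using Cons.IH[OF alternating_contract[OF Cons.prems]]
      by (simp add: C) (rule linear_compose_sub)
  qed
  show ?thesis unfolding alternating_iff_adjacent using D[OF assms] L[OF assms] by blast
qed


section \<open>Clifford operators\<close>

lemma fun_minus_conv_add: "(\<phi> :: 'v form) - \<psi> = \<phi> + cscale (-1) \<psi>"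
  by (simp add: cscale_def fun_eq_iff)

lemma clifford_add: "clifford a (\<phi> + \<psi>) = clifford a \<phi> + clifford a \<psi>"
  by (simp add: clifford_def contract_add wedge_add_right)

lemma clifford_cscale: "clifford a (cscale c \<phi>) = cscale c (clifford a \<phi>)"
  by (simp add: clifford_def contract_cscale wedge_cscale_right cform.scale_right_distrib)



lemma clifford_anticommute:
  assumes "alternating \<phi>"
  shows "clifford a (clifford b \<phi>) = cscale (complex_of_real (2 * pairing a b)) \<phi> - clifford b (clifford a \<phi>)"
proof -
  have "clifford a (clifford b \<phi>) = contract (fst a) (contract (fst b) \<phi>)
     + (cscale (complex_of_real (blinfun_apply (snd b) (fst a))) \<phi> - covector (snd b) \<and>\<^sub>f contract (fst a) \<phi>)
     + covector (snd a) \<and>\<^sub>f contract (fst b) \<phi> + covector (snd a) \<and>\<^sub>f (covector (snd b) \<and>\<^sub>f \<phi>)" for a b :: "'a gtan"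
    by (simp add: clifford_def contract_add wedge_add_right contract_covector_wedge add.assoc)
  then show ?thesis
    using alternating_contract_anticommute[OF assms, of "fst a" "fst b"]
      covector_wedge_anticommute[of "snd a" "snd b" \<phi>]
    by (simp only:) (simp add: pairing_def cscale_def fun_eq_iff algebra_simps)
qed

definition pairingC :: "('v::euclidean_space) gtanC \<Rightarrow> 'v gtanC \<Rightarrow> complex" where
  "pairingC v w = Complex (pairing (fst v) (fst w) - pairing (snd v) (snd w))
     (pairing (fst v) (snd w) + pairing (snd v) (fst w))"

text \<open>
  The Clifford relation; contractions anticommute on alternating forms only, whence the
  hypothesis.
\<close>

lemma cliffordC_anticommute:
  assumes "alternating \<phi>"
  shows "cliffordC v (cliffordC w \<phi>) = cscale (2 * pairingC v w) \<phi> - cliffordC w (cliffordC v \<phi>)"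
  unfolding cliffordC_def clifford_add clifford_cscale
    clifford_anticommute[OF assms, of "fst v" "fst w"] clifford_anticommute[OF assms, of "snd v" "snd w"]
    clifford_anticommute[OF assms, of "fst v" "snd w"] clifford_anticommute[OF assms, of "snd v" "fst w"]
  by (simp add: cscale_def fun_eq_iff pairingC_def complex_eq_iff) (simp add: algebra_simps)

text \<open>
  The constant-coefficient operators. The rules generate all polynomials in exterior multiplications
  and contractions; all properties of such operators that are used for fields of forms (linearity,
  preservation of smoothness, commutation with derivatives and averages) follow by induction.
\<close>

inductive clifford_op :: "(('v::euclidean_space) form \<Rightarrow> 'v form) \<Rightarrow> bool" where
  clifford_op_id: "clifford_op (\<lambda>\<phi>. \<phi>)"
| clifford_op_contract: "clifford_op T \<Longrightarrow> clifford_op (\<lambda>\<phi>. contract X (T \<phi>))"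
| clifford_op_wedge: "clifford_op T \<Longrightarrow> clifford_op (\<lambda>\<phi>. covector \<xi> \<and>\<^sub>f T \<phi>)"
| clifford_op_cscale: "clifford_op T \<Longrightarrow> clifford_op (\<lambda>\<phi>. cscale c (T \<phi>))"
| clifford_op_add: "clifford_op T \<Longrightarrow> clifford_op T' \<Longrightarrow> clifford_op (\<lambda>\<phi>. T \<phi> + T' \<phi>)"

lemma clifford_op_additive: "clifford_op T \<Longrightarrow> T (\<phi> + \<psi>) = T \<phi> + T \<psi>"
  by (induction arbitrary: \<phi> \<psi> rule: clifford_op.induct)
     (simp_all only: contract_add wedge_add_right cform.scale_right_distrib ac_simps)

lemma clifford_op_homogeneous: "clifford_op T \<Longrightarrow> T (cscale c \<phi>) = cscale c (T \<phi>)"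
  by (induction arbitrary: \<phi> rule: clifford_op.induct)
     (simp_all add: contract_cscale wedge_cscale_right cform.scale_right_distrib mult.commute)

lemma clifford_op_alternating: "clifford_op T \<Longrightarrow> alternating \<phi> \<Longrightarrow> alternating (T \<phi>)"
  by (induction arbitrary: \<phi> rule: clifford_op.induct)
     (simp_all add: alternating_contract alternating_covector_wedge alternating_cscale alternating_add)

lemma clifford_op_zero: "clifford_op T \<Longrightarrow> T 0 = 0"
  using clifford_op_homogeneous[of T 0 0] by simp

lemma clifford_op_minus: "clifford_op T \<Longrightarrow> T (- \<phi>) = - T \<phi>"
  using clifford_op_homogeneous[of T "-1" \<phi>] by simp

lemma clifford_op_diff: "clifford_op T \<Longrightarrow> T (\<phi> - \<psi>) = T \<phi> - T \<psi>"
  using clifford_op_additive[of T \<phi> "- \<psi>"] clifford_op_minus[of T \<psi>] by simp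

lemma clifford_op_sum: "clifford_op T \<Longrightarrow> T (sum f I) = (\<Sum>i\<in>I. T (f i))"
  by (induction I rule: infinite_finite_induct)
     (simp_all only: sum.infinite sum.empty sum.insert clifford_op_zero clifford_op_additive not_False_eq_True)

lemma clifford_op_comp: "clifford_op T \<Longrightarrow> clifford_op T' \<Longrightarrow> clifford_op (\<lambda>\<phi>. T (T' \<phi>))"
  by (induction rule: clifford_op.induct) (auto intro: clifford_op.intros)

lemma clifford_op_difference: "clifford_op T \<Longrightarrow> clifford_op T' \<Longrightarrow> clifford_op (\<lambda>\<phi>. T \<phi> - T' \<phi>)"
  unfolding fun_minus_conv_add by (intro clifford_op.intros)

lemma clifford_op_uminus: "clifford_op T \<Longrightarrow> clifford_op (\<lambda>\<phi>. - T \<phi>)"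
  using clifford_op_cscale[of T "-1"] by simp

lemma clifford_op_null: "clifford_op (\<lambda>\<phi>. 0)"
  using clifford_op_cscale[OF clifford_op_id, of 0] by simp


lemma clifford_op_cliffordC: "clifford_op T \<Longrightarrow> clifford_op (\<lambda>\<phi>. cliffordC v (T \<phi>))"
  unfolding cliffordC_def clifford_def by (intro clifford_op.intros)

lemma linear_frame_expansion:
  fixes F :: "'v::euclidean_space \<Rightarrow> 'v form"
  assumes "\<And>v. (\<Sum>k\<in>I. blinfun_apply (\<xi> k) v *\<^sub>R X k) = v" "finite I"
    and "linear (\<lambda>v. F v vs)"
  shows "F v vs = (\<Sum>k\<in>I. complex_of_real (blinfun_apply (\<xi> k) v) * F (X k) vs)"
proof -
  have "F v vs = F (\<Sum>k\<in>I. blinfun_apply (\<xi> k) v *\<^sub>R X k) vs" using assms(1) by simp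
  also have "\<dots> = (\<Sum>k\<in>I. complex_of_real (blinfun_apply (\<xi> k) v) * F (X k) vs)"
    using linear_sum[OF assms(3), of "\<lambda>k. blinfun_apply (\<xi> k) v *\<^sub>R X k" I]
    by (simp add: linear_scale[OF assms(3)] scaleR_conv_of_real)
  finally show ?thesis .
qed

text \<open>
  Antisymmetrization over the argument of \<open>F\<close>, computed in a frame. The Koszul formula for \<open>ext_d\<close> has this
  shape in constant and in left-invariant frames.
\<close>

lemma alternating_sum_conv_wedge:
  assumes "\<And>v. (\<Sum>k\<in>I. blinfun_apply (\<xi> k) v *\<^sub>R X k) = v" "finite I"
    and "\<And>ws. linear (\<lambda>v. F v ws)"
  shows "(\<Sum>i<length vs. (- 1) ^ i * F (vs ! i) (take i vs @ drop (Suc i) vs)) =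
    (\<Sum>k\<in>I. covector (\<xi> k) \<and>\<^sub>f F (X k)) vs"
  using assms(3)
proof (induction vs arbitrary: F)
  case Nil
  then show ?case by (simp add: sum_fun_apply covector_wedge_Nil)
next
  case (Cons v vs)
  have "(\<Sum>i<length (v # vs). (- 1) ^ i * F ((v # vs) ! i) (take i (v # vs) @ drop (Suc i) (v # vs)))
      = F v vs - (\<Sum>i<length vs. (- 1) ^ i * contract v (F (vs ! i)) (take i vs @ drop (Suc i) vs))"
    by (simp add: sum.lessThan_Suc_shift sum_negf contract_def del: sum.lessThan_Suc)
  also have "\<dots> = F v vs - (\<Sum>k\<in>I. covector (\<xi> k) \<and>\<^sub>f contract v (F (X k))) vs"
    by (subst Cons.IH[of "\<lambda>w. contract v (F w)"]) (simp_all add: contract_def Cons.prems)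
  also have "\<dots> = contract v (\<Sum>k\<in>I. covector (\<xi> k) \<and>\<^sub>f F (X k)) vs"
    by (simp add: contract_sum contract_covector_wedge sum_subtractf sum_fun_apply cscale_apply
        linear_frame_expansion[of \<xi> X I F vs v, OF assms(1,2) Cons.prems])
  finally show ?case by (simp add: contract_def)
qed

section \<open>Coframes\<close>

text \<open>
  A form killed by all contractions is a multiple of \<open>unit_form\<close>, and \<open>\<phi> = \<iota>(e \<and> \<phi>) + e \<and> \<iota>\<phi>\<close> expresses a
  form through two forms that are killed by one more contraction.
\<close>

lemma alternating_generated_by_wedges:
  fixes \<phi> :: "('v::euclidean_space) form"
  assumes dual: "\<And>i j. i \<in> I \<Longrightarrow> j \<in> I \<Longrightarrow> blinfun_apply (\<xi> i) (X j) = (if i = j then 1 else 0)"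
    and expand: "\<And>v. (\<Sum>k\<in>I. blinfun_apply (\<xi> k) v *\<^sub>R X k) = v" and I: "finite I"
    and unit: "unit_form \<in> S"
    and add: "\<And>\<phi> \<psi>. \<phi> \<in> S \<Longrightarrow> \<psi> \<in> S \<Longrightarrow> \<phi> + \<psi> \<in> S"
    and scale: "\<And>c \<phi>. \<phi> \<in> S \<Longrightarrow> cscale c \<phi> \<in> S"
    and wedge: "\<And>k \<phi>. k \<in> I \<Longrightarrow> \<phi> \<in> S \<Longrightarrow> covector (\<xi> k) \<and>\<^sub>f \<phi> \<in> S"
    and "alternating \<phi>"
  shows "\<phi> \<in> S"
proof -
  \<comment> \<open>\<open>K\<close> is the set of contractions that may act nontrivially on \<open>\<phi>\<close>.\<close>
  have main: "\<phi> \<in> S" if "finite K" "K \<subseteq> I" "alternating \<phi>" "\<And>k. k \<in> I - K \<Longrightarrow> contract (X k) \<phi> = 0" for K \<phi>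
    using that
  proof (induction K arbitrary: \<phi> rule: finite_induct)
    case empty
    have 0: "contract v \<phi> = 0" for v
    proof
      fix vs
      have "linear (\<lambda>w. contract w \<phi> vs)"
        using alternating_linear_append[OF empty(2), of "[]" vs] by (simp add: contract_def)
      from linear_frame_expansion[of \<xi> X I "\<lambda>w. contract w \<phi>", OF expand I this, of v] empty(3)
      show "contract v \<phi> vs = 0 vs" by simp
    qed
    have "\<phi> = cscale (\<phi> []) unit_form"
      by (rule form_eqI) (simp_all add: 0 contract_cscale contract_unit_form cscale_apply, simp add: unit_form_def)
    then show ?case using scale[OF unit] by metis
  next
    case (insert i K)
    have i: "i \<in> I" using insert by blast
    let ?a = "contract (X i) (covector (\<xi> i) \<and>\<^sub>f \<phi>)" and ?b = "contract (X i) \<phi>"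
    have eq: "\<phi> = ?a + covector (\<xi> i) \<and>\<^sub>f ?b"
      using dual[OF i i] by (simp add: contract_covector_wedge)
    have alt: "alternating ?a" "alternating ?b"
      using insert by (auto intro: alternating_contract alternating_covector_wedge)
    have self: "contract (X k) (contract (X k) \<psi>) = 0" if "alternating \<psi>" for k \<psi>
      by (rule ext) (simp add: contract_def alternating_not_distinct[OF that])
    have kill: "contract (X k) ?a = 0 \<and> contract (X k) ?b = 0" if k: "k \<in> I - K" for k
    proof (cases "k = i")
      case True then show ?thesis
        using self alternating_covector_wedge[OF insert.prems(2)] insert.prems(2) by simp
    next
      case False
      with k insert.prems have "contract (X k) \<phi> = 0" by blast
      moreover from this have "contract (X k) ?b = 0"
        by (simp add: alternating_contract_anticommute[OF insert.prems(2), of "X k"] contract_zero)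
      ultimately show ?thesis using False k dual[OF i, of k] dual[OF i i]
        by (auto simp: contract_covector_wedge contract_diff wedge_zero_right)
    qed
    have "?a \<in> S" "?b \<in> S"
      using insert.IH[of ?a] insert.IH[of ?b] alt kill insert.prems by auto
    then show ?case using eq add wedge[OF i] by metis
  qed
  show ?thesis using main[of I \<phi>] I assms by auto
qed


section \<open>Fermionic modes of the Iwasawa coframe\<close>

lemma cliffordC_plus:
  assumes "alternating \<phi>" shows "cliffordC (v + w) \<phi> = cliffordC v \<phi> + cliffordC w \<phi>"
proof -
  have c: "covector (\<xi> + \<eta>) = covector \<xi> + covector \<eta>" for \<xi> \<eta> :: "'a \<Rightarrow>\<^sub>L real"
    by (auto simp: fun_eq_iff covector_def blinfun.add_left split: list.split)
  have "clifford (a + b) \<phi> = clifford a \<phi> + clifford b \<phi>" for a b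
    by (simp add: clifford_def c alternating_contract_linear[OF assms] wedge_add_left algebra_simps)
  then show ?thesis by (simp add: cliffordC_def cform.scale_right_distrib algebra_simps)
qed

lemma cliffordC_scaleR:
  assumes "alternating \<phi>" shows "cliffordC (r *\<^sub>R v) \<phi> = cscale (complex_of_real r) (cliffordC v \<phi>)"
proof -
  have c: "covector (r *\<^sub>R \<xi>) = cscale (complex_of_real r) (covector \<xi>)" for \<xi> :: "'a \<Rightarrow>\<^sub>L real"
    by (auto simp: fun_eq_iff covector_def blinfun.scaleR_left cscale_def split: list.split)
  have "clifford (r *\<^sub>R a) \<phi> = cscale (complex_of_real r) (clifford a \<phi>)" for a
    by (simp add: clifford_def c alternating_contract_linear[OF assms] wedge_cscale_left cform.scale_right_distrib)
  then show ?thesis by (simp add: cliffordC_def cform.scale_right_distrib mult.commute)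
qed

text \<open>
  A coframe at one point with its dual frame. Everything about \<open>U\<^sup>k\<close> is pointwise algebra over these data.
\<close>

locale coframe =
  fixes \<epsilon> :: "nat \<Rightarrow> ('v::euclidean_space \<Rightarrow>\<^sub>L real)" and X :: "nat \<Rightarrow> 'v"
  assumes dual: "\<And>i j. i \<in> {1..6} \<Longrightarrow> j \<in> {1..6} \<Longrightarrow> blinfun_apply (\<epsilon> i) (X j) = (if i = j then 1 else 0)"
    and expand: "\<And>v. (\<Sum>k\<in>{1..6}. blinfun_apply (\<epsilon> k) v *\<^sub>R X k) = v"
begin

text \<open>
  The modes \<open>1, 2, 3\<close> are exterior multiplication with \<open>\<theta>, \<eta>, \<zeta>\<close> and contraction with the dual vectors
  \<open>(X\<^sub>1 - \<i> X\<^sub>2) / 2\<close> etc.; the modes \<open>4, 5, 6\<close> are their conjugates.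
\<close>

definition wedge_mode :: "nat \<Rightarrow> 'v gtanC" where
  "wedge_mode k = (if k \<le> 3 then ((0, \<epsilon> (2 * k - 1)), (0, \<epsilon> (2 * k)))
     else ((0, \<epsilon> (2 * k - 7)), (0, - \<epsilon> (2 * k - 6))))"

definition contract_mode :: "nat \<Rightarrow> 'v gtanC" where
  "contract_mode k = (if k \<le> 3 then (((1/2) *\<^sub>R X (2 * k - 1), 0), (- (1/2) *\<^sub>R X (2 * k), 0))
     else (((1/2) *\<^sub>R X (2 * k - 7), 0), ((1/2) *\<^sub>R X (2 * k - 6), 0)))"

definition W :: "nat \<Rightarrow> 'v form \<Rightarrow> 'v form" where "W k = cliffordC (wedge_mode k)"
definition C :: "nat \<Rightarrow> 'v form \<Rightarrow> 'v form" where "C k = cliffordC (contract_mode k)"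

lemma clifford_op_W: "clifford_op T \<Longrightarrow> clifford_op (\<lambda>\<phi>. W k (T \<phi>))"
  and clifford_op_C: "clifford_op T \<Longrightarrow> clifford_op (\<lambda>\<phi>. C k (T \<phi>))"
  by (simp_all add: W_def C_def clifford_op_cliffordC)

lemma op_W: "clifford_op (W k)" and op_C: "clifford_op (C k)"
  using clifford_op_W[OF clifford_op_id] clifford_op_C[OF clifford_op_id] by auto

lemmas mode_linear =
  clifford_op_additive[OF op_W] clifford_op_diff[OF op_W] clifford_op_minus[OF op_W]
  clifford_op_homogeneous[OF op_W] clifford_op_zero[OF op_W]
  clifford_op_additive[OF op_C] clifford_op_diff[OF op_C] clifford_op_minus[OF op_C]
  clifford_op_homogeneous[OF op_C] clifford_op_zero[OF op_C]

lemmas mode_alternating = clifford_op_alternating[OF op_W] clifford_op_alternating[OF op_C]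

lemma atLeastAtMost_1_6: "{1..6::nat} = {1,2,3,4,5,6}" by auto

lemma mode_pairings:
  assumes "i \<in> {1..6}" "j \<in> {1..6}"
  shows "pairingC (wedge_mode i) (wedge_mode j) = 0" "pairingC (contract_mode i) (contract_mode j) = 0"
    "2 * pairingC (contract_mode i) (wedge_mode j) = (if i = j then 1 else 0)"
proof -
  show "pairingC (wedge_mode i) (wedge_mode j) = 0" "pairingC (contract_mode i) (contract_mode j) = 0"
    by (simp_all add: pairingC_def pairing_def wedge_mode_def contract_mode_def complex_eq_iff)
  have ij: "i = 1 \<or> i = 2 \<or> i = 3 \<or> i = 4 \<or> i = 5 \<or> i = 6" "j = 1 \<or> j = 2 \<or> j = 3 \<or> j = 4 \<or> j = 5 \<or> j = 6"
    using assms by auto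
  show "2 * pairingC (contract_mode i) (wedge_mode j) = (if i = j then 1 else 0)"
    using ij(1) 
  proof (elim disjE)
  qed (use ij(2) in \<open>elim disjE; simp only:; simp add: pairingC_def pairing_def wedge_mode_def contract_mode_def
       blinfun.scaleR_right blinfun.minus_left blinfun.minus_right dual complex_eq_iff\<close>)+
qed

lemma W_anticommute: "i \<in> {1..6} \<Longrightarrow> j \<in> {1..6} \<Longrightarrow> alternating \<phi> \<Longrightarrow> W i (W j \<phi>) = - W j (W i \<phi>)"
  using cliffordC_anticommute[of \<phi> "wedge_mode i" "wedge_mode j"] by (simp add: W_def mode_pairings(1))

lemma C_anticommute: "i \<in> {1..6} \<Longrightarrow> j \<in> {1..6} \<Longrightarrow> alternating \<phi> \<Longrightarrow> C i (C j \<phi>) = - C j (C i \<phi>)"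
  using cliffordC_anticommute[of \<phi> "contract_mode i" "contract_mode j"] by (simp add: C_def mode_pairings(2))

lemma C_W: "i \<in> {1..6} \<Longrightarrow> j \<in> {1..6} \<Longrightarrow> alternating \<phi> \<Longrightarrow> C i (W j \<phi>) = (if i = j then \<phi> else 0) - W j (C i \<phi>)"
  using cliffordC_anticommute[of \<phi> "contract_mode i" "wedge_mode j"] by (simp add: C_def W_def mode_pairings(3))

lemma form_eq_minus_self: "(\<phi> :: 'v form) = - \<phi> \<Longrightarrow> \<phi> = 0"
  by (auto simp: fun_eq_iff complex_eq_iff)

lemma W_W_self: "i \<in> {1..6} \<Longrightarrow> alternating \<phi> \<Longrightarrow> W i (W i \<phi>) = 0"
  and C_C_self: "i \<in> {1..6} \<Longrightarrow> alternating \<phi> \<Longrightarrow> C i (C i \<phi>) = 0"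
  using W_anticommute[of i i \<phi>] C_anticommute[of i i \<phi>] form_eq_minus_self by blast+

lemma W_swap: "j < i \<Longrightarrow> i \<in> {1..6} \<Longrightarrow> j \<in> {1..6} \<Longrightarrow> alternating \<phi> \<Longrightarrow> W i (W j \<phi>) = - W j (W i \<phi>)"
  and C_swap: "j < i \<Longrightarrow> i \<in> {1..6} \<Longrightarrow> j \<in> {1..6} \<Longrightarrow> alternating \<phi> \<Longrightarrow> C i (C j \<phi>) = - C j (C i \<phi>)"
  by (simp_all add: W_anticommute[of i j] C_anticommute[of i j])

text \<open>
  As simplification rules these bring every word in the modes into normal order, exterior
  multiplications first and indices increasing. An identity between polynomials in the modes thus
  becomes an identity between linear combinations of the same words.
\<close>

lemmas normal_order = C_W W_W_self C_C_self W_swap C_swap mode_linear mode_alternating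

lemma C_unit_form: "C k unit_form = 0"
proof -
  have "covector 0 = (0 :: 'v form)"
    by (auto simp: fun_eq_iff covector_def split: list.split)
  then show ?thesis
    by (simp add: C_def cliffordC_def clifford_def contract_mode_def contract_unit_form wedge_zero_left)
qed

definition "del0 \<phi> = W 1 (W 2 (C 3 \<phi>))"
definition "delb0 \<phi> = W 4 (W 5 (C 6 \<phi>))"
definition "adj \<phi> = W 3 (C 2 (C 1 \<phi>))"
definition "adjb \<phi> = W 6 (C 5 (C 4 \<phi>))"
text \<open>
  Up to a scalar \<open>K\<close> is the action of the complex structure of \<open>L \<oplus> L'\<close> as an element of the spin Lie
  algebra; its eigenvalues are the degrees \<open>k\<close>. The terms in \<open>W 1\<close>, \<open>W 4\<close> are the complex part and the
  others the symplectic part of the structure.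
\<close>

definition "K \<phi> = W 1 (C 1 \<phi>) - W 4 (C 4 \<phi>) - cscale (1/2) (W 2 (W 3 \<phi>)) + cscale 2 (C 2 (C 3 \<phi>))
   + cscale (1/2) (W 5 (W 6 \<phi>)) - cscale 2 (C 5 (C 6 \<phi>))"

lemma clifford_op_del0: "clifford_op T \<Longrightarrow> clifford_op (\<lambda>\<phi>. del0 (T \<phi>))"
  and clifford_op_delb0: "clifford_op T \<Longrightarrow> clifford_op (\<lambda>\<phi>. delb0 (T \<phi>))"
  and clifford_op_adj: "clifford_op T \<Longrightarrow> clifford_op (\<lambda>\<phi>. adj (T \<phi>))"
  and clifford_op_adjb: "clifford_op T \<Longrightarrow> clifford_op (\<lambda>\<phi>. adjb (T \<phi>))"
  and clifford_op_K: "clifford_op T \<Longrightarrow> clifford_op (\<lambda>\<phi>. K (T \<phi>))"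
  unfolding del0_def delb0_def adj_def adjb_def K_def
  by (intro clifford_op_W clifford_op_C clifford_op_add clifford_op_difference clifford_op_cscale; assumption)+

lemma op_del0: "clifford_op del0" and op_delb0: "clifford_op delb0" and op_adj: "clifford_op adj"
  and op_adjb: "clifford_op adjb" and op_K: "clifford_op K"
  using clifford_op_del0[OF clifford_op_id] clifford_op_delb0[OF clifford_op_id]
    clifford_op_adj[OF clifford_op_id] clifford_op_adjb[OF clifford_op_id] clifford_op_K[OF clifford_op_id] by auto

text \<open>
  These relations make the complements of the two Laplacians commute with one half of \<open>d\<close> and annihilate the
  other. The orientation of the equations moves barred operators to the left.
\<close>

lemma laplacian_relations:
  assumes "alternating \<phi>"
  shows "del0 (del0 \<phi>) = 0" "delb0 (delb0 \<phi>) = 0" "del0 (delb0 \<phi>) = - delb0 (del0 \<phi>)"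
    "del0 (adj (del0 \<phi>)) = del0 \<phi>" "delb0 (adjb (delb0 \<phi>)) = delb0 \<phi>"
    "adj (delb0 \<phi>) = - delb0 (adj \<phi>)" "del0 (adjb \<phi>) = - adjb (del0 \<phi>)"
    "adj (adjb \<phi>) = - adjb (adj \<phi>)"
  unfolding del0_def delb0_def adj_def adjb_def by (simp_all add: normal_order assms)

lemma K_shifts:
  assumes "alternating \<phi>"
  shows "K (del0 \<phi>) = del0 (K \<phi>) + del0 \<phi>" "K (delb0 \<phi>) = delb0 (K \<phi>) - delb0 \<phi>"
    "K (adj \<phi>) = adj (K \<phi>) - adj \<phi>" "K (adjb \<phi>) = adjb (K \<phi>) + adjb \<phi>"
  unfolding del0_def delb0_def adj_def adjb_def K_def
  by (simp_all add: normal_order assms)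

text \<open>
  Dual bases of \<open>L\<close>, the annihilator of the pure spinor, and of its conjugate: \<open>up\<close> raises the degree and
  kills the spinor, \<open>down\<close> lowers it. For the symplectic modes they are \<open>X - \<iota>\<^sub>X B\<close> and \<open>X + \<iota>\<^sub>X B\<close> with
  \<open>B = (\<eta>' \<and> \<zeta>' - \<eta> \<and> \<zeta>) / 2\<close>.
\<close>

definition up :: "nat \<Rightarrow> 'v form \<Rightarrow> 'v form" where
  "up a \<phi> = (if a = 1 then C 4 \<phi> else if a = 2 then W 1 \<phi>
     else if a = 3 then C 6 \<phi> + cscale (1/2) (W 5 \<phi>) else if a = 4 then cscale (1/2) (W 6 \<phi>) - C 5 \<phi>
     else if a = 5 then cscale (1/2) (W 2 \<phi>) - C 3 \<phi> else C 2 \<phi> + cscale (1/2) (W 3 \<phi>))"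

definition down :: "nat \<Rightarrow> 'v form \<Rightarrow> 'v form" where
  "down a \<phi> = (if a = 1 then W 4 \<phi> else if a = 2 then C 1 \<phi>
     else if a = 3 then C 5 \<phi> + cscale (1/2) (W 6 \<phi>) else if a = 4 then C 6 \<phi> - cscale (1/2) (W 5 \<phi>)
     else if a = 5 then C 2 \<phi> - cscale (1/2) (W 3 \<phi>) else C 3 \<phi> + cscale (1/2) (W 2 \<phi>))"

lemma op_up: "clifford_op (up a)"
proof -
  have "clifford_op (\<lambda>\<phi>. up a \<phi>)"
    unfolding up_def
    by (cases "a = 1"; cases "a = 2"; cases "a = 3"; cases "a = 4"; cases "a = 5"; simp;
      intro clifford_op_W clifford_op_C clifford_op_add clifford_op_difference clifford_op_cscale clifford_op_id)
  then show ?thesis by simp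
qed

lemma op_down: "clifford_op (down a)"
proof -
  have "clifford_op (\<lambda>\<phi>. down a \<phi>)"
    unfolding down_def
    by (cases "a = 1"; cases "a = 2"; cases "a = 3"; cases "a = 4"; cases "a = 5"; simp;
      intro clifford_op_W clifford_op_C clifford_op_add clifford_op_difference clifford_op_cscale clifford_op_id)
  then show ?thesis by simp
qed

lemma K_up: "a \<in> {1..6} \<Longrightarrow> alternating \<phi> \<Longrightarrow> K (up a \<phi>) = up a (K \<phi>) + up a \<phi>"
  unfolding atLeastAtMost_1_6 K_def
  by (elim insertE emptyE; simp only:; simp add: up_def normal_order; simp add: fun_eq_iff cscale_apply algebra_simps)

lemma K_down: "a \<in> {1..6} \<Longrightarrow> alternating \<phi> \<Longrightarrow> K (down a \<phi>) = down a (K \<phi>) - down a \<phi>"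
  unfolding atLeastAtMost_1_6 K_def
  by (elim insertE emptyE; simp only:; simp add: down_def normal_order; simp add: fun_eq_iff cscale_apply algebra_simps)


text \<open>
  The harmonic projection, a product of the two complements of the Laplacians.
\<close>

definition "hproj \<phi> = (let \<psi> = \<phi> - (delb0 (adjb \<phi>) + adjb (delb0 \<phi>)) in \<psi> - (del0 (adj \<psi>) + adj (del0 \<psi>)))"
definition "d0 \<phi> = del0 \<phi> + delb0 \<phi>"

lemma op_d0: "clifford_op d0"
  unfolding d0_def[abs_def] by (intro clifford_op.intros op_del0 op_delb0)

lemma op_hproj: "clifford_op hproj"
  unfolding hproj_def[abs_def] Let_def
  by (intro clifford_op_difference clifford_op_add clifford_op_del0 clifford_op_delb0 clifford_op_adj clifford_op_adjb clifford_op_id)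

lemmas lap_linear =
  clifford_op_additive[OF op_del0] clifford_op_diff[OF op_del0] clifford_op_minus[OF op_del0] clifford_op_zero[OF op_del0]
  clifford_op_additive[OF op_delb0] clifford_op_diff[OF op_delb0] clifford_op_minus[OF op_delb0] clifford_op_zero[OF op_delb0]
  clifford_op_additive[OF op_adj] clifford_op_diff[OF op_adj] clifford_op_minus[OF op_adj] clifford_op_zero[OF op_adj]
  clifford_op_additive[OF op_adjb] clifford_op_diff[OF op_adjb] clifford_op_minus[OF op_adjb] clifford_op_zero[OF op_adjb]
  
lemmas lap_alternating = clifford_op_alternating[OF op_del0] clifford_op_alternating[OF op_delb0]
  clifford_op_alternating[OF op_adj] clifford_op_alternating[OF op_adjb]

lemma hproj_d0: assumes "alternating \<phi>" shows "hproj (d0 \<phi>) = 0"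
  unfolding hproj_def d0_def Let_def by (simp add: laplacian_relations lap_linear lap_alternating assms)

lemma d0_hproj: assumes "alternating \<phi>" shows "d0 (hproj \<phi>) = 0"
  unfolding hproj_def d0_def Let_def 
  by (simp add: laplacian_relations lap_linear lap_alternating alternating_diff alternating_add assms)

text \<open>
  For closed \<open>\<phi>\<close> each Laplacian is \<open>d\<close> applied to an adjoint, as that adjoint anticommutes with the other
  half of \<open>d\<close>.
\<close>

lemma closed_minus_hproj:
  assumes "alternating \<phi>" "d0 \<phi> = 0"
  shows "\<phi> - hproj \<phi> = d0 (adjb \<phi> + adj (\<phi> - (delb0 (adjb \<phi>) + adjb (delb0 \<phi>))))"
proof -
  have d: "del0 \<phi> = - delb0 \<phi>" using assms(2) unfolding d0_def by (simp add: add_eq_0_iff)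
  show ?thesis
    unfolding hproj_def d0_def Let_def 
    by (simp add: laplacian_relations lap_linear lap_alternating alternating_diff alternating_add assms d)
qed

definition eig :: "int \<Rightarrow> 'v form set" where
  "eig k = {\<phi>. alternating \<phi> \<and> K \<phi> = cscale (of_int k) \<phi>}"

lemma eig_alternating: "\<phi> \<in> eig k \<Longrightarrow> alternating \<phi>" by (simp add: eig_def)

lemma eig_add: "\<phi> \<in> eig k \<Longrightarrow> \<psi> \<in> eig k \<Longrightarrow> \<phi> + \<psi> \<in> eig k"
  by (simp add: eig_def alternating_add clifford_op_additive[OF op_K] cform.scale_right_distrib)
lemma eig_cscale: "\<phi> \<in> eig k \<Longrightarrow> cscale c \<phi> \<in> eig k"
  by (simp add: eig_def alternating_cscale clifford_op_homogeneous[OF op_K] mult.commute)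
lemma eig_zero: "0 \<in> eig k"
  by (simp add: eig_def alternating_zero clifford_op_zero[OF op_K])
lemma eig_diff: "\<phi> \<in> eig k \<Longrightarrow> \<psi> \<in> eig k \<Longrightarrow> \<phi> - \<psi> \<in> eig k"
  using eig_add[of \<phi> k "cscale (-1) \<psi>"] eig_cscale[of \<psi> k "-1"] by simp
lemma eig_sum: "(\<And>i. i \<in> I \<Longrightarrow> f i \<in> eig k) \<Longrightarrow> sum f I \<in> eig k"
  by (induction I rule: infinite_finite_induct) (simp_all add: eig_zero eig_add)

lemma eig_shift:
  assumes "clifford_op T" "\<And>\<phi>. alternating \<phi> \<Longrightarrow> K (T \<phi>) = T (K \<phi>) + cscale (of_int s) (T \<phi>)" "\<phi> \<in> eig k"
  shows "T \<phi> \<in> eig (k + s)"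
proof -
  have "alternating \<phi>" "K \<phi> = cscale (of_int k) \<phi>" using assms(3) by (auto simp: eig_def)
  moreover from this have "K (T \<phi>) = cscale (of_int k) (T \<phi>) + cscale (of_int s) (T \<phi>)"
    by (simp only: assms(2) clifford_op_homogeneous[OF assms(1)])
  ultimately show ?thesis
    using clifford_op_alternating[OF assms(1)] by (simp add: eig_def cform.scale_left_distrib)
qed

lemma eig_up: "a \<in> {1..6} \<Longrightarrow> \<phi> \<in> eig k \<Longrightarrow> up a \<phi> \<in> eig (k + 1)"
  by (rule eig_shift[OF op_up]) (auto simp: K_up)
lemma eig_down: "a \<in> {1..6} \<Longrightarrow> \<phi> \<in> eig k \<Longrightarrow> down a \<phi> \<in> eig (k - 1)"
  using eig_shift[OF op_down, of a "-1" \<phi> k] by (simp add: K_down)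
lemma eig_del0: "\<phi> \<in> eig k \<Longrightarrow> del0 \<phi> \<in> eig (k + 1)" and eig_adjb: "\<phi> \<in> eig k \<Longrightarrow> adjb \<phi> \<in> eig (k + 1)"
  by (rule eig_shift[OF op_del0] eig_shift[OF op_adjb]; simp add: K_shifts)+
lemma eig_delb0: "\<phi> \<in> eig k \<Longrightarrow> delb0 \<phi> \<in> eig (k - 1)" and eig_adj: "\<phi> \<in> eig k \<Longrightarrow> adj \<phi> \<in> eig (k - 1)"
  using eig_shift[OF op_delb0, of "-1" \<phi> k] eig_shift[OF op_adj, of "-1" \<phi> k] by (simp_all add: K_shifts)

lemma eig_hproj: assumes "\<phi> \<in> eig k" shows "hproj \<phi> \<in> eig k"
proof -
  have 1: "delb0 (adjb \<psi>) + adjb (delb0 \<psi>) \<in> eig k" "del0 (adj \<psi>) + adj (del0 \<psi>) \<in> eig k" if "\<psi> \<in> eig k" for \<psi>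
    using eig_del0[OF eig_adj, OF that] eig_adj[OF eig_del0, OF that]
      eig_delb0[OF eig_adjb, OF that] eig_adjb[OF eig_delb0, OF that]
    by (auto intro: eig_add)
  show ?thesis unfolding hproj_def Let_def by (intro eig_diff 1 assms)
qed

text \<open>
  The inverse of the change of basis from modes to \<open>up\<close> and \<open>down\<close>. It shows that every mode changes the degree
  by \<open>1\<close> or \<open>-1\<close>.
\<close>

lemma mode_split:
  assumes "k \<in> {1..6}"
  shows "\<exists>a\<in>{1..6}. \<exists>b\<in>{1..6}. \<exists>s t. \<forall>\<phi>. W k \<phi> = cscale s (up a \<phi>) + cscale t (down b \<phi>)"
    and "\<exists>a\<in>{1..6}. \<exists>b\<in>{1..6}. \<exists>s t. \<forall>\<phi>. C k \<phi> = cscale s (up a \<phi>) + cscale t (down b \<phi>)"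
proof -
  have w: "W 1 \<phi> = cscale 1 (up 2 \<phi>) + cscale 0 (down 1 \<phi>)" 
    "W 4 \<phi> = cscale 0 (up 2 \<phi>) + cscale 1 (down 1 \<phi>)"
    "W 2 \<phi> = cscale 1 (up 5 \<phi>) + cscale 1 (down 6 \<phi>)"
    "W 3 \<phi> = cscale 1 (up 6 \<phi>) + cscale (-1) (down 5 \<phi>)"
    "W 5 \<phi> = cscale 1 (up 3 \<phi>) + cscale (-1) (down 4 \<phi>)"
    "W 6 \<phi> = cscale 1 (up 4 \<phi>) + cscale 1 (down 3 \<phi>)" for \<phi>
    by (simp_all add: up_def down_def, simp_all add: fun_eq_iff cscale_apply)
  have c: "C 1 \<phi> = cscale 0 (up 2 \<phi>) + cscale 1 (down 2 \<phi>)" 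
    "C 4 \<phi> = cscale 1 (up 1 \<phi>) + cscale 0 (down 1 \<phi>)"
    "C 2 \<phi> = cscale (1/2) (up 6 \<phi>) + cscale (1/2) (down 5 \<phi>)"
    "C 3 \<phi> = cscale (-1/2) (up 5 \<phi>) + cscale (1/2) (down 6 \<phi>)"
    "C 5 \<phi> = cscale (-1/2) (up 4 \<phi>) + cscale (1/2) (down 3 \<phi>)"
    "C 6 \<phi> = cscale (1/2) (up 3 \<phi>) + cscale (1/2) (down 4 \<phi>)" for \<phi>
    by (simp_all add: up_def down_def, simp_all add: fun_eq_iff cscale_apply field_simps)
  have k: "k = 1 \<or> k = 2 \<or> k = 3 \<or> k = 4 \<or> k = 5 \<or> k = 6" using assms by auto
  have m: "1 \<in> {1..6::nat}" "2 \<in> {1..6::nat}" "3 \<in> {1..6::nat}" "4 \<in> {1..6::nat}" "5 \<in> {1..6::nat}" "6 \<in> {1..6::nat}"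
    by auto
  show "\<exists>a\<in>{1..6}. \<exists>b\<in>{1..6}. \<exists>s t. \<forall>\<phi>. W k \<phi> = cscale s (up a \<phi>) + cscale t (down b \<phi>)"
    using k by (elim disjE; simp only:) (rule bexI, rule bexI, rule exI, rule exI, rule allI, rule w, rule m, rule m)+
  show "\<exists>a\<in>{1..6}. \<exists>b\<in>{1..6}. \<exists>s t. \<forall>\<phi>. C k \<phi> = cscale s (up a \<phi>) + cscale t (down b \<phi>)"
    using k by (elim disjE; simp only:) (rule bexI, rule bexI, rule exI, rule exI, rule allI, rule c, rule m, rule m)+
qed

subsection \<open>The pure spinor\<close>

text \<open>
  Exterior multiplication with the exponent of the pure spinor.
\<close>

definition two_form_op :: "'v form \<Rightarrow> 'v form" where
  "two_form_op \<phi> = cscale (1/2) (W 5 (W 6 \<phi>)) - cscale (1/2) (W 2 (W 3 \<phi>))"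

definition vacuum :: "'v form" where
  "vacuum = (let \<theta> = W 1 unit_form in \<theta> + two_form_op \<theta> + cscale (1/2) (two_form_op (two_form_op \<theta>)))"

lemma vacuum_explicit:
  "vacuum = W 1 unit_form + cscale (1/2) (W 5 (W 6 (W 1 unit_form))) - cscale (1/2) (W 2 (W 3 (W 1 unit_form)))
     - cscale (1/4) (W 2 (W 3 (W 5 (W 6 (W 1 unit_form)))))"
  unfolding vacuum_def Let_def two_form_op_def
  by (simp add: normal_order alternating_unit_form; simp add: fun_eq_iff cscale_apply algebra_simps)

lemma alternating_vacuum: "alternating vacuum"
  unfolding vacuum_explicit
  by (intro alternating_add alternating_diff alternating_cscale mode_alternating alternating_unit_form)

lemma up_vacuum: "a \<in> {1..6} \<Longrightarrow> up a vacuum = 0"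
  unfolding atLeastAtMost_1_6 vacuum_explicit
  by (elim insertE emptyE; simp only:; simp add: up_def normal_order alternating_unit_form C_unit_form;
     simp add: fun_eq_iff cscale_apply algebra_simps)

text \<open>
  Multiplying by \<open>\<eta>, \<zeta>, \<eta>', \<zeta>'\<close> kills all but the lowest term of the exponential. So the spinor generates
  every form under the Clifford action.
\<close>

lemma unit_from_vacuum:
  "unit_form = C 6 (C 5 (C 3 (C 2 (C 1 (W 2 (W 3 (W 5 (W 6 vacuum))))))))"
  unfolding vacuum_explicit by (simp add: normal_order alternating_unit_form C_unit_form)

lemma vacuum_nonzero: "vacuum \<noteq> 0"
proof
  assume "vacuum = 0"
  then have "unit_form = (0 :: 'v form)" using unit_from_vacuum by (simp add: mode_linear)
  from fun_cong[OF this, of "[]"] show False by (simp add: unit_form_def)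
qed

lemma eig_vacuum: "vacuum \<in> eig 3"
  unfolding eig_def K_def mem_Collect_eq vacuum_explicit
  by (intro conjI alternating_add alternating_diff alternating_cscale mode_alternating alternating_unit_form;
     simp add: normal_order alternating_unit_form C_unit_form;
     simp add: fun_eq_iff cscale_apply algebra_simps)

lemma down_anticommute:
  assumes "a \<in> {1..6}" "b \<in> {1..6}" and [simp]: "alternating \<phi>"
  shows "down a (down b \<phi>) = - down b (down a \<phi>)"
proof -
  have "a = 1 \<or> a = 2 \<or> a = 3 \<or> a = 4 \<or> a = 5 \<or> a = 6" "b = 1 \<or> b = 2 \<or> b = 3 \<or> b = 4 \<or> b = 5 \<or> b = 6"
    using assms by auto
  then have "down a (down b \<phi>) + down b (down a \<phi>) = 0"
    by (elim disjE; simp only:; simp add: down_def normal_order; simp add: fun_eq_iff cscale_apply algebra_simps)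
  then show ?thesis by (simp add: eq_neg_iff_add_eq_0)
qed

lemma up_down: "a \<in> {1..6} \<Longrightarrow> b \<in> {1..6} \<Longrightarrow> alternating \<phi> \<Longrightarrow> up a (down b \<phi>) = (if a = b then \<phi> else 0) - down b (up a \<phi>)"
proof -
  assume h: "a \<in> {1..6}" "b \<in> {1..6}" and [simp]: "alternating \<phi>"
  have "a = 1 \<or> a = 2 \<or> a = 3 \<or> a = 4 \<or> a = 5 \<or> a = 6" "b = 1 \<or> b = 2 \<or> b = 3 \<or> b = 4 \<or> b = 5 \<or> b = 6"
    using h by auto
  then show ?thesis
    by (elim disjE; simp only:; simp add: down_def up_def normal_order; simp add: fun_eq_iff cscale_apply algebra_simps)
qed

end


section \<open>The spaces \<open>U\<^sup>k\<close> as eigenspaces\<close>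

context coframe begin

lemma covector_wedge_expansion:
  "covector \<xi> \<and>\<^sub>f \<phi> = (\<Sum>k\<in>{1..6}. cscale (complex_of_real (blinfun_apply \<xi> (X k))) (covector (\<epsilon> k) \<and>\<^sub>f \<phi>))"
proof -
  have "blinfun_apply \<xi> v = (\<Sum>k\<in>{1..6}. blinfun_apply \<xi> (X k) * blinfun_apply (\<epsilon> k) v)" for v
  proof -
    have "blinfun_apply \<xi> v = blinfun_apply \<xi> (\<Sum>k\<in>{1..6}. blinfun_apply (\<epsilon> k) v *\<^sub>R X k)" by (simp only: expand)
    then show ?thesis by (simp add: blinfun.sum_right blinfun.scaleR_right mult.commute)
  qed
  note exp = this
  have "covector \<xi> vs = (\<Sum>k\<in>{1..6}. cscale (complex_of_real (blinfun_apply \<xi> (X k))) (covector (\<epsilon> k))) vs" for vs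
  proof (cases "\<exists>v. vs = [v]")
    case True
    then obtain v where "vs = [v]" by blast
    then show ?thesis using arg_cong[OF exp[of v], of complex_of_real]
      by (simp add: sum_fun_apply cscale_apply covector_def)
  qed (auto simp: sum_fun_apply cscale_apply covector_def split: list.split)
  then have "covector \<xi> = (\<Sum>k\<in>{1..6}. cscale (complex_of_real (blinfun_apply \<xi> (X k))) (covector (\<epsilon> k)))" by blast
  moreover have "sum f I \<and>\<^sub>f \<phi> = (\<Sum>i\<in>I. f i \<and>\<^sub>f \<phi>)" for f :: "nat \<Rightarrow> 'v form" and I
    by (induction I rule: infinite_finite_induct)
       (simp_all only: sum.infinite sum.empty sum.insert wedge_zero_left wedge_add_left not_False_eq_True)
  ultimately show ?thesis by (simp add: wedge_cscale_left)
qed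

lemma clifford_expansion:
  assumes "alternating \<phi>"
  shows "clifford a \<phi> = (\<Sum>k\<in>{1..6}. cscale (complex_of_real (blinfun_apply (\<epsilon> k) (fst a))) (contract (X k) \<phi>)
     + cscale (complex_of_real (blinfun_apply (snd a) (X k))) (covector (\<epsilon> k) \<and>\<^sub>f \<phi>))"
proof -
  have 1: "contract v \<phi> = (\<Sum>k\<in>{1..6}. cscale (complex_of_real (blinfun_apply (\<epsilon> k) v)) (contract (X k) \<phi>))" for v
  proof
    fix vs
    have "linear (\<lambda>v. contract v \<phi> vs)"
      using alternating_linear_append[OF assms, of "[]" vs] by (simp add: contract_def)
    from linear_frame_expansion[of \<epsilon> X "{1..6}" "\<lambda>v. contract v \<phi>" vs v, OF expand _ this]
    show "contract v \<phi> vs = (\<Sum>k\<in>{1..6}. cscale (complex_of_real (blinfun_apply (\<epsilon> k) v)) (contract (X k) \<phi>)) vs"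
      by (simp add: sum_fun_apply cscale_apply)
  qed
  show ?thesis unfolding clifford_def sum.distrib 1[symmetric] covector_wedge_expansion[symmetric] ..
qed

lemma real_modes:
  assumes "alternating \<phi>"
  shows "contract (X (Suc 0)) \<phi> = C 1 \<phi> + C 4 \<phi>" "contract (X 3) \<phi> = C 2 \<phi> + C 5 \<phi>" "contract (X 5) \<phi> = C 3 \<phi> + C 6 \<phi>"
    "contract (X 2) \<phi> = cscale \<i> (C 1 \<phi> - C 4 \<phi>)" "contract (X 4) \<phi> = cscale \<i> (C 2 \<phi> - C 5 \<phi>)"
    "contract (X 6) \<phi> = cscale \<i> (C 3 \<phi> - C 6 \<phi>)"
    "covector (\<epsilon> (Suc 0)) \<and>\<^sub>f \<phi> = cscale (1/2) (W 1 \<phi> + W 4 \<phi>)" "covector (\<epsilon> 3) \<and>\<^sub>f \<phi> = cscale (1/2) (W 2 \<phi> + W 5 \<phi>)"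
    "covector (\<epsilon> 5) \<and>\<^sub>f \<phi> = cscale (1/2) (W 3 \<phi> + W 6 \<phi>)"
    "covector (\<epsilon> 2) \<and>\<^sub>f \<phi> = cscale (- \<i>/2) (W 1 \<phi> - W 4 \<phi>)" "covector (\<epsilon> 4) \<and>\<^sub>f \<phi> = cscale (- \<i>/2) (W 2 \<phi> - W 5 \<phi>)"
    "covector (\<epsilon> 6) \<and>\<^sub>f \<phi> = cscale (- \<i>/2) (W 3 \<phi> - W 6 \<phi>)"
proof -
  have c0: "covector 0 = (0 :: 'v form)" and cm: "covector (- \<xi>) = - (covector \<xi> :: 'v form)" for \<xi>
    by (auto simp: fun_eq_iff covector_def blinfun.minus_left split: list.split)
  note al = alternating_contract_linear[OF assms]
  have W: "cliffordC ((0, \<xi>), (0, \<eta>)) \<phi> = covector \<xi> \<and>\<^sub>f \<phi> + cscale \<i> (covector \<eta> \<and>\<^sub>f \<phi>)" for \<xi> \<eta>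
    by (simp add: cliffordC_def clifford_def al)
  have C: "cliffordC ((r *\<^sub>R v, 0), (s *\<^sub>R w, 0)) \<phi> = cscale (complex_of_real r) (contract v \<phi>) + cscale (\<i> * complex_of_real s) (contract w \<phi>)" for r s v w
    by (simp add: cliffordC_def clifford_def al c0 wedge_zero_left)
  have C': "C 1 \<phi> = cscale (1/2) (contract (X (Suc 0)) \<phi>) - cscale (\<i>/2) (contract (X 2) \<phi>)"
    "C 2 \<phi> = cscale (1/2) (contract (X 3) \<phi>) - cscale (\<i>/2) (contract (X 4) \<phi>)"
    "C 3 \<phi> = cscale (1/2) (contract (X 5) \<phi>) - cscale (\<i>/2) (contract (X 6) \<phi>)"
    "C 4 \<phi> = cscale (1/2) (contract (X (Suc 0)) \<phi>) + cscale (\<i>/2) (contract (X 2) \<phi>)"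
    "C 5 \<phi> = cscale (1/2) (contract (X 3) \<phi>) + cscale (\<i>/2) (contract (X 4) \<phi>)"
    "C 6 \<phi> = cscale (1/2) (contract (X 5) \<phi>) + cscale (\<i>/2) (contract (X 6) \<phi>)"
    using C[of "1/2" _ "-1/2"] C[of "1/2" _ "1/2"] by (simp_all add: C_def contract_mode_def)
  have W': "W 1 \<phi> = covector (\<epsilon> (Suc 0)) \<and>\<^sub>f \<phi> + cscale \<i> (covector (\<epsilon> 2) \<and>\<^sub>f \<phi>)"
    "W 2 \<phi> = covector (\<epsilon> 3) \<and>\<^sub>f \<phi> + cscale \<i> (covector (\<epsilon> 4) \<and>\<^sub>f \<phi>)"
    "W 3 \<phi> = covector (\<epsilon> 5) \<and>\<^sub>f \<phi> + cscale \<i> (covector (\<epsilon> 6) \<and>\<^sub>f \<phi>)"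
    "W 4 \<phi> = covector (\<epsilon> (Suc 0)) \<and>\<^sub>f \<phi> - cscale \<i> (covector (\<epsilon> 2) \<and>\<^sub>f \<phi>)"
    "W 5 \<phi> = covector (\<epsilon> 3) \<and>\<^sub>f \<phi> - cscale \<i> (covector (\<epsilon> 4) \<and>\<^sub>f \<phi>)"
    "W 6 \<phi> = covector (\<epsilon> 5) \<and>\<^sub>f \<phi> - cscale \<i> (covector (\<epsilon> 6) \<and>\<^sub>f \<phi>)"
    by (simp_all add: W_def wedge_mode_def W cm wedge_minus_left)
  show "contract (X (Suc 0)) \<phi> = C 1 \<phi> + C 4 \<phi>" "contract (X 3) \<phi> = C 2 \<phi> + C 5 \<phi>" "contract (X 5) \<phi> = C 3 \<phi> + C 6 \<phi>"
    "contract (X 2) \<phi> = cscale \<i> (C 1 \<phi> - C 4 \<phi>)" "contract (X 4) \<phi> = cscale \<i> (C 2 \<phi> - C 5 \<phi>)"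
    "contract (X 6) \<phi> = cscale \<i> (C 3 \<phi> - C 6 \<phi>)"
    unfolding C' by (simp_all add: fun_eq_iff cscale_apply field_simps)
  show "covector (\<epsilon> (Suc 0)) \<and>\<^sub>f \<phi> = cscale (1/2) (W 1 \<phi> + W 4 \<phi>)" "covector (\<epsilon> 3) \<and>\<^sub>f \<phi> = cscale (1/2) (W 2 \<phi> + W 5 \<phi>)"
    "covector (\<epsilon> 5) \<and>\<^sub>f \<phi> = cscale (1/2) (W 3 \<phi> + W 6 \<phi>)"
    "covector (\<epsilon> 2) \<and>\<^sub>f \<phi> = cscale (- \<i>/2) (W 1 \<phi> - W 4 \<phi>)" "covector (\<epsilon> 4) \<and>\<^sub>f \<phi> = cscale (- \<i>/2) (W 2 \<phi> - W 5 \<phi>)"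
    "covector (\<epsilon> 6) \<and>\<^sub>f \<phi> = cscale (- \<i>/2) (W 3 \<phi> - W 6 \<phi>)"
    unfolding W' by (simp_all add: fun_eq_iff cscale_apply field_simps)
qed

definition bar :: "nat \<Rightarrow> nat" where "bar k = (if k \<le> 3 then k + 3 else k - 3)"

lemma mode_expansion:
  "\<exists>x y. \<forall>\<phi>. alternating \<phi> \<longrightarrow>
     cliffordC v \<phi> = (\<Sum>k\<in>{1..6}. cscale (x k) (C k \<phi>) + cscale (y k) (W k \<phi>)) \<and>
     cliffordC (conj_gtan v) \<phi> = (\<Sum>k\<in>{1..6}. cscale (cnj (x k)) (C (bar k) \<phi>) + cscale (cnj (y k)) (W (bar k) \<phi>))"
proof -
  \<comment> \<open>The coefficients of \<open>v\<close> in the real frame and, as \<open>x\<close> and \<open>y\<close>, in the complex modes.\<close>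
  define \<alpha> where "\<alpha> k = Complex (blinfun_apply (\<epsilon> k) (fst (fst v))) (blinfun_apply (\<epsilon> k) (fst (snd v)))" for k
  define \<beta> where "\<beta> k = Complex (blinfun_apply (snd (fst v)) (X k)) (blinfun_apply (snd (snd v)) (X k))" for k
  define x where "x k = (if k \<le> 3 then \<alpha> (2*k-1) + \<i> * \<alpha> (2*k) else \<alpha> (2*k-7) - \<i> * \<alpha> (2*k-6))" for k
  define y where "y k = (if k \<le> 3 then \<beta> (2*k-1) - \<i> * \<beta> (2*k) else \<beta> (2*k-7) + \<i> * \<beta> (2*k-6)) / 2" for k
  have "cliffordC v \<phi> = (\<Sum>k\<in>{1..6}. cscale (x k) (C k \<phi>) + cscale (y k) (W k \<phi>)) \<and>
     cliffordC (conj_gtan v) \<phi> = (\<Sum>k\<in>{1..6}. cscale (cnj (x k)) (C (bar k) \<phi>) + cscale (cnj (y k)) (W (bar k) \<phi>))"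
    if \<phi>: "alternating \<phi>" for \<phi>
  proof -
    have 1: "cliffordC v \<phi> = (\<Sum>k\<in>{1..6}. cscale (\<alpha> k) (contract (X k) \<phi>) + cscale (\<beta> k) (covector (\<epsilon> k) \<and>\<^sub>f \<phi>))"
      by (auto simp: cliffordC_def clifford_expansion[OF \<phi>] fun_eq_iff sum_fun_apply cscale_apply \<alpha>_def \<beta>_def
        complex_eq_iff sum_distrib_left algebra_simps simp flip: sum.distrib)
    have 2: "cliffordC (conj_gtan v) \<phi> = (\<Sum>k\<in>{1..6}. cscale (cnj (\<alpha> k)) (contract (X k) \<phi>) + cscale (cnj (\<beta> k)) (covector (\<epsilon> k) \<and>\<^sub>f \<phi>))"
      by (auto simp: cliffordC_def conj_gtan_def clifford_expansion[OF \<phi>] fun_eq_iff sum_fun_apply cscale_apply \<alpha>_def \<beta>_def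
        complex_eq_iff sum_distrib_left algebra_simps blinfun.minus_left blinfun.minus_right simp flip: sum.distrib)
    show ?thesis
      unfolding 1 2 atLeastAtMost_1_6
      by (auto simp: real_modes[OF \<phi>] x_def y_def bar_def fun_eq_iff cscale_apply field_simps simp flip: numeral_2_eq_2)
  qed
  then show ?thesis by blast
qed

text \<open>
  An element of \<open>L\<close> is orthogonal to each \<open>up a\<close>, since their anticommutator is a scalar that kills the
  spinor. These six linear equations leave the span of the \<open>up a\<close> only, and conjugation maps that to
  the span of the \<open>down a\<close>.
\<close>

lemma vacuum_annihilator_conj:
  assumes "v \<in> annihilator vacuum"
  shows "\<exists>c. \<forall>\<phi>. alternating \<phi> \<longrightarrow> cliffordC (conj_gtan v) \<phi> = (\<Sum>a\<in>{1..6}. cscale (c a) (down a \<phi>))"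
proof -
  obtain x y where xy: "\<And>\<phi>. alternating \<phi> \<Longrightarrow> 
     cliffordC v \<phi> = (\<Sum>k\<in>{1..6}. cscale (x k) (C k \<phi>) + cscale (y k) (W k \<phi>)) \<and>
     cliffordC (conj_gtan v) \<phi> = (\<Sum>k\<in>{1..6}. cscale (cnj (x k)) (C (bar k) \<phi>) + cscale (cnj (y k)) (W (bar k) \<phi>))"
    using mode_expansion by blast
  have z: "cliffordC v vacuum = 0" using assms by (simp add: annihilator_def)
  have ann: "up a (cliffordC v vacuum) + cliffordC v (up a vacuum) = cscale c vacuum \<Longrightarrow> a \<in> {1..6} \<Longrightarrow> c = 0" for a c
    using vacuum_nonzero up_vacuum[of a] clifford_op_zero[OF op_up, of a] xy[OF alternating_zero]
    by (auto simp: z mode_linear)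
  have e: "x 1 = 0" "y 4 = 0" "y 2 = - x 3 / 2" "y 3 = x 2 / 2" "y 5 = x 6 / 2" "y 6 = - x 5 / 2"
  proof -
    have E: "alternating \<phi> \<Longrightarrow> cliffordC v \<phi> =
        cscale (x 1) (C 1 \<phi>) + cscale (y 1) (W 1 \<phi>) + cscale (x 2) (C 2 \<phi>) + cscale (y 2) (W 2 \<phi>)
      + cscale (x 3) (C 3 \<phi>) + cscale (y 3) (W 3 \<phi>) + cscale (x 4) (C 4 \<phi>) + cscale (y 4) (W 4 \<phi>)
      + cscale (x 5) (C 5 \<phi>) + cscale (y 5) (W 5 \<phi>) + cscale (x 6) (C 6 \<phi>) + cscale (y 6) (W 6 \<phi>)" for \<phi>
      using xy[THEN conjunct1, of \<phi>] unfolding atLeastAtMost_1_6 by (simp add: add.assoc)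
    note S = E alternating_vacuum up_def normal_order alternating_add alternating_diff alternating_cscale
    show "x 1 = 0" by (rule ann[of 2]) (simp_all add: S, simp add: fun_eq_iff cscale_apply algebra_simps)
    show "y 4 = 0" by (rule ann[of 1]) (simp_all add: S, simp add: fun_eq_iff cscale_apply algebra_simps)
    have "y 2 + x 3 / 2 = 0" by (rule ann[of 6]) (simp_all add: S, simp add: fun_eq_iff cscale_apply field_simps)
    then show "y 2 = - x 3 / 2" by (simp add: eq_neg_iff_add_eq_0)
    have "y 6 + x 5 / 2 = 0" by (rule ann[of 3]) (simp_all add: S, simp add: fun_eq_iff cscale_apply field_simps)
    then show "y 6 = - x 5 / 2" by (simp add: eq_neg_iff_add_eq_0)
    have "x 2 / 2 - y 3 = 0" by (rule ann[of 5]) (simp_all add: S, simp add: fun_eq_iff cscale_apply field_simps)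
    then show "y 3 = x 2 / 2" by simp
    have "x 6 / 2 - y 5 = 0" by (rule ann[of 4]) (simp_all add: S, simp add: fun_eq_iff cscale_apply field_simps)
    then show "y 5 = x 6 / 2" by simp
  qed
  define c where "c a = cnj (if a = 1 then y 1 else if a = 2 then x 4 else if a = 3 then x 2 else if a = 4 then x 3
     else if a = 5 then x 5 else x 6)" for a :: nat
  have "cliffordC (conj_gtan v) \<phi> = (\<Sum>a\<in>{1..6}. cscale (c a) (down a \<phi>))" if "alternating \<phi>" for \<phi>
    unfolding xy[OF that, THEN conjunct2] atLeastAtMost_1_6
    by (simp add: bar_def c_def down_def) (simp add: e e(1)[simplified] fun_eq_iff cscale_apply field_simps)
  then show ?thesis by blast
qed


text \<open>
  The span of the increasing words in \<open>down 1, \<dots>, down n\<close> applied to the spinor. Restricting to increasing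
  words bounds their length, so that no degree below \<open>-3\<close> occurs.
\<close>

primrec fock :: "nat \<Rightarrow> 'v form set" where
  "fock 0 = range (\<lambda>c. cscale c vacuum)"
| "fock (Suc n) = {\<phi> + down (Suc n) \<psi> | \<phi> \<psi>. \<phi> \<in> fock n \<and> \<psi> \<in> fock n}"

lemma fock_alternating: "\<phi> \<in> fock n \<Longrightarrow> alternating \<phi>"
  by (induction n arbitrary: \<phi>)
     (auto intro!: alternating_cscale alternating_vacuum alternating_add clifford_op_alternating[OF op_down])

lemma fock_SucI: "\<alpha> \<in> fock n \<Longrightarrow> \<beta> \<in> fock n \<Longrightarrow> \<alpha> + down (Suc n) \<beta> \<in> fock (Suc n)"
  by auto

lemma fock_cscale: "\<phi> \<in> fock n \<Longrightarrow> cscale c \<phi> \<in> fock n"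
proof (induction n arbitrary: \<phi>)
  case (Suc n)
  then obtain \<alpha> \<beta> where h: "\<phi> = \<alpha> + down (Suc n) \<beta>" "\<alpha> \<in> fock n" "\<beta> \<in> fock n" by auto
  have "cscale c \<phi> = cscale c \<alpha> + down (Suc n) (cscale c \<beta>)"
    by (simp only: h(1) cform.scale_right_distrib clifford_op_homogeneous[OF op_down])
  then show ?case using fock_SucI[OF Suc.IH[OF h(2)] Suc.IH[OF h(3)]] by (simp only:)
qed auto

lemma fock_add: "\<phi> \<in> fock n \<Longrightarrow> \<psi> \<in> fock n \<Longrightarrow> \<phi> + \<psi> \<in> fock n"
proof (induction n arbitrary: \<phi> \<psi>)
  case 0
  then obtain c c' where "\<phi> = cscale c vacuum" "\<psi> = cscale c' vacuum" by auto
  then have "\<phi> + \<psi> = cscale (c + c') vacuum" by (simp only: cform.scale_left_distrib)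
  then show "\<phi> + \<psi> \<in> fock 0" unfolding fock.simps by (rule range_eqI)
next
  case (Suc n)
  then obtain \<alpha> \<beta> where h: "\<phi> = \<alpha> + down (Suc n) \<beta>" "\<alpha> \<in> fock n" "\<beta> \<in> fock n" by auto
  from Suc obtain \<alpha>' \<beta>' where h': "\<psi> = \<alpha>' + down (Suc n) \<beta>'" "\<alpha>' \<in> fock n" "\<beta>' \<in> fock n" by auto
  have "\<phi> + \<psi> = (\<alpha> + \<alpha>') + down (Suc n) (\<beta> + \<beta>')"
    by (simp only: h(1) h'(1) clifford_op_additive[OF op_down] ac_simps)
  then show ?case using fock_SucI[OF Suc.IH[OF h(2) h'(2)] Suc.IH[OF h(3) h'(3)]] by (simp only:)
qed

lemma zero_in_fock: "0 \<in> fock n"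
proof (induction n)
  case 0 show "0 \<in> fock 0" using range_eqI[of 0 "\<lambda>c. cscale c vacuum" 0] by simp
next
  case (Suc n) then show ?case using fock_SucI[OF Suc Suc] by (simp only: clifford_op_zero[OF op_down] add_0)
qed

lemma fock_diff: "\<phi> \<in> fock n \<Longrightarrow> \<psi> \<in> fock n \<Longrightarrow> \<phi> - \<psi> \<in> fock n"
  using fock_add[of \<phi> n "cscale (-1) \<psi>"] fock_cscale[of \<psi> n "-1"] by simp

lemma fock_up: "n \<le> 6 \<Longrightarrow> a \<in> {1..6} \<Longrightarrow> \<phi> \<in> fock n \<Longrightarrow> up a \<phi> \<in> fock n"
proof (induction n arbitrary: \<phi>)
  case 0 then show ?case
    by (auto simp: clifford_op_homogeneous[OF op_up] up_vacuum intro: range_eqI[of _ _ 0])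
next
  case (Suc n)
  then obtain \<alpha> \<beta> where h: "\<phi> = \<alpha> + down (Suc n) \<beta>" "\<alpha> \<in> fock n" "\<beta> \<in> fock n" by auto
  have "up a \<phi> = (up a \<alpha> + (if a = Suc n then \<beta> else 0)) + down (Suc n) (cscale (-1) (up a \<beta>))"
    using Suc.prems fock_alternating[OF h(3)]
    by (simp add: h clifford_op_additive[OF op_up] up_down clifford_op_minus[OF op_down])
  also have "\<dots> \<in> fock (Suc n)"
    using Suc h by (intro fock_SucI fock_add fock_cscale) (auto simp: zero_in_fock)
  finally show ?case .
qed

lemma fock_down: "n \<le> 6 \<Longrightarrow> a \<in> {1..n} \<Longrightarrow> \<phi> \<in> fock n \<Longrightarrow> down a \<phi> \<in> fock n"
proof (induction n arbitrary: \<phi>)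
  case (Suc n)
  then obtain \<alpha> \<beta> where h: "\<phi> = \<alpha> + down (Suc n) \<beta>" "\<alpha> \<in> fock n" "\<beta> \<in> fock n" by auto
  have anti: "down a (down (Suc n) \<beta>) = - down (Suc n) (down a \<beta>)"
    by (rule down_anticommute) (use Suc.prems fock_alternating[OF h(3)] in auto)
  show ?case
  proof (cases "a = Suc n")
    case True
    with anti have "down a (down (Suc n) \<beta>) = 0" by (simp add: form_eq_minus_self)
    then have "down a \<phi> = 0 + down (Suc n) \<alpha>" by (simp add: h clifford_op_additive[OF op_down] True)
    then show ?thesis using fock_SucI[OF zero_in_fock h(2)] by simp
  next
    case False
    have "down a \<phi> = down a \<alpha> + down (Suc n) (cscale (-1) (down a \<beta>))"
      by (simp add: h clifford_op_additive[OF op_down] anti clifford_op_minus[OF op_down])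
    also have "\<dots> \<in> fock (Suc n)"
      using Suc h False by (intro fock_SucI fock_add fock_cscale) auto
    finally show ?thesis .
  qed
qed auto

lemma fock_modes:
  assumes "k \<in> {1..6}" "\<phi> \<in> fock 6" shows "W k \<phi> \<in> fock 6" "C k \<phi> \<in> fock 6"
  using mode_split[OF assms(1)] fock_up[of 6 _ \<phi>] fock_down[of 6 _ \<phi>] assms(2)
  by (metis fock_add fock_cscale order_refl)+

text \<open>
  The full Fock space is stable under \<open>up\<close> and \<open>down\<close>, hence under all exterior multiplications, and it
  contains \<open>unit_form\<close>.
\<close>

lemma fock_total: assumes "alternating \<phi>" shows "\<phi> \<in> fock 6"
proof (rule alternating_generated_by_wedges[of "{1..6}" \<epsilon> X])
  have "vacuum \<in> fock n" for n
  proof (induction n)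
    case 0 then show ?case using range_eqI[of vacuum "\<lambda>c. cscale c vacuum" 1] by simp
  next
    case (Suc n) then show ?case using fock_SucI[OF Suc zero_in_fock] by (simp add: clifford_op_zero[OF op_down])
  qed
  then show "unit_form \<in> fock 6"
    by (subst unit_from_vacuum) (intro fock_modes; simp)
  fix k \<psi> assume k: "k \<in> {1..6::nat}" and \<psi>: "\<psi> \<in> fock 6"
  have m: "W 1 \<psi> \<in> fock 6" "W 2 \<psi> \<in> fock 6" "W 3 \<psi> \<in> fock 6" "W 4 \<psi> \<in> fock 6" "W 5 \<psi> \<in> fock 6" "W 6 \<psi> \<in> fock 6"
    using fock_modes(1)[OF _ \<psi>] by auto
  have "k = 1 \<or> k = 2 \<or> k = 3 \<or> k = 4 \<or> k = 5 \<or> k = 6" using k by auto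
  then show "covector (\<epsilon> k) \<and>\<^sub>f \<psi> \<in> fock 6"
    using m by (elim disjE; simp only: One_nat_def real_modes[OF fock_alternating[OF \<psi>]]; intro fock_add fock_diff fock_cscale; simp)
qed (use dual expand assms fock_add fock_cscale in auto)

end

lemma cliffordC_minus:
  assumes "alternating \<phi>" shows "cliffordC (v - w) \<phi> = cliffordC v \<phi> - cliffordC w \<phi>"
  using cliffordC_plus[OF assms, of v "(-1) *\<^sub>R w"] cliffordC_scaleR[OF assms, of "-1" w] by simp

locale vacuum_structure = coframe +
  fixes j
  assumes eigenspace: "i_eigenspace j = annihilator vacuum"
    and line: "canonical_line j = range (\<lambda>c. cscale c vacuum)"
    and half_dim: "half_dim TYPE('a) = 3"
begin

abbreviation "U \<equiv> U_space j"

definition words :: "int \<Rightarrow> 'a form set" where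
  "words k = {foldr cliffordC ls u | ls u.
          set ls \<subseteq> conj_gtan ` i_eigenspace j \<and> length ls = nat (3 - k) \<and> u \<in> canonical_line j}"

lemma U_eq: "k \<le> 3 \<Longrightarrow> U k = cform.span (words k)"
  by (simp add: U_space_def half_dim cspan_def words_def)

lemma eig_conj:
  assumes "v \<in> conj_gtan ` i_eigenspace j" "\<phi> \<in> eig k"
  shows "cliffordC v \<phi> \<in> eig (k - 1)"
proof -
  obtain c where "\<And>\<phi>. alternating \<phi> \<Longrightarrow> cliffordC v \<phi> = (\<Sum>a\<in>{1..6}. cscale (c a) (down a \<phi>))"
    using assms(1) vacuum_annihilator_conj eigenspace by blast
  then show ?thesis using assms(2) eig_alternating[OF assms(2)]
    by (auto intro!: eig_sum eig_cscale eig_down)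
qed

lemma words_eig: assumes "k \<le> 3" "w \<in> words k" shows "w \<in> eig k"
proof -
  have "foldr cliffordC ls u \<in> eig (3 - int (length ls))"
    if "set ls \<subseteq> conj_gtan ` i_eigenspace j" "u \<in> canonical_line j" for ls u
    using that
  proof (induction ls)
    case Nil then show ?case using eig_cscale[OF eig_vacuum] by (auto simp: line)
  next
    case (Cons v ls)
    then have "cliffordC v (foldr cliffordC ls u) \<in> eig (3 - int (length ls) - 1)"
      by (intro eig_conj) auto
    then show ?case by (simp add: algebra_simps)
  qed
  then show ?thesis using assms unfolding words_def by fastforce
qed

lemma U_eig: "U k \<subseteq> eig k"
proof (cases "k \<le> 3")
  case True
  have "cform.span (words k) \<subseteq> eig k"
    by (rule cform.span_minimal) (auto simp: words_eig[OF True] cform.subspace_def eig_zero eig_add eig_cscale)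
  then show ?thesis by (simp add: U_eq True)
next
  case False then show ?thesis by (simp add: U_space_def half_dim eig_zero)
qed

lemma conj_wedge_mode: "k \<in> {1..6} \<Longrightarrow> conj_gtan (wedge_mode k) = wedge_mode (bar k)"
  and conj_contract_mode: "k \<in> {1..6} \<Longrightarrow> conj_gtan (contract_mode k) = contract_mode (bar k)"
  unfolding atLeastAtMost_1_6
  by (auto simp: conj_gtan_def wedge_mode_def contract_mode_def bar_def)

text \<open>
  Conjugation exchanges the modes \<open>k\<close> and \<open>bar k\<close>, so each \<open>down a\<close> is the conjugate of an element that kills the
  spinor.
\<close>

lemma down_conj:
  assumes a: "a \<in> {1..6}"
  shows "\<exists>v\<in>conj_gtan ` i_eigenspace j. \<forall>\<phi>. alternating \<phi> \<longrightarrow> cliffordC v \<phi> = down a \<phi>"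
proof -
  have add: "conj_gtan (v + w) = conj_gtan v + conj_gtan w" and scale: "conj_gtan (r *\<^sub>R v) = r *\<^sub>R conj_gtan v"
    and sub: "conj_gtan (v - w) = conj_gtan v - conj_gtan w" for v w :: "'a gtanC" and r
    by (simp_all add: conj_gtan_def)
  have 1: "\<exists>v\<in>conj_gtan ` i_eigenspace j. \<forall>\<phi>. alternating \<phi> \<longrightarrow> cliffordC v \<phi> = cliffordC (conj_gtan v') \<phi>"
    if "cliffordC v' vacuum = 0" for v'
    by (rule bexI[of _ "conj_gtan v'"]) (use that in \<open>auto simp: eigenspace annihilator_def\<close>)
  have u: "up b vacuum = 0" if "b \<in> {1..6}" for b by (rule up_vacuum[OF that])
  \<comment> \<open>The conjugates of the summands of \<open>down a\<close>.\<close>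
  define v' where "v' = (if a = 1 then wedge_mode 1 else if a = 2 then contract_mode 4
    else if a = 3 then contract_mode 2 + (1/2) *\<^sub>R wedge_mode 3 else if a = 4 then contract_mode 3 + (-1/2) *\<^sub>R wedge_mode 2
    else if a = 5 then contract_mode 5 + (-1/2) *\<^sub>R wedge_mode 6 else contract_mode 6 + (1/2) *\<^sub>R wedge_mode 5)"
  have av: "a = 1 \<or> a = 2 \<or> a = 3 \<or> a = 4 \<or> a = 5 \<or> a = 6" using a by auto
  have "cliffordC v' vacuum = 0"
    using av u[of 1] u[of 2] u[of 3] u[of 4] u[of 5] u[of 6] unfolding up_def
    by (elim disjE) (simp_all add: v'_def cliffordC_plus[OF alternating_vacuum] cliffordC_minus[OF alternating_vacuum] cliffordC_scaleR[OF alternating_vacuum]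
       flip: W_def C_def)
  moreover have "cliffordC (conj_gtan v') \<phi> = down a \<phi>" if "alternating \<phi>" for \<phi>
    using av by (elim disjE) (simp_all add: v'_def add sub scale conj_wedge_mode conj_contract_mode bar_def
      cliffordC_plus[OF that] cliffordC_minus[OF that] cliffordC_scaleR[OF that] down_def flip: W_def C_def)
  ultimately show ?thesis using 1 by metis
qed

lemma U_down:
  assumes "a \<in> {1..6}" "k \<le> 3" "\<phi> \<in> U k"
  shows "down a \<phi> \<in> U (k - 1)"
proof -
  obtain v where v: "v \<in> conj_gtan ` i_eigenspace j" "\<And>\<phi>. alternating \<phi> \<Longrightarrow> cliffordC v \<phi> = down a \<phi>"
    using down_conj[OF assms(1)] by blast
  have w: "down a w \<in> words (k - 1)" if w_mem: "w \<in> words k" for w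
  proof -
    obtain ls u where w: "w = foldr cliffordC ls u" "set ls \<subseteq> conj_gtan ` i_eigenspace j" "length ls = nat (3 - k)" 
      "u \<in> canonical_line j" using w_mem unfolding words_def mem_Collect_eq by (elim exE conjE)
    have "down a w = foldr cliffordC (v # ls) u"
      using v(2)[of w] eig_alternating[OF words_eig[OF assms(2) w_mem]] w(1) by simp
    moreover have "set (v # ls) \<subseteq> conj_gtan ` i_eigenspace j" "length (v # ls) = nat (3 - (k - 1))"
      using w v(1) assms(2) by auto
    ultimately show ?thesis using w(4) unfolding words_def by blast
  qed
  have "\<phi> \<in> cform.span (words k)" using assms by (simp add: U_eq)
  then have "down a \<phi> \<in> cform.span (words (k - 1))"
  proof (induction rule: cform.span_induct_alt)
    case base show "down a 0 \<in> cform.span (words (k - 1))" by (simp add: clifford_op_zero[OF op_down] cform.span_zero)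
  next
    case (step c x y)
    show "down a (cscale c x + y) \<in> cform.span (words (k - 1))"
      unfolding clifford_op_additive[OF op_down] clifford_op_homogeneous[OF op_down]
      by (intro cform.span_add cform.span_scale cform.span_base w step)
  qed
  then show ?thesis using assms by (simp add: U_eq)
qed

lemma U_zero: "0 \<in> U k"
  by (cases "k \<le> 3") (simp_all add: U_eq cform.span_zero, simp add: U_space_def half_dim)

lemma U_add: "\<phi> \<in> U k \<Longrightarrow> \<psi> \<in> U k \<Longrightarrow> \<phi> + \<psi> \<in> U k"
  by (cases "k \<le> 3") (simp_all add: U_eq cform.span_add, simp add: U_space_def half_dim)

lemma fock_decomposition:
  "n \<le> 6 \<Longrightarrow> \<phi> \<in> fock n \<Longrightarrow> \<exists>u. (\<forall>i. u i \<in> U (3 - int i)) \<and> \<phi> = (\<Sum>i\<le>n. u i)"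
proof (induction n arbitrary: \<phi>)
  case 0
  then obtain c where c: "\<phi> = cscale c vacuum" by auto
  have "foldr cliffordC [] \<phi> \<in> words 3"
    unfolding words_def mem_Collect_eq
    by (intro exI[of _ "[]"] exI[of _ \<phi>]) (auto simp: line c)
  then have "\<phi> \<in> U 3" by (simp add: U_eq cform.span_base)
  then show ?case using U_zero by (intro exI[of _ "\<lambda>i. if i = 0 then \<phi> else 0"]) auto
next
  case (Suc n)
  then obtain \<alpha> \<beta> where h: "\<phi> = \<alpha> + down (Suc n) \<beta>" "\<alpha> \<in> fock n" "\<beta> \<in> fock n" by auto
  from Suc.IH[OF _ h(2)] Suc.IH[OF _ h(3)] Suc.prems obtain u u' where
    u: "\<And>i. u i \<in> U (3 - int i)" "\<alpha> = (\<Sum>i\<le>n. u i)" "\<And>i. u' i \<in> U (3 - int i)" "\<beta> = (\<Sum>i\<le>n. u' i)" by auto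
  note z = U_zero
  define w where "w i = (if i \<le> n then u i else 0) + (if i = 0 then 0 else down (Suc n) (u' (i - 1)))" for i
  have "w i \<in> U (3 - int i)" for i
    unfolding w_def
  proof (rule U_add)
    show "(if i = 0 then 0 else down (Suc n) (u' (i - 1))) \<in> U (3 - int i)"
      using U_down[of "Suc n" "3 - int (i - 1)" "u' (i - 1)"] u(3) Suc.prems
      by (auto simp: z of_nat_diff algebra_simps)
  qed (use u z in auto)
  moreover have "\<phi> = (\<Sum>i\<le>Suc n. w i)"
  proof -
    have e1: "(\<Sum>i\<le>n. (if i \<le> n then u i else 0)) = (\<Sum>i\<le>n. u i)" by (rule sum.cong) auto
    have "(\<Sum>i\<le>Suc n. w i) = (\<Sum>i\<le>Suc n. (if i \<le> n then u i else 0)) + (\<Sum>i\<le>Suc n. (if i = 0 then 0 else down (Suc n) (u' (i - 1))))"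
      unfolding w_def by (rule sum.distrib)
    also have "(\<Sum>i\<le>Suc n. (if i \<le> n then u i else 0)) = \<alpha>" unfolding u(2) sum.atMost_Suc e1 by simp
    also have "(\<Sum>i\<le>Suc n. (if i = 0 then 0 else down (Suc n) (u' (i - 1)))) = down (Suc n) \<beta>"
      unfolding u(4) clifford_op_sum[OF op_down] by (subst sum.atMost_Suc_shift) simp
    finally show ?thesis using h(1) by (simp only:)
  qed
  ultimately show ?case by blast
qed


end

context coframe begin

text \<open>
  The Lagrange interpolation polynomial in \<open>K\<close> that is \<open>1\<close> at \<open>k\<close> and \<open>0\<close> at the other nodes. As a polynomial in the
  modes the projection to \<open>U\<^sup>k\<close> is a Clifford operator.
\<close>

primrec lagrange :: "int \<Rightarrow> int list \<Rightarrow> 'v form \<Rightarrow> 'v form" where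
  "lagrange k [] \<phi> = \<phi>"
| "lagrange k (l # ls) \<phi> = (if l = k then lagrange k ls \<phi>
     else cscale (1 / of_int (k - l)) (K (lagrange k ls \<phi>) - cscale (of_int l) (lagrange k ls \<phi>)))"

definition "proj k = lagrange k [-3..3]"

lemma op_proj: "clifford_op (proj k)"
proof -
  have "clifford_op (lagrange k ls)" for ls
  proof (induction ls)
    case Nil then show ?case using clifford_op_id by simp
  next
    case (Cons l ls)
    then have "clifford_op (\<lambda>\<phi>. lagrange k ls \<phi>)"
      "clifford_op (\<lambda>\<phi>. cscale (1 / of_int (k - l)) (K (lagrange k ls \<phi>) - cscale (of_int l) (lagrange k ls \<phi>)))"
      by (auto intro!: clifford_op_K clifford_op_difference clifford_op_cscale)
    then show ?case by (cases "l = k") simp_all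
  qed
  then show ?thesis by (simp add: proj_def)
qed

lemma lagrange_eig:
  "\<phi> \<in> eig m \<Longrightarrow> \<exists>c. lagrange k ls \<phi> = cscale c \<phi> \<and> (m = k \<longrightarrow> c = 1) \<and> (m \<noteq> k \<and> m \<in> set ls \<longrightarrow> c = 0)"
proof (induction ls)
  case Nil
  show ?case by (rule exI[of _ 1]) simp
next
  case (Cons l ls)
  then obtain c where c: "lagrange k ls \<phi> = cscale c \<phi>" "m = k \<Longrightarrow> c = 1" "m \<noteq> k \<Longrightarrow> m \<in> set ls \<Longrightarrow> c = 0" by auto
  have K: "K (cscale c \<phi>) - cscale (of_int l) (cscale c \<phi>) = cscale (c * of_int (m - l)) \<phi>"
    using Cons.prems by (simp add: eig_def clifford_op_homogeneous[OF op_K]) (simp add: fun_eq_iff cscale_apply algebra_simps)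
  show ?case
  proof (cases "l = k")
    case True then show ?thesis using c by auto
  next
    case False
    then have "lagrange k (l # ls) \<phi> = cscale ((1 / of_int (k - l)) * (c * of_int (m - l))) \<phi>"
      by (simp only: lagrange.simps if_False c(1) K) (simp only: cform.scale_scale)
    then show ?thesis
      by (rule_tac exI[of _ "(1 / of_int (k - l)) * (c * of_int (m - l))"]) (use c False in auto)
  qed
qed

lemma proj_eig: assumes "\<phi> \<in> eig m" "m \<in> {-3..3}" shows "proj k \<phi> = (if m = k then \<phi> else 0)"
  using lagrange_eig[OF assms(1), of k "[-3..3]"] assms(2) by (auto simp: proj_def)

end

context vacuum_structure begin

lemma eig_decomposition:
  assumes "alternating \<phi>"
  obtains u where "\<And>k. u k \<in> U k" "\<phi> = (\<Sum>k\<in>{-3..3}. u k)" "\<And>k. k \<notin> {-3..3} \<Longrightarrow> u k = 0"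
proof -
  obtain u where u: "\<And>i. u i \<in> U (3 - int i)" "\<phi> = (\<Sum>i\<le>6. u i)"
    using fock_decomposition[of 6 \<phi>] fock_total[OF assms] by auto
  note z = U_zero
  define u' where "u' k = (if k \<in> {-3..3} then u (nat (3 - k)) else 0)" for k
  have 1: "u' k \<in> U k" for k using u(1)[of "nat (3 - k)"] z by (auto simp: u'_def)
  have 2: "(\<Sum>i\<le>6. u i) = (\<Sum>k\<in>{-3..3}. u' k)"
    by (rule sum.reindex_bij_witness[of _ "\<lambda>k. nat (3 - k)" "\<lambda>i. 3 - int i"]) (auto simp: u'_def)
  have 3: "k \<notin> {-3..3} \<Longrightarrow> u' k = 0" for k by (simp only: u'_def if_False)
  show ?thesis by (rule that[of u']) (rule 1, simp only: u(2) 2, rule 3)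
qed

lemma proj_U_sum:
  assumes "\<And>l. u l \<in> U l" "finite I" "I \<subseteq> {-3..3}"
  shows "proj k (\<Sum>l\<in>I. u l) = (if k \<in> I then u k else 0)"
proof -
  have "proj k (\<Sum>l\<in>I. u l) = (\<Sum>l\<in>I. proj k (u l))" by (rule clifford_op_sum[OF op_proj])
  also have "\<dots> = (\<Sum>l\<in>I. if l = k then u l else 0)"
    by (rule sum.cong) (use assms proj_eig U_eig in blast)+
  also have "\<dots> = (if k \<in> I then u k else 0)" by (simp add: sum.delta[OF assms(2)])
  finally show ?thesis .
qed

lemma proj_mem_U: "alternating \<phi> \<Longrightarrow> proj k \<phi> \<in> U k"
  and sum_proj: "alternating \<phi> \<Longrightarrow> (\<Sum>k\<in>{-3..3}. proj k \<phi>) = \<phi>"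
  and proj_outside: "alternating \<phi> \<Longrightarrow> k \<notin> {-3..3} \<Longrightarrow> proj k \<phi> = 0"
proof -
  assume "alternating \<phi>"
  then obtain u where u: "\<And>k. u k \<in> U k" "\<phi> = (\<Sum>k\<in>{-3..3}. u k)" "\<And>k. k \<notin> {-3..3} \<Longrightarrow> u k = 0"
    using eig_decomposition by blast
  have p: "proj k \<phi> = u k" for k
    using proj_U_sum[OF u(1), of "{-3..3}" k] u(2,3) by (cases "k \<in> {-3..3}") auto
  show "proj k \<phi> \<in> U k" "(\<Sum>k\<in>{-3..3}. proj k \<phi>) = \<phi>" by (simp_all only: p u(1) u(2)[symmetric])
  show "k \<notin> {-3..3} \<Longrightarrow> proj k \<phi> = 0" using p u(3) by simp
qed

lemma eig_subset_U: "eig k \<subseteq> U k"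
proof
  fix \<phi> assume \<phi>: "\<phi> \<in> eig k"
  obtain c where c: "c = 1" "proj k \<phi> = cscale c \<phi>"
    using lagrange_eig[OF \<phi>, of k "[-3..3]"] by (auto simp: proj_def)
  then show "\<phi> \<in> U k" using proj_mem_U[OF eig_alternating[OF \<phi>], of k] by simp
qed

lemma U_eq_eig: "U k = eig k"
  using U_eig eig_subset_U by blast

lemma U_outside: "k \<notin> {-3..3} \<Longrightarrow> U k = {0}"
proof -
  assume k: "k \<notin> {-3..3}"
  have "\<phi> = 0" if "\<phi> \<in> eig k" for \<phi>
    using lagrange_eig[OF that, of k "[-3..3]"] proj_outside[OF eig_alternating[OF that] k]
    by (auto simp: proj_def)
  then show ?thesis using eig_zero U_eq_eig by blast
qed

lemma U_component_eq_proj: assumes "alternating \<phi>" shows "U_component j k \<phi> = proj k \<phi>"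
proof -
  let ?P = "\<lambda>c. (\<forall>l. c l \<in> U l) \<and> finite {l. c l \<noteq> 0} \<and> \<phi> = (\<Sum>l | c l \<noteq> 0. c l)"
  have "(THE c. ?P c) = (\<lambda>k. proj k \<phi>)"
  proof (rule the_equality)
    have s: "{l. proj l \<phi> \<noteq> 0} \<subseteq> {-3..3}" using proj_outside[OF assms] by blast
    then have "finite {l. proj l \<phi> \<noteq> 0}" by (rule finite_subset) simp
    moreover have "(\<Sum>l | proj l \<phi> \<noteq> 0. proj l \<phi>) = (\<Sum>l\<in>{-3..3}. proj l \<phi>)"
      by (rule sum.mono_neutral_left) (use s in auto)
    ultimately show "?P (\<lambda>k. proj k \<phi>)" using proj_mem_U[OF assms] sum_proj[OF assms] by simp
  next
    fix c assume c: "?P c"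
    then have s: "{l. c l \<noteq> 0} \<subseteq> {-3..3}" using U_outside by blast
    show "c = (\<lambda>k. proj k \<phi>)"
    proof
      fix k show "c k = proj k \<phi>"
        using proj_U_sum[of c "{l. c l \<noteq> 0}" k] c s by auto
    qed
  qed
  then show ?thesis unfolding U_component_def by simp
qed

end


section \<open>Smooth functions\<close>

lemma C_k_Suc_imp: "C_k (Suc k) f \<Longrightarrow> C_k k f"
proof (induction k arbitrary: f)
  case 0
  then show ?case
    by (auto intro!: continuous_at_imp_continuous_on differentiable_imp_continuous_within)
qed auto

lemma smooth_differentiable: "smooth f \<Longrightarrow> f differentiable (at x)"
  unfolding smooth_def by (metis C_k.simps(2))

lemma smooth_has_derivative: "smooth f \<Longrightarrow> (f has_derivative frechet_derivative f (at x)) (at x)"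
  using smooth_differentiable frechet_derivative_works by blast

lemma smooth_derivative: "smooth f \<Longrightarrow> smooth (\<lambda>x. frechet_derivative f (at x) v)"
  unfolding smooth_def by (metis C_k.simps(2))

lemma smooth_continuous: "smooth f \<Longrightarrow> continuous_on S f"
  unfolding smooth_def by (metis C_k.simps(1) continuous_on_subset subset_UNIV)

lemma frechet_derivative_eqI: "(f has_derivative f') (at x) \<Longrightarrow> frechet_derivative f (at x) = f'"
  using frechet_derivative_at by metis

lemma C_k_const: "C_k k (\<lambda>x. c)"
proof (induction k arbitrary: c)
  case (Suc k) then show ?case by simp
qed simp

lemma C_k_add: "C_k k f \<Longrightarrow> C_k k g \<Longrightarrow> C_k k (\<lambda>x. f x + g x)"
proof (induction k arbitrary: f g)
  case 0 then show ?case by (auto intro: continuous_on_add)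
next
  case (Suc k)
  have "((\<lambda>x. f x + g x) has_derivative (\<lambda>v. frechet_derivative f (at x) v + frechet_derivative g (at x) v)) (at x)" for x
    using Suc.prems by (intro has_derivative_add) (auto simp: frechet_derivative_works)
  note d = this frechet_derivative_eqI[OF this]
  show ?case using Suc.IH Suc.prems by (auto simp: d(2) intro: differentiableI d(1))
qed

lemma C_k_mult: "C_k k f \<Longrightarrow> C_k k g \<Longrightarrow> C_k k (\<lambda>x. f x * g x)" for f g :: "'a::real_normed_vector \<Rightarrow> complex"
proof (induction k arbitrary: f g)
  case 0 then show ?case by (auto intro: continuous_on_mult)
next
  case (Suc k)
  have "((\<lambda>x. f x * g x) has_derivative (\<lambda>v. f x * frechet_derivative g (at x) v + frechet_derivative f (at x) v * g x)) (at x)" for x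
    using Suc.prems by (intro has_derivative_mult) (auto simp: frechet_derivative_works)
  note d = this frechet_derivative_eqI[OF this]
  show ?case using Suc.IH Suc.prems C_k_Suc_imp[OF Suc.prems(1)] C_k_Suc_imp[OF Suc.prems(2)]
    by (auto simp: d(2) intro: differentiableI d(1) intro!: C_k_add)
qed

lemma smooth_const: "smooth (\<lambda>x. c)" by (simp add: smooth_def C_k_const)
lemma smooth_add: "smooth f \<Longrightarrow> smooth g \<Longrightarrow> smooth (\<lambda>x. f x + g x)" by (simp add: smooth_def C_k_add)
lemma smooth_mult: "smooth f \<Longrightarrow> smooth g \<Longrightarrow> smooth (\<lambda>x. f x * g x)" for f g :: "'a::real_normed_vector \<Rightarrow> complex"
  by (simp add: smooth_def C_k_mult)
lemma smooth_sum: "(\<And>i. i \<in> I \<Longrightarrow> smooth (f i)) \<Longrightarrow> smooth (\<lambda>x. \<Sum>i\<in>I. f i x)"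
  by (induction I rule: infinite_finite_induct) (auto intro: smooth_const smooth_add)

lemma smooth_bounded_linear: assumes "bounded_linear f" shows "smooth f"
proof -
  have d: "(f has_derivative f) (at x)" for x using assms by (rule bounded_linear_imp_has_derivative)
  have "C_k k f" for k
    by (cases k) (use assms d in \<open>auto simp: frechet_derivative_eqI[OF d] C_k_const linear_continuous_on intro: differentiableI\<close>)
  then show ?thesis by (simp add: smooth_def)
qed


section \<open>Averages along a direction\<close>

text \<open>
  The weight \<open>1\<close> gives the mean along a period \<open>v\<close>. The weight \<open>t - 1/2\<close>
  gives the primitive along \<open>v\<close> of the deviation from the mean, by integration by parts
  (\<open>wavg_primitive_ftc\<close>). The upper limit \<open>s\<close> varies in the proof of \<open>frechet_derivative_commute\<close> only.
\<close>

definition wavg :: "real \<Rightarrow> (real \<Rightarrow> real) \<Rightarrow> 'v::euclidean_space \<Rightarrow> ('v \<Rightarrow> complex) \<Rightarrow> 'v \<Rightarrow> complex" where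
  "wavg s q v f x = integral {0..s} (\<lambda>t. complex_of_real (q t) * f (x + t *\<^sub>R v))"

lemma wavg_integrable:
  fixes f :: "'v::euclidean_space \<Rightarrow> complex"
  assumes "continuous_on UNIV q" "continuous_on UNIV f"
  shows "(\<lambda>t. complex_of_real (q t) * f (x + t *\<^sub>R v)) integrable_on {0..s}"
proof -
  have "continuous_on {0..s} (\<lambda>t. f (x + t *\<^sub>R v))"
    by (rule continuous_on_compose2[OF assms(2)]) (auto intro!: continuous_intros)
  then show ?thesis
    by (intro integrable_continuous_real continuous_intros continuous_on_subset[OF assms(1)]) auto
qed

lemma wavg_has_derivative:
  fixes f :: "'v::euclidean_space \<Rightarrow> complex"
  assumes f: "smooth f" and q: "continuous_on UNIV q"
  shows "(wavg s q v f has_derivative (\<lambda>w. wavg s q v (\<lambda>y. frechet_derivative f (at y) w) x)) (at x)"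
proof -
  let ?D = "\<lambda>y w. frechet_derivative f (at y) w"
  have bl: "bounded_linear (?D y)" for y
    using smooth_has_derivative[OF f] has_derivative_bounded_linear by blast
  define fx where "fx x t = Blinfun (\<lambda>w. complex_of_real (q t) * ?D (x + t *\<^sub>R v) w)" for x t
  have app: "blinfun_apply (fx x t) w = complex_of_real (q t) * ?D (x + t *\<^sub>R v) w" for x t w
    unfolding fx_def by (subst bounded_linear_Blinfun_apply) (intro bounded_linear_const_mult bl refl)+
  have "((\<lambda>x. integral (cbox 0 s) (\<lambda>t. complex_of_real (q t) * f (x + t *\<^sub>R v))) has_derivative
     blinfun_apply (integral (cbox 0 s) (fx x))) (at x within UNIV)"
  proof (rule leibniz_rule)
    fix y t
    have "((\<lambda>y. f (y + t *\<^sub>R v)) has_derivative ?D (y + t *\<^sub>R v)) (at y)"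
      by (rule has_derivative_compose[of "\<lambda>x. x + t *\<^sub>R v" "\<lambda>v. v" y UNIV f, simplified])
         (auto intro!: derivative_eq_intros smooth_has_derivative[OF f])
    then have "((\<lambda>y. complex_of_real (q t) * f (y + t *\<^sub>R v)) has_derivative (\<lambda>w. complex_of_real (q t) * ?D (y + t *\<^sub>R v) w)) (at y)"
      by (rule has_derivative_mult_right)
    then show "((\<lambda>y. complex_of_real (q t) * f (y + t *\<^sub>R v)) has_derivative blinfun_apply (fx y t)) (at y within UNIV)"
      by (simp add: app[abs_def])
  next
    fix y show "(\<lambda>t. complex_of_real (q t) * f (y + t *\<^sub>R v)) integrable_on cbox 0 s"
      using wavg_integrable[OF q smooth_continuous[OF f]] by simp
  next
    show "continuous_on (UNIV \<times> cbox 0 s) (\<lambda>(x, t). fx x t)"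
    proof (rule continuous_on_blinfun_componentwise)
      fix i :: 'v
      have "continuous_on (UNIV \<times> cbox 0 s) (\<lambda>p. complex_of_real (q (snd p)) * ?D (fst p + snd p *\<^sub>R v) i)"
        by (intro continuous_intros continuous_on_compose2[OF q] continuous_on_compose2[OF smooth_continuous[OF smooth_derivative[OF f], of UNIV]]) auto
      then show "continuous_on (UNIV \<times> cbox 0 s) (\<lambda>x. blinfun_apply (case x of (x, t) \<Rightarrow> fx x t) i)"
        by (simp add: case_prod_unfold app)
    qed
  qed auto
  moreover have w: "blinfun_apply (integral (cbox 0 s) (fx x)) w = wavg s q v (\<lambda>y. ?D y w) x" for w
  proof -
    have "continuous_on (cbox 0 s) (fx x)"
    proof (rule continuous_on_blinfun_componentwise)
      fix i :: 'v
      show "continuous_on (cbox 0 s) (\<lambda>t. blinfun_apply (fx x t) i)"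
        unfolding app
        by (intro continuous_intros continuous_on_compose2[OF q] continuous_on_compose2[OF smooth_continuous[OF smooth_derivative[OF f], of UNIV]]) auto
    qed
    then have "fx x integrable_on cbox 0 s" by (rule integrable_continuous)
    then show ?thesis by (simp add: blinfun_apply_integral app wavg_def)
  qed
  moreover have "blinfun_apply (integral (cbox 0 s) (fx x)) = (\<lambda>w. wavg s q v (\<lambda>y. ?D y w) x)"
    by (rule ext) (rule w)
  moreover have "(\<lambda>x. integral (cbox 0 s) (\<lambda>t. complex_of_real (q t) * f (x + t *\<^sub>R v))) = wavg s q v f"
    by (simp add: wavg_def[abs_def])
  ultimately show ?thesis by simp
qed

lemma smooth_wavg:
  fixes f :: "'v::euclidean_space \<Rightarrow> complex"
  assumes "smooth f" "continuous_on UNIV q" shows "smooth (wavg s q v f)"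
proof -
  have "C_k k (wavg s q v f)" for k
    using assms(1)
  proof (induction k arbitrary: f)
    case 0
    then show ?case using wavg_has_derivative[OF _ assms(2)]
      by (auto intro!: continuous_at_imp_continuous_on has_derivative_continuous)
  next
    case (Suc k)
    note d = wavg_has_derivative[OF Suc.prems assms(2)]
    show ?case using Suc.IH[OF smooth_derivative[OF Suc.prems]]
      by (auto simp: frechet_derivative_eqI[OF d] intro: differentiableI d)
  qed
  then show ?thesis by (simp add: smooth_def)
qed

lemma wavg_add:
  assumes "continuous_on UNIV q" "smooth f" "smooth g"
  shows "wavg s q v (\<lambda>x. f x + g x) x = wavg s q v f x + wavg s q v g x"
  unfolding wavg_def using wavg_integrable[OF assms(1) smooth_continuous[OF assms(2)]]
    wavg_integrable[OF assms(1) smooth_continuous[OF assms(3)]]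
  by (simp add: distrib_left integral_add)

lemma wavg_cmult: "wavg s q v (\<lambda>x. c * f x) x = c * wavg s q v f x"
proof -
  have "wavg s q v (\<lambda>x. c * f x) x = integral {0..s} (\<lambda>t. c * (complex_of_real (q t) * f (x + t *\<^sub>R v)))"
    by (simp add: wavg_def mult.left_commute)
  then show ?thesis by (simp add: wavg_def)
qed

lemma derivative_along_line:
  assumes "smooth f"
  shows "((\<lambda>t. f (x + t *\<^sub>R v)) has_vector_derivative frechet_derivative f (at (x + t *\<^sub>R v)) v) (at t within S)"
proof -
  have "((\<lambda>t. f (x + t *\<^sub>R v)) has_derivative (\<lambda>h. frechet_derivative f (at (x + t *\<^sub>R v)) (h *\<^sub>R v))) (at t within S)"
    by (rule has_derivative_compose[of "\<lambda>t. x + t *\<^sub>R v" "\<lambda>h. h *\<^sub>R v" t S f])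
       (auto intro!: derivative_eq_intros smooth_has_derivative[OF assms])
  then show ?thesis
    unfolding has_vector_derivative_def
    by (simp add: linear_scale[OF linear_frechet_derivative[OF smooth_differentiable[OF assms]]])
qed

lemma wavg_derivative_ftc:
  fixes f :: "'v::euclidean_space \<Rightarrow> complex"
  assumes "smooth f" "0 \<le> s"
  shows "wavg s (\<lambda>_. 1) v (\<lambda>y. frechet_derivative f (at y) v) x = f (x + s *\<^sub>R v) - f x"
proof -
  have "((\<lambda>t. frechet_derivative f (at (x + t *\<^sub>R v)) v) has_integral (f (x + s *\<^sub>R v) - f (x + 0 *\<^sub>R v))) {0..s}"
    by (rule fundamental_theorem_of_calculus[OF assms(2)]) (rule derivative_along_line[OF assms(1)])
  then show ?thesis by (simp add: wavg_def integral_unique)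
qed

lemma wavg_primitive_ftc:
  fixes f :: "'v::euclidean_space \<Rightarrow> complex"
  assumes "smooth f" and per: "f (x + v) = f x"
  shows "wavg 1 (\<lambda>t. t - 1/2) v (\<lambda>y. frechet_derivative f (at y) v) x = f x - wavg 1 (\<lambda>_. 1) v f x"
proof -
  let ?g = "\<lambda>t. (t - 1/2) *\<^sub>R f (x + t *\<^sub>R v)"
  have "((\<lambda>t. (t - 1/2) *\<^sub>R frechet_derivative f (at (x + t *\<^sub>R v)) v + 1 *\<^sub>R f (x + t *\<^sub>R v)) has_integral (?g 1 - ?g 0)) {0..1}"
    by (rule fundamental_theorem_of_calculus)
       (auto intro!: has_vector_derivative_scaleR derivative_along_line[OF assms(1)] derivative_eq_intros)
  from integral_unique[OF this]
  have "integral {0..1} (\<lambda>t. complex_of_real (t - 1/2) * frechet_derivative f (at (x + t *\<^sub>R v)) v + complex_of_real 1 * f (x + t *\<^sub>R v))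
    = complex_of_real (1 - 1/2) * f (x + 1 *\<^sub>R v) - complex_of_real (0 - 1/2) * f (x + 0 *\<^sub>R v)"
    by (simp only: scaleR_conv_of_real)
  also have "\<dots> = f x" using per by simp
  finally have 1: "integral {0..1} (\<lambda>t. complex_of_real (t - 1/2) * frechet_derivative f (at (x + t *\<^sub>R v)) v + complex_of_real 1 * f (x + t *\<^sub>R v)) = f x" .
  have "integral {0..1} (\<lambda>t. complex_of_real (t - 1/2) * frechet_derivative f (at (x + t *\<^sub>R v)) v + complex_of_real 1 * f (x + t *\<^sub>R v))
     = wavg 1 (\<lambda>t. t - 1/2) v (\<lambda>y. frechet_derivative f (at y) v) x + wavg 1 (\<lambda>_. 1) v f x"
    unfolding wavg_def
    by (rule integral_add; rule wavg_integrable)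
       (auto intro!: smooth_continuous[OF smooth_derivative[OF assms(1)]] smooth_continuous[OF assms(1)] continuous_intros)
  then show ?thesis using 1 by (simp add: eq_diff_eq)
qed

text \<open>
  Both sides are the derivative at \<open>s = 0\<close> of \<open>\<partial>\<^sub>a f (x + s b) - \<partial>\<^sub>a f x\<close>, which is the integral of
  \<open>\<partial>\<^sub>a \<partial>\<^sub>b f\<close> along the segment because \<open>\<partial>\<^sub>a\<close> passes under the integral of \<open>\<partial>\<^sub>b f\<close>.
\<close>

lemma frechet_derivative_commute:
  fixes f :: "'v::euclidean_space \<Rightarrow> complex"
  assumes "smooth f"
  shows "frechet_derivative (\<lambda>y. frechet_derivative f (at y) a) (at x) b =
         frechet_derivative (\<lambda>y. frechet_derivative f (at y) b) (at x) a"
proof -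
  let ?D = "\<lambda>v f x. frechet_derivative f (at x) v"
  have sa: "smooth (?D a f)" and sb: "smooth (?D b f)" by (intro smooth_derivative assms)+
  have eq: "?D a f (x + s *\<^sub>R b) - ?D a f x = integral {0..s} (\<lambda>t. ?D a (?D b f) (x + t *\<^sub>R b))" if "0 \<le> s" for s
  proof -
    have d1: "((\<lambda>y. f (y + s *\<^sub>R b) - f y) has_derivative (\<lambda>w. ?D w f (x + s *\<^sub>R b) - ?D w f x)) (at x)"
      by (intro has_derivative_diff smooth_has_derivative[OF assms]
          has_derivative_compose[of "\<lambda>y. y + s *\<^sub>R b" "\<lambda>v. v" x UNIV f, simplified])
         (auto intro!: derivative_eq_intros smooth_has_derivative[OF assms])
    have "(\<lambda>y. f (y + s *\<^sub>R b) - f y) = wavg s (\<lambda>_. 1) b (?D b f)"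
      using wavg_derivative_ftc[OF assms that] by auto
    then have "((\<lambda>y. f (y + s *\<^sub>R b) - f y) has_derivative (\<lambda>w. wavg s (\<lambda>_. 1) b (?D w (?D b f)) x)) (at x)"
      using wavg_has_derivative[OF sb, of "\<lambda>_. 1"] by simp
    from has_derivative_unique[OF d1 this] have "?D a f (x + s *\<^sub>R b) - ?D a f x = wavg s (\<lambda>_. 1) b (?D a (?D b f)) x"
      by meson
    then show ?thesis by (simp add: wavg_def)
  qed
  have "((\<lambda>s. ?D a f (x + s *\<^sub>R b) - ?D a f x) has_vector_derivative ?D b (?D a f) (x + 0 *\<^sub>R b)) (at 0 within {0..1})"
    by (auto intro!: derivative_eq_intros derivative_along_line[OF sa])
  moreover have "((\<lambda>s. integral {0..s} (\<lambda>t. ?D a (?D b f) (x + t *\<^sub>R b))) has_vector_derivative ?D a (?D b f) (x + 0 *\<^sub>R b)) (at 0 within {0..1})"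
    by (rule integral_has_vector_derivative)
       (auto intro!: continuous_on_compose2[OF smooth_continuous[OF smooth_derivative[OF sb], of UNIV]] continuous_intros)
  then have "((\<lambda>s. ?D a f (x + s *\<^sub>R b) - ?D a f x) has_vector_derivative ?D a (?D b f) (x + 0 *\<^sub>R b)) (at 0 within {0..1})"
    by (rule has_vector_derivative_transform[rotated -1]) (auto simp: eq)
  ultimately show ?thesis
    using vector_derivative_unique_within_closed_interval[of 0 1 0] by fastforce
qed

section \<open>Form fields\<close>

text \<open>
  A functional that is linear on smooth functions is applied to the coefficients of a field; it
  commutes with every Clifford operator, as the value of \<open>T \<phi>\<close> at a list is a linear combination of
  values of \<open>\<phi>\<close>.
\<close>

definition coeffwise :: "(('a \<Rightarrow> complex) \<Rightarrow> complex) \<Rightarrow> ('a \<Rightarrow> 'v form) \<Rightarrow> 'v form" where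
  "coeffwise L u = (\<lambda>vs. L (\<lambda>x. u x vs))"

definition linear_functional :: "(('a::euclidean_space \<Rightarrow> complex) \<Rightarrow> complex) \<Rightarrow> bool" where
  "linear_functional L \<longleftrightarrow> (\<forall>f g. smooth f \<longrightarrow> smooth g \<longrightarrow> L (\<lambda>x. f x + g x) = L f + L g) \<and>
     (\<forall>c f. smooth f \<longrightarrow> L (\<lambda>x. c * f x) = c * L f)"

lemma linear_functional_zero: assumes "linear_functional L" shows "L (\<lambda>x. 0) = 0"
proof -
  have "L (\<lambda>x. 0 * (0 :: complex)) = 0 * L (\<lambda>x. 0)"
    using assms smooth_const[of 0] unfolding linear_functional_def by blast
  then show ?thesis by simp
qed

lemma linear_functional_sum:
  assumes "linear_functional L" "\<And>i. i \<in> I \<Longrightarrow> smooth (f i)"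
  shows "L (\<lambda>x. \<Sum>i\<in>I. c i * f i x) = (\<Sum>i\<in>I. c i * L (f i))"
  using assms(2)
proof (induction I rule: infinite_finite_induct)
  case (insert i I)
  have s: "smooth (\<lambda>x. c i * f i x)" "smooth (\<lambda>x. \<Sum>i\<in>I. c i * f i x)"
    using insert.prems by (intro smooth_mult smooth_sum smooth_const; simp)+
  have "L (\<lambda>x. \<Sum>i\<in>insert i I. c i * f i x) = L (\<lambda>x. c i * f i x + (\<Sum>i\<in>I. c i * f i x))"
    using insert by simp
  also have "\<dots> = L (\<lambda>x. c i * f i x) + L (\<lambda>x. \<Sum>i\<in>I. c i * f i x)"
    using assms(1) s unfolding linear_functional_def by blast
  finally show ?case using insert assms(1) by (auto simp: linear_functional_def)
qed (simp_all add: linear_functional_zero[OF assms(1)])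

lemma wedge_eq_coefficient_sum:
  "(\<alpha> \<and>\<^sub>f \<phi>) vs = (\<Sum>S\<in>Pow {..<length vs}.
     ((- 1) ^ card {(i, j). i \<in> S \<and> j \<in> {..<length vs} - S \<and> j < i} * \<alpha> (nths vs S)) * \<phi> (nths vs (- S)))"
  by (simp add: wedge_def)

lemma smooth_coeff_clifford_op:
  assumes "clifford_op T" "\<And>vs. smooth (\<lambda>x. u x vs)" shows "smooth (\<lambda>x. T (u x) vs)"
  using assms
proof (induction arbitrary: vs rule: clifford_op.induct)
  case (clifford_op_wedge T \<xi>)
  then have "smooth (\<lambda>x. T (u x) ws)" for ws by blast
  then show ?case unfolding wedge_eq_coefficient_sum by (intro smooth_sum smooth_mult smooth_const)
qed (auto simp: contract_def cscale_def intro!: smooth_mult smooth_add smooth_const)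

lemma smooth_form_coeff: "smooth_form u \<Longrightarrow> smooth (\<lambda>x. u x vs)" by (simp add: smooth_form_def)
lemma smooth_form_alternating: "smooth_form u \<Longrightarrow> alternating (u x)" by (simp add: smooth_form_def)

lemma smooth_form_clifford_op: "clifford_op T \<Longrightarrow> smooth_form u \<Longrightarrow> smooth_form (\<lambda>x. T (u x))"
  by (simp add: smooth_form_def clifford_op_alternating smooth_coeff_clifford_op)

lemma coeffwise_clifford_op:
  assumes "clifford_op T" "linear_functional L" "\<And>vs. smooth (\<lambda>x. u x vs)"
  shows "coeffwise L (\<lambda>x. T (u x)) = T (coeffwise L u)"
  using assms(1)
proof (induction rule: clifford_op.induct)
  case (clifford_op_wedge T \<xi>)
  show ?case
  proof
    fix vs
    show "coeffwise L (\<lambda>x. covector \<xi> \<and>\<^sub>f T (u x)) vs = (covector \<xi> \<and>\<^sub>f T (coeffwise L u)) vs"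
      unfolding clifford_op_wedge.IH[symmetric] unfolding coeffwise_def wedge_eq_coefficient_sum
      by (rule linear_functional_sum[OF assms(2)]) (rule smooth_coeff_clifford_op[OF clifford_op_wedge.hyps assms(3)])
  qed
next
  case (clifford_op_contract T X)
  show ?case unfolding clifford_op_contract.IH[symmetric] unfolding coeffwise_def contract_def ..
next
  case (clifford_op_cscale T c)
  have "smooth (\<lambda>x. T (u x) vs)" for vs by (rule smooth_coeff_clifford_op[OF clifford_op_cscale.hyps assms(3)])
  then show ?case using assms(2)
    unfolding clifford_op_cscale.IH[symmetric] unfolding coeffwise_def cscale_def linear_functional_def by blast
next
  case (clifford_op_add T T')
  have "smooth (\<lambda>x. T (u x) vs)" "smooth (\<lambda>x. T' (u x) vs)" for vs
    by (rule smooth_coeff_clifford_op[OF clifford_op_add.hyps(1) assms(3)] smooth_coeff_clifford_op[OF clifford_op_add.hyps(2) assms(3)])+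
  then show ?case using assms(2)
    unfolding clifford_op_add.IH[symmetric] unfolding coeffwise_def plus_fun_def linear_functional_def by blast
qed simp

lemma alternating_coeffwise:
  assumes "linear_functional L" "smooth_form u" shows "alternating (coeffwise L u)"
  unfolding alternating_def coeffwise_def
proof (intro conjI allI impI)
  fix vs :: "'a list" and i assume i: "i < length vs"
  have l: "linear (\<lambda>v. u x (vs[i := v]))" for x
    using alternating_linear[OF smooth_form_alternating[OF assms(2)] i] .
  have s: "smooth (\<lambda>x. u x ws)" for ws by (rule smooth_form_coeff[OF assms(2)])
  show "linear (\<lambda>v. L (\<lambda>x. u x (vs[i := v])))"
    by (rule linearI) (use assms(1) s in \<open>auto simp: linear_add[OF l] linear_scale[OF l] linear_functional_def scaleR_conv_of_real\<close>)
next
  fix vs :: "'a list" assume "\<not> distinct vs"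
  then have "u x vs = 0" for x by (rule alternating_not_distinct[OF smooth_form_alternating[OF assms(2)]])
  then show "L (\<lambda>x. u x vs) = 0"
    using linear_functional_zero[OF assms(1)] by simp
qed


definition dir :: "'v::euclidean_space \<Rightarrow> 'v form_field \<Rightarrow> 'v form_field" where
  "dir v u = (\<lambda>x. coeffwise (\<lambda>f. frechet_derivative f (at x) v) u)"

definition Avg :: "(real \<Rightarrow> real) \<Rightarrow> 'v::euclidean_space \<Rightarrow> 'v form_field \<Rightarrow> 'v form_field" where
  "Avg q v u = (\<lambda>x. coeffwise (\<lambda>f. wavg 1 q v f x) u)"

lemma dir_apply: "dir v u x vs = frechet_derivative (\<lambda>y. u y vs) (at x) v"
  by (simp add: dir_def coeffwise_def)

lemma Avg_apply: "Avg q v u x vs = wavg 1 q v (\<lambda>y. u y vs) x"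
  by (simp add: Avg_def coeffwise_def)

lemma frechet_derivative_add: "smooth f \<Longrightarrow> smooth g \<Longrightarrow>
    frechet_derivative (\<lambda>x. f x + g x) (at x) v = frechet_derivative f (at x) v + frechet_derivative g (at x) v"
  by (subst frechet_derivative_eqI[OF has_derivative_add]) (auto intro: smooth_has_derivative)

lemma frechet_derivative_cmult: "smooth f \<Longrightarrow>
    frechet_derivative (\<lambda>x. c * f x) (at x) v = c * frechet_derivative f (at x) v" for f :: "'a::real_normed_vector \<Rightarrow> complex"
  by (subst frechet_derivative_eqI[OF has_derivative_mult_right]) (auto intro: smooth_has_derivative)

lemma linear_functional_derivative: "linear_functional (\<lambda>f. frechet_derivative f (at x) v)"
  by (simp add: linear_functional_def frechet_derivative_add frechet_derivative_cmult)

lemma linear_functional_wavg: "continuous_on UNIV q \<Longrightarrow> linear_functional (\<lambda>f. wavg s q v f x)"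
  by (simp add: linear_functional_def wavg_add wavg_cmult)

lemma smooth_form_dir: "smooth_form u \<Longrightarrow> smooth_form (dir v u)"
  using alternating_coeffwise[OF linear_functional_derivative, of u]
  by (simp add: smooth_form_def[of "dir v u"] dir_apply smooth_derivative smooth_form_coeff) (simp add: dir_def)

lemma smooth_form_Avg: "smooth_form u \<Longrightarrow> continuous_on UNIV q \<Longrightarrow> smooth_form (Avg q v u)"
proof -
  assume u: "smooth_form u" and q: "continuous_on UNIV q"
  have "(\<lambda>x. Avg q v u x vs) = wavg 1 q v (\<lambda>y. u y vs)" for vs by (simp add: Avg_apply fun_eq_iff)
  then show ?thesis using alternating_coeffwise[OF linear_functional_wavg[OF q] u]
    by (simp add: smooth_form_def[of "Avg q v u"] smooth_wavg smooth_form_coeff u q) (simp add: Avg_def)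
qed

lemma dir_clifford_op: "clifford_op T \<Longrightarrow> smooth_form u \<Longrightarrow> dir v (\<lambda>x. T (u x)) x = T (dir v u x)"
  unfolding dir_def by (rule coeffwise_clifford_op) (auto simp: linear_functional_derivative smooth_form_coeff)

lemma Avg_clifford_op: "clifford_op T \<Longrightarrow> smooth_form u \<Longrightarrow> continuous_on UNIV q \<Longrightarrow> Avg q v (\<lambda>x. T (u x)) x = T (Avg q v u x)"
  unfolding Avg_def by (rule coeffwise_clifford_op) (auto simp: linear_functional_wavg smooth_form_coeff)

lemma smooth_form_add: "smooth_form u \<Longrightarrow> smooth_form w \<Longrightarrow> smooth_form (\<lambda>x. u x + w x)"
  by (simp add: smooth_form_def alternating_add smooth_add)

lemma smooth_form_zero: "smooth_form (\<lambda>x. 0)"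
  by (simp add: smooth_form_def alternating_zero smooth_const)

lemma smooth_form_const: "alternating \<phi> \<Longrightarrow> smooth_form (\<lambda>x. \<phi>)"
  by (simp add: smooth_form_def smooth_const)

lemma smooth_form_minus: "smooth_form u \<Longrightarrow> smooth_form (\<lambda>x. - u x)"
  by (rule smooth_form_clifford_op[OF clifford_op_uminus[OF clifford_op_id]])

lemma smooth_form_diff: "smooth_form u \<Longrightarrow> smooth_form w \<Longrightarrow> smooth_form (\<lambda>x. u x - w x)"
  using smooth_form_add[of u "\<lambda>x. - w x"] smooth_form_minus[of w] by simp

lemma smooth_form_sum: "(\<And>i. i \<in> I \<Longrightarrow> smooth_form (u i)) \<Longrightarrow> smooth_form (\<lambda>x. \<Sum>i\<in>I. u i x)"
  by (induction I rule: infinite_finite_induct) (auto intro: smooth_form_zero smooth_form_add)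

lemma dir_add: "smooth_form u \<Longrightarrow> smooth_form w \<Longrightarrow> dir v (\<lambda>x. u x + w x) x = dir v u x + dir v w x"
  by (rule ext) (simp add: dir_apply frechet_derivative_add smooth_form_coeff)

lemma dir_diff: "smooth_form u \<Longrightarrow> smooth_form w \<Longrightarrow> dir v (\<lambda>x. u x - w x) x = dir v u x - dir v w x"
  using dir_add[of u "\<lambda>x. - w x" v x] dir_clifford_op[OF clifford_op_uminus[OF clifford_op_id], of w v x]
  by (simp add: smooth_form_minus)

lemma Avg_add: "smooth_form u \<Longrightarrow> smooth_form w \<Longrightarrow> continuous_on UNIV q \<Longrightarrow> Avg q v (\<lambda>x. u x + w x) x = Avg q v u x + Avg q v w x"
  by (rule ext) (simp add: Avg_apply wavg_add smooth_form_coeff)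

lemma Avg_diff: "smooth_form u \<Longrightarrow> smooth_form w \<Longrightarrow> continuous_on UNIV q \<Longrightarrow> Avg q v (\<lambda>x. u x - w x) x = Avg q v u x - Avg q v w x"
  using Avg_add[of u "\<lambda>x. - w x" q v x] Avg_clifford_op[OF clifford_op_uminus[OF clifford_op_id], of w q v x]
  by (simp add: smooth_form_minus)

lemma dir_const: "dir v (\<lambda>x. \<phi>) x = 0"
  by (rule ext) (simp add: dir_apply)

lemma dir_sum: "(\<And>i. i \<in> I \<Longrightarrow> smooth_form (u i)) \<Longrightarrow> dir v (\<lambda>x. \<Sum>i\<in>I. u i x) x = (\<Sum>i\<in>I. dir v (u i) x)"
proof (induction I rule: infinite_finite_induct)
  case (insert i I)
  have "dir v (\<lambda>x. u i x + (\<Sum>i\<in>I. u i x)) x = dir v (u i) x + dir v (\<lambda>x. \<Sum>i\<in>I. u i x) x"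
    by (rule dir_add) (use insert in \<open>auto intro: smooth_form_sum\<close>)
  then show "dir v (\<lambda>x. \<Sum>i\<in>insert i I. u i x) x = (\<Sum>i\<in>insert i I. dir v (u i) x)"
    using insert by simp
qed (simp_all add: dir_const[of v 0, simplified])

lemma dir_commute: "smooth_form u \<Longrightarrow> dir v (dir w u) x = dir w (dir v u) x"
  by (rule ext) (simp add: dir_apply frechet_derivative_commute smooth_form_coeff)

lemma dir_Avg:
  assumes "smooth_form u" "continuous_on UNIV q" shows "dir w (Avg q v u) x = Avg q v (dir w u) x"
proof
  fix vs
  have "(\<lambda>y. Avg q v u y vs) = wavg 1 q v (\<lambda>y. u y vs)" by (simp add: Avg_apply fun_eq_iff)
  then show "dir w (Avg q v u) x vs = Avg q v (dir w u) x vs"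
    by (simp add: dir_apply Avg_apply frechet_derivative_eqI[OF wavg_has_derivative] assms smooth_form_coeff)
qed

lemma dir_linear: "smooth_form u \<Longrightarrow> linear (\<lambda>v. dir v u x vs)"
  unfolding dir_apply by (rule linear_frechet_derivative) (simp add: smooth_form_coeff smooth_differentiable)

lemma dir_direction:
  assumes "smooth_form u"
  shows "dir (v + w) u x = dir v u x + dir w u x" "dir (r *\<^sub>R v) u x = cscale (complex_of_real r) (dir v u x)" "dir 0 u x = 0"
  using linear_add[OF dir_linear[OF assms]] linear_scale[OF dir_linear[OF assms]] linear_0[OF dir_linear[OF assms]]
  by (auto simp: fun_eq_iff cscale_def scaleR_conv_of_real)

lemma dir_zero_constant_along:
  assumes "smooth_form u" "\<And>y. dir v u y = 0" shows "u (x + t *\<^sub>R v) = u x"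
proof
  fix vs
  have t: "u (x + t *\<^sub>R v) vs = u x vs" if "0 \<le> t" for x t
    using wavg_derivative_ftc[OF smooth_form_coeff[OF assms(1)] that, of v vs x] fun_cong[OF assms(2)]
    by (simp add: dir_apply wavg_def)
  show "u (x + t *\<^sub>R v) vs = u x vs"
    using t[of t x] t[of "-t" "x + t *\<^sub>R v"] by (cases "0 \<le> t") auto
qed

lemma Avg_cong: "(\<And>t. u (x + t *\<^sub>R v) = w (x + t *\<^sub>R v)) \<Longrightarrow> Avg q v u x = Avg q v w x"
  by (rule ext) (simp add: Avg_apply wavg_def)

lemma Avg_const_along:
  assumes "smooth_form u" "\<And>y. dir v u y = 0" shows "Avg (\<lambda>_. 1) v u x = u x"
  using dir_zero_constant_along[OF assms] by (auto simp: fun_eq_iff Avg_apply wavg_def)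

lemma Avg_dir_periodic:
  assumes "smooth_form u" "\<And>y. u (y + v) = u y"
  shows "Avg (\<lambda>_. 1) v (dir v u) x = 0" "Avg (\<lambda>t. t - 1/2) v (dir v u) x = u x - Avg (\<lambda>_. 1) v u x"
proof -
  show "Avg (\<lambda>_. 1) v (dir v u) x = 0"
    using wavg_derivative_ftc[OF smooth_form_coeff[OF assms(1)], of 1 v _ x] assms(2)
    by (auto simp: fun_eq_iff Avg_apply dir_apply)
  show "Avg (\<lambda>t. t - 1/2) v (dir v u) x = u x - Avg (\<lambda>_. 1) v u x"
    using wavg_primitive_ftc[OF smooth_form_coeff[OF assms(1)]] assms(2)
    by (auto simp: fun_eq_iff Avg_apply dir_apply)
qed

lemma ext_d_eq:
  assumes "smooth_form \<omega>"
  shows "ext_d \<omega> x = (\<Sum>b\<in>Basis. covector (blinfun_inner_left b) \<and>\<^sub>f dir b \<omega> x)"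
proof
  fix vs
  have "(\<Sum>i<length vs. (- 1) ^ i * dir (vs ! i) \<omega> x (take i vs @ drop (Suc i) vs)) =
    (\<Sum>b\<in>Basis. covector (blinfun_inner_left b) \<and>\<^sub>f dir b \<omega> x) vs"
    by (rule alternating_sum_conv_wedge[where X = "\<lambda>b. b"])
       (auto simp: euclidean_representation inner_commute dir_linear[OF assms])
  then show "ext_d \<omega> x vs = (\<Sum>b\<in>Basis. covector (blinfun_inner_left b) \<and>\<^sub>f dir b \<omega> x) vs"
    by (simp add: ext_d_def dir_apply)
qed

lemma op_covector_wedge: "clifford_op (\<lambda>\<phi>. covector \<xi> \<and>\<^sub>f \<phi>)"
  by (intro clifford_op.intros)

lemma smooth_form_ext_d: assumes "smooth_form \<omega>" shows "smooth_form (ext_d \<omega>)"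
proof -
  have "ext_d \<omega> = (\<lambda>x. \<Sum>b\<in>Basis. covector (blinfun_inner_left b) \<and>\<^sub>f dir b \<omega> x)"
    using ext_d_eq[OF assms] by blast
  moreover have "smooth_form (\<lambda>x. \<Sum>b\<in>Basis. covector (blinfun_inner_left b) \<and>\<^sub>f dir b \<omega> x)"
    by (intro smooth_form_sum smooth_form_clifford_op[OF op_covector_wedge] smooth_form_dir assms)
  ultimately show ?thesis by simp
qed


lemma ext_d_ext_d: assumes "smooth_form \<omega>" shows "ext_d (ext_d \<omega>) = 0"
proof
  fix x
  let ?w = "\<lambda>b::'a. \<lambda>\<phi>. covector (blinfun_inner_left b) \<and>\<^sub>f \<phi>"
  let ?S = "\<Sum>c\<in>Basis. \<Sum>b\<in>Basis. ?w c (?w b (dir c (dir b \<omega>) x))"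
  have e: "ext_d \<omega> = (\<lambda>x. \<Sum>b\<in>Basis. ?w b (dir b \<omega> x))" using ext_d_eq[OF assms] by blast
  have "dir c (ext_d \<omega>) x = (\<Sum>b\<in>Basis. ?w b (dir c (dir b \<omega>) x))" for c
    unfolding e
    by (subst dir_sum) (auto intro!: smooth_form_clifford_op[OF op_covector_wedge] smooth_form_dir assms sum.cong
      dir_clifford_op[OF op_covector_wedge])
  then have S: "ext_d (ext_d \<omega>) x = ?S"
    by (simp add: ext_d_eq[OF smooth_form_ext_d[OF assms]] wedge_sum_right)
  have "?S = (\<Sum>b\<in>Basis. \<Sum>c\<in>Basis. ?w c (?w b (dir c (dir b \<omega>) x)))" by (rule sum.swap)
  also have "\<dots> = (\<Sum>b\<in>Basis. \<Sum>c\<in>Basis. - ?w b (?w c (dir b (dir c \<omega>) x)))"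
    by (intro sum.cong refl) (subst covector_wedge_anticommute, subst dir_commute[OF assms], rule refl)
  also have "\<dots> = - ?S" by (simp add: sum_negf)
  finally have "?S = - ?S" .
  then have "?S vs = 0" for vs by (auto simp: fun_eq_iff complex_eq_iff)
  then show "ext_d (ext_d \<omega>) x = 0 x" unfolding S by (simp add: fun_eq_iff)
qed


section \<open>The Heisenberg group and the left trivialization\<close>

type_synonym V = "complex ^ 3"

text \<open>
  The nonlinear part of the group law in the chart of matrix entries, and the differential \<open>M x\<close> of
  left translation by \<open>x\<close>, which does not depend on the base point.
\<close>

definition cocycle :: "V \<Rightarrow> V \<Rightarrow> V" where "cocycle x v = axis 3 (x $ 1 * v $ 2)"
definition M :: "V \<Rightarrow> V \<Rightarrow> V" where "M x v = v + cocycle x v"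

lemma cocycle_nth: "cocycle x v $ 1 = 0" "cocycle x v $ 2 = 0" "cocycle x v $ 3 = x $ 1 * v $ 2"
  by (simp_all add: cocycle_def axis_def)

lemma V_eqI: "v $ 1 = w $ 1 \<Longrightarrow> v $ 2 = w $ 2 \<Longrightarrow> v $ 3 = w $ 3 \<Longrightarrow> v = w" for v w :: V
  by (simp add: vec_eq_iff forall_3)

lemma left_translation_eq: "left_translation g h = g + M g h"
  by (rule V_eqI) (simp_all add: left_translation_def heis_chart_def heis_def matrix_matrix_mult_def sum_3 M_def cocycle_nth)

lemma linear_cocycle: "linear (cocycle x)" and linear_M: "linear (M x)" and linear_cocycle_left: "linear (\<lambda>x. cocycle x v)"
  by (rule linearI; rule V_eqI; simp add: M_def cocycle_nth algebra_simps)+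

lemma M_M: "M x (M y v) = M (x + y) v" and M_zero: "M 0 v = v"
  by (rule V_eqI; simp add: M_def cocycle_nth algebra_simps)+

lemma M_left_translation: "M (left_translation g x) v = M g (M x v)"
  by (rule V_eqI) (simp_all add: left_translation_eq M_def cocycle_nth algebra_simps)

lemma M_cancel: "M x (M (- x) v) = v" "M (- x) (M x v) = v"
  by (simp_all add: M_M M_zero)

lemma cocycle_M: "cocycle (M x v) = cocycle v"
  by (auto simp: fun_eq_iff cocycle_def M_def axis_def)

lemma cocycle_basis: "cocycle x v = Re (x $ 1 * v $ 2) *\<^sub>R axis 3 1 + Im (x $ 1 * v $ 2) *\<^sub>R axis 3 \<i>"
  by (rule V_eqI) (simp_all add: cocycle_nth axis_def complex_eq_iff)

lemma left_translation_has_derivative: "(left_translation g has_derivative M g) (at x)"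
proof -
  have "bounded_linear (M g)" using linear_M linear_conv_bounded_linear by blast
  from bounded_linear_imp_has_derivative[OF this] show ?thesis
    unfolding left_translation_eq[abs_def] by (auto intro!: derivative_eq_intros)
qed

lemma frechet_left_translation: "frechet_derivative (left_translation g) (at x) = M g"
  by (rule frechet_derivative_eqI[OF left_translation_has_derivative])

text \<open>
  \<open>hat \<omega>\<close> expresses the field \<open>\<omega>\<close> in left-invariant frames, with values in the forms on the Lie algebra:
  invariance of \<open>\<omega>\<close> under a left translation becomes invariance of the function \<open>hat \<omega>\<close>, and
  left-invariant forms become constant.
\<close>

definition pull :: "('v \<Rightarrow> 'v) \<Rightarrow> 'v form \<Rightarrow> 'v form" where "pull T \<phi> = (\<lambda>vs. \<phi> (map T vs))"
definition hat :: "V form_field \<Rightarrow> V form_field" where "hat \<omega> = (\<lambda>x. pull (M x) (\<omega> x))"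
definition unhat :: "V form_field \<Rightarrow> V form_field" where "unhat u = (\<lambda>x. pull (M (- x)) (u x))"

lemma pull_pull: "pull T (pull S \<phi>) = pull (\<lambda>v. S (T v)) \<phi>" by (simp add: pull_def o_def)
lemma pull_id: "pull (\<lambda>v. v) \<phi> = \<phi>" by (simp add: pull_def)
lemma hat_unhat: "hat (unhat u) = u" and unhat_hat: "unhat (hat \<omega>) = \<omega>"
  by (auto simp: hat_def unhat_def pull_pull M_cancel pull_id)

lemma pull_wedge: "pull T (\<alpha> \<and>\<^sub>f \<beta>) = pull T \<alpha> \<and>\<^sub>f pull T \<beta>"
  by (rule ext) (simp add: pull_def wedge_def nths_map)
lemma pull_contract: "pull T (contract (T v) \<phi>) = contract v (pull T \<phi>)" by (simp add: pull_def contract_def)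
lemma pull_add: "pull T (\<alpha> + \<beta>) = pull T \<alpha> + pull T \<beta>" by (simp add: pull_def fun_eq_iff)
lemma pull_diff: "pull T (\<alpha> - \<beta>) = pull T \<alpha> - pull T \<beta>" by (simp add: pull_def fun_eq_iff)
lemma pull_zero: "pull T 0 = 0" by (simp add: pull_def fun_eq_iff)
lemma pull_cscale: "pull T (cscale c \<alpha>) = cscale c (pull T \<alpha>)" by (simp add: pull_def cscale_def)
lemma pull_sum: "pull T (sum f I) = (\<Sum>i\<in>I. pull T (f i))" by (rule ext) (simp add: pull_def sum_fun_apply)
lemma pull_covector: "(\<And>v. blinfun_apply \<eta> v = blinfun_apply \<xi> (T v)) \<Longrightarrow> pull T (covector \<xi>) = covector \<eta>"
  by (auto simp: pull_def covector_def fun_eq_iff split: list.split)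

lemma hat_zero: "hat 0 = 0"
  by (rule ext) (simp only: hat_def zero_fun_apply pull_zero)

lemma alternating_pull:
  assumes "linear T" "alternating \<phi>" shows "alternating (pull T \<phi>)"
  unfolding alternating_iff_adjacent pull_def map_append list.map
proof (intro conjI allI)
  fix us ws v
  show "linear (\<lambda>v. \<phi> (map T us @ T v # map T ws))"
    using linear_compose[OF assms(1) alternating_linear_append[OF assms(2)]] by (simp add: o_def)
  show "\<phi> (map T us @ T v # T v # map T ws) = 0"
    by (rule alternating_not_distinct[OF assms(2)]) simp
qed

lemma alternating_slot_M:
  assumes "alternating \<phi>"
  shows "\<phi> (us @ M x w # ws) = \<phi> (us @ w # ws) + complex_of_real (Re (x $ 1 * w $ 2)) * \<phi> (us @ axis 3 1 # ws)
     + complex_of_real (Im (x $ 1 * w $ 2)) * \<phi> (us @ axis 3 \<i> # ws)"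
proof -
  note l = alternating_linear_append[OF assms, of us ws]
  show ?thesis
    unfolding M_def cocycle_basis linear_add[OF l] linear_scale[OF l] by (simp add: scaleR_conv_of_real)
qed

lemma smooth_Re_Im: "smooth (\<lambda>x :: V. complex_of_real (Re ((r *\<^sub>R x) $ 1 * c)))" "smooth (\<lambda>x :: V. complex_of_real (Im ((r *\<^sub>R x) $ 1 * c)))"
proof -
  have "bounded_linear (\<lambda>x :: V. (r *\<^sub>R x) $ 1 * c)"
    by (intro bounded_linear_compose[OF bounded_linear_mult_left[of c]] bounded_linear_compose[OF bounded_linear_vec_nth] bounded_linear_scaleR_right)
  then show "smooth (\<lambda>x :: V. complex_of_real (Re ((r *\<^sub>R x) $ 1 * c)))" "smooth (\<lambda>x :: V. complex_of_real (Im ((r *\<^sub>R x) $ 1 * c)))"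
    by (intro smooth_bounded_linear bounded_linear_compose[OF bounded_linear_of_real] bounded_linear_compose[OF bounded_linear_Re]
      bounded_linear_compose[OF bounded_linear_Im]; assumption)+
qed

lemma smooth_form_twist:
  assumes "smooth_form u" shows "smooth_form (\<lambda>x. pull (M (r *\<^sub>R x)) (u x))"
proof -
  have "smooth (\<lambda>x. u x (us @ map (M (r *\<^sub>R x)) ws))" for us ws
  proof (induction ws arbitrary: us)
    case Nil then show ?case by (simp add: smooth_form_coeff[OF assms])
  next
    case (Cons w ws)
    have "smooth (\<lambda>x. u x (us @ v # map (M (r *\<^sub>R x)) ws))" for v
      using Cons[of "us @ [v]"] by simp
    then show ?case
      unfolding list.map alternating_slot_M[OF smooth_form_alternating[OF assms]]
      by (intro smooth_add smooth_mult smooth_Re_Im)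
  qed
  from this[of "[]"] show ?thesis
    using alternating_pull[OF linear_M smooth_form_alternating[OF assms]]
    by (simp add: smooth_form_def) (simp add: pull_def)
qed

lemma smooth_form_hat: "smooth_form \<omega> \<Longrightarrow> smooth_form (hat \<omega>)"
  and smooth_form_unhat: "smooth_form \<omega> \<Longrightarrow> smooth_form (unhat \<omega>)"
  using smooth_form_twist[of \<omega> 1] smooth_form_twist[of \<omega> "-1"] by (simp_all add: hat_def unhat_def)

text \<open>
  The derivation of forms that extends the transpose of \<open>T\<close>: the derivative of \<open>pull\<close> along a curve of
  linear maps through the identity with velocity \<open>T\<close>.
\<close>

primrec der :: "('v \<Rightarrow> 'v) \<Rightarrow> 'v list \<Rightarrow> 'v form \<Rightarrow> complex" where
  "der T [] \<phi> = 0"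
| "der T (w # ws) \<phi> = \<phi> (T w # ws) + der T ws (contract w \<phi>)"

lemma smooth_form_contract: "smooth_form u \<Longrightarrow> smooth_form (\<lambda>x. contract w (u x))"
  by (rule smooth_form_clifford_op[OF clifford_op_contract[OF clifford_op_id]])

lemma dir_contract: "smooth_form u \<Longrightarrow> dir v (\<lambda>x. contract w (u x)) x = contract w (dir v u x)"
  by (rule dir_clifford_op[OF clifford_op_contract[OF clifford_op_id]])

lemma twist_has_derivative:
  assumes "smooth_form u"
  shows "((\<lambda>y. u y (map (M (x - y)) vs)) has_derivative (\<lambda>v. dir v u x vs - der (cocycle v) vs (u x))) (at x)"
  using assms
proof (induction vs arbitrary: u)
  case Nil
  then show ?case by (simp add: dir_apply smooth_has_derivative smooth_form_coeff)
next
  case (Cons w ws)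
  let ?f = "\<lambda>c y. u y (c # map (M (x - y)) ws)"
  have f: "(?f c has_derivative (\<lambda>v. contract c (dir v u x) ws - der (cocycle v) ws (contract c (u x)))) (at x)" for c
    using Cons.IH[OF smooth_form_contract[OF Cons.prems, of c], unfolded dir_contract[OF Cons.prems]]
    by (simp only: contract_def)
  let ?z = "\<lambda>v::V. v $ 1 * w $ 2"
  have bl: "bounded_linear ?z"
    by (intro bounded_linear_compose[OF bounded_linear_mult_left] bounded_linear_vec_nth)
  have z: "((\<lambda>y. ?z (x - y)) has_derivative (\<lambda>v. - ?z v)) (at x)"
  proof -
    have "((\<lambda>y. x - y) has_derivative (\<lambda>v. 0 - v)) (at x)"
      by (intro has_derivative_diff has_derivative_const has_derivative_ident)
    from bounded_linear.has_derivative[OF bl this] show ?thesis by simp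
  qed
  have re: "((\<lambda>y. complex_of_real (Re (?z (x - y)))) has_derivative (\<lambda>v. complex_of_real (Re (- ?z v)))) (at x)"
    by (intro bounded_linear.has_derivative[OF bounded_linear_of_real] bounded_linear.has_derivative[OF bounded_linear_Re] z)
  have im: "((\<lambda>y. complex_of_real (Im (?z (x - y)))) has_derivative (\<lambda>v. complex_of_real (Im (- ?z v)))) (at x)"
    by (intro bounded_linear.has_derivative[OF bounded_linear_of_real] bounded_linear.has_derivative[OF bounded_linear_Im] z)
  have id: "map (M 0) ws = ws" "map (M (x - x)) ws = ws" by (auto intro: map_idI simp: M_zero)
  have lin: "u x (cocycle v w # ws) = complex_of_real (Re (?z v)) * u x (axis 3 1 # ws) + complex_of_real (Im (?z v)) * u x (axis 3 \<i> # ws)" for v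
  proof -
    have l: "linear (\<lambda>v. u x (v # ws))"
      using alternating_linear_append[OF smooth_form_alternating[OF Cons.prems], where us = "[]"] by simp
    show ?thesis unfolding cocycle_basis linear_add[OF l] linear_scale[OF l] scaleR_conv_of_real[where 'a = complex] ..
  qed
  have split: "u y (map (M (x - y)) (w # ws)) = ?f w y + complex_of_real (Re (?z (x - y))) * ?f (axis 3 1) y
     + complex_of_real (Im (?z (x - y))) * ?f (axis 3 \<i>) y" for y
    using alternating_slot_M[OF smooth_form_alternating[OF Cons.prems], where us = "[]"] by simp
  show ?case
    unfolding split
    by (rule has_derivative_eq_rhs[OF has_derivative_add[OF has_derivative_add[OF f has_derivative_mult[OF re f]] has_derivative_mult[OF im f]]])
       (auto simp: fun_eq_iff id lin contract_def algebra_simps)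
qed

context coframe begin

lemma der_eq:
  assumes "alternating \<phi>" "\<And>l v. l \<in> {1..6} \<Longrightarrow> blinfun_apply (\<tau> l) v = blinfun_apply (\<epsilon> l) (T v)"
  shows "der T vs \<phi> = (\<Sum>l\<in>{1..6}. covector (\<tau> l) \<and>\<^sub>f contract (X l) \<phi>) vs"
  using assms(1)
proof (induction vs arbitrary: \<phi>)
  case Nil then show ?case by (simp add: sum_fun_apply covector_wedge_Nil)
next
  case (Cons w ws)
  have "\<phi> (T w # ws) = (\<Sum>l\<in>{1..6}. complex_of_real (blinfun_apply (\<tau> l) w) * contract (X l) \<phi> ws)"
  proof -
    have "linear (\<lambda>v. contract v \<phi> ws)"
      using alternating_linear_append[OF Cons.prems, of "[]" ws] by (simp add: contract_def)
    from linear_frame_expansion[of \<epsilon> X "{1..6}" "\<lambda>v. contract v \<phi>" ws "T w", OF expand _ this]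
    show ?thesis by (simp add: assms(2)) (simp add: contract_def)
  qed
  moreover have "(\<Sum>l\<in>{1..6}. covector (\<tau> l) \<and>\<^sub>f contract (X l) \<phi>) (w # ws)
    = contract w (\<Sum>l\<in>{1..6}. covector (\<tau> l) \<and>\<^sub>f contract (X l) \<phi>) ws" by (simp add: contract_def)
  moreover have "contract w (\<Sum>l\<in>{1..6}. covector (\<tau> l) \<and>\<^sub>f contract (X l) \<phi>) ws =
    (\<Sum>l\<in>{1..6}. complex_of_real (blinfun_apply (\<tau> l) w) * contract (X l) \<phi> ws)
    + (\<Sum>l\<in>{1..6}. covector (\<tau> l) \<and>\<^sub>f contract (X l) (contract w \<phi>)) ws"
    by (simp add: contract_sum contract_covector_wedge sum_fun_apply cscale_apply
       alternating_contract_anticommute[OF Cons.prems, of w] wedge_minus_right sum.distrib)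
  ultimately show ?case using Cons.IH[OF alternating_contract[OF Cons.prems]] by simp
qed

text \<open>
  Multiplication by a two-form with coefficients \<open>a\<close>, of which only the antisymmetric part matters.
\<close>

definition quad :: "(nat \<Rightarrow> nat \<Rightarrow> real) \<Rightarrow> 'v form \<Rightarrow> 'v form" where
  "quad a \<psi> = (\<Sum>k\<in>{1..6}. \<Sum>m\<in>{1..6}. cscale (complex_of_real (a k m)) (covector (\<epsilon> k) \<and>\<^sub>f (covector (\<epsilon> m) \<and>\<^sub>f \<psi>)))"

lemma quad_unit_eval:
  assumes "p \<in> {1..6}" "q \<in> {1..6}"
  shows "quad a unit_form [X p, X q] = complex_of_real (a p q - a q p)"
proof -
  let ?d = "\<lambda>i j :: nat. if i = j then 1 else 0 :: complex"
  have 1: "(covector \<xi> \<and>\<^sub>f \<phi>) (v # vs) = complex_of_real (blinfun_apply \<xi> v) * \<phi> vs - (covector \<xi> \<and>\<^sub>f contract v \<phi>) vs" for \<xi> v vs and \<phi> :: "'v form"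
    using fun_cong[OF contract_covector_wedge, of v \<xi> \<phi> vs] by (simp add: contract_def cscale_def)
  have dl: "complex_of_real (blinfun_apply (\<epsilon> i) (X j)) = ?d i j" if "i \<in> {1..6}" "j \<in> {1..6}" for i j
    using dual[OF that] by simp
  have "(covector (\<epsilon> k) \<and>\<^sub>f (covector (\<epsilon> m) \<and>\<^sub>f unit_form)) [X p, X q] = ?d k p * ?d m q - ?d m p * ?d k q"
    if "k \<in> {1..6}" "m \<in> {1..6}" for k m
    using that assms
    by (simp only: 1 dl contract_covector_wedge contract_unit_form wedge_diff_right wedge_cscale_right wedge_zero_right covector_wedge_Nil)
       (simp add: 1 dl cscale_apply covector_wedge_Nil contract_unit_form wedge_zero_right unit_form_def)
  then have "quad a unit_form [X p, X q] = (\<Sum>k\<in>{1..6}. \<Sum>m\<in>{1..6}. complex_of_real (a k m) * (?d k p * ?d m q - ?d m p * ?d k q))"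
    by (simp add: quad_def sum_fun_apply cscale_apply)
  also have "\<dots> = (\<Sum>k\<in>{1..6}. \<Sum>m\<in>{1..6}. complex_of_real (a k m) * (?d k p * ?d m q)) - (\<Sum>k\<in>{1..6}. \<Sum>m\<in>{1..6}. complex_of_real (a k m) * (?d m p * ?d k q))"
    by (simp add: right_diff_distrib sum_subtractf)
  also have "\<dots> = complex_of_real (a p q) - complex_of_real (a q p)"
  proof -
    have "(\<Sum>k\<in>{1..6}. \<Sum>m\<in>{1..6}. complex_of_real (a k m) * (?d k p' * ?d m q')) = complex_of_real (a p' q')"
      if "p' \<in> {1..6}" "q' \<in> {1..6}" for p' q'
      using that by (simp add: if_distrib[of "\<lambda>x. _ * x"] sum.delta if_distribR cong: if_cong)
    from this[OF assms] this[OF assms(2,1)] show ?thesis by (simp add: mult.commute[of "?d _ p"])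
  qed
  finally show ?thesis by simp
qed

lemma quad_cong:
  assumes "\<And>p q. p \<in> {1..6} \<Longrightarrow> q \<in> {1..6} \<Longrightarrow> a p q - a q p = b p q - b q p"
  shows "quad a \<psi> = quad b \<psi>"
proof -
  let ?E = "\<lambda>k m. covector (\<epsilon> k) \<and>\<^sub>f (covector (\<epsilon> m) \<and>\<^sub>f \<psi>)"
  define c where "c k m = complex_of_real (a k m - b k m)" for k m
  have c: "c p q = c q p" if "p \<in> {1..6}" "q \<in> {1..6}" for p q
    using assms[OF that] by (simp add: c_def) (metis (no_types, lifting) diff_add_cancel diff_diff_eq2 of_real_diff of_real_eq_iff add.commute diff_diff_add)
  have d: "quad a \<psi> - quad b \<psi> = (\<Sum>k\<in>{1..6}. \<Sum>m\<in>{1..6}. cscale (c k m) (?E k m))"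
    unfolding quad_def c_def by (simp add: cform.scale_left_diff_distrib sum_subtractf)
  also have "\<dots> = (\<Sum>m\<in>{1..6}. \<Sum>k\<in>{1..6}. cscale (c k m) (?E k m))" by (rule sum.swap)
  also have "\<dots> = (\<Sum>m\<in>{1..6}. \<Sum>k\<in>{1..6}. - cscale (c m k) (?E m k))"
  proof (intro sum.cong refl)
    fix m k :: nat assume "m \<in> {1..6}" "k \<in> {1..6}"
    then show "cscale (c k m) (?E k m) = - cscale (c m k) (?E m k)"
      using covector_wedge_anticommute[of "\<epsilon> k" "\<epsilon> m" \<psi>] c[of k m] by simp
  qed
  also have "\<dots> = - (quad a \<psi> - quad b \<psi>)" unfolding d by (simp add: sum_negf)
  finally have "quad a \<psi> - quad b \<psi> = 0" by (rule form_eq_minus_self)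
  then show ?thesis by simp
qed

end

locale heisenberg_coframe = coframe \<epsilon> X for \<epsilon> :: "nat \<Rightarrow> (V \<Rightarrow>\<^sub>L real)" and X :: "nat \<Rightarrow> V"
begin

definition D :: "V form_field \<Rightarrow> V form_field" where "D u = hat (ext_d (unhat u))"

text \<open>
  \<open>alg_d\<close> is the Chevalley-Eilenberg differential: \<open>quad (struct l)\<close> is multiplication by
  \<open>d \<epsilon>\<^sup>l\<close>, as the bracket of the Lie algebra is the antisymmetrization of \<open>cocycle\<close>.
\<close>

definition struct :: "nat \<Rightarrow> nat \<Rightarrow> nat \<Rightarrow> real" where
  "struct l k m = - blinfun_apply (\<epsilon> l) (cocycle (X k) (X m))"

definition alg_d :: "V form \<Rightarrow> V form" where
  "alg_d \<phi> = (\<Sum>l\<in>{1..6}. quad (struct l) (contract (X l) \<phi>))"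

lemma cocycle_coframe:
  obtains \<tau> where "\<And>l v. blinfun_apply (\<tau> l) v = blinfun_apply (\<epsilon> l) (cocycle w v)"
proof -
  have "bounded_linear (\<lambda>v. blinfun_apply (\<epsilon> l) (cocycle w v))" for l
    using linear_cocycle[of w] by (intro bounded_linear_compose[OF blinfun.bounded_linear_right]) (simp add: linear_conv_bounded_linear)
  then have "blinfun_apply (Blinfun (\<lambda>v. blinfun_apply (\<epsilon> l) (cocycle w v))) v = blinfun_apply (\<epsilon> l) (cocycle w v)" for l v
    by (simp add: bounded_linear_Blinfun_apply)
  then show ?thesis by (rule that)
qed

lemma der_struct:
  assumes "alternating \<phi>"
  shows "(\<Sum>k\<in>{1..6}. covector (\<epsilon> k) \<and>\<^sub>f (\<lambda>ws. der (cocycle (X k)) ws \<phi>)) = - alg_d \<phi>"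
proof -
  have "covector (\<epsilon> k) \<and>\<^sub>f (\<lambda>ws. der (cocycle (X k)) ws \<phi>) =
     (\<Sum>l\<in>{1..6}. \<Sum>m\<in>{1..6}. cscale (- complex_of_real (struct l k m)) (covector (\<epsilon> k) \<and>\<^sub>f (covector (\<epsilon> m) \<and>\<^sub>f contract (X l) \<phi>)))" for k
  proof -
    obtain \<tau> where \<tau>: "\<And>l v. blinfun_apply (\<tau> l) v = blinfun_apply (\<epsilon> l) (cocycle (X k) v)" using cocycle_coframe by blast
    have "(\<lambda>ws. der (cocycle (X k)) ws \<phi>) = (\<Sum>l\<in>{1..6}. covector (\<tau> l) \<and>\<^sub>f contract (X l) \<phi>)"
      by (rule ext) (rule der_eq[OF assms \<tau>])
    also have "\<dots> = (\<Sum>l\<in>{1..6}. \<Sum>m\<in>{1..6}. cscale (- complex_of_real (struct l k m)) (covector (\<epsilon> m) \<and>\<^sub>f contract (X l) \<phi>))"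
      by (subst covector_wedge_expansion) (simp only: \<tau> struct_def minus_minus of_real_minus)
    finally show ?thesis by (simp only: wedge_sum_right wedge_cscale_right)
  qed
  then have "(\<Sum>k\<in>{1..6}. covector (\<epsilon> k) \<and>\<^sub>f (\<lambda>ws. der (cocycle (X k)) ws \<phi>)) =
     (\<Sum>k\<in>{1..6}. \<Sum>l\<in>{1..6}. \<Sum>m\<in>{1..6}. cscale (- complex_of_real (struct l k m)) (covector (\<epsilon> k) \<and>\<^sub>f (covector (\<epsilon> m) \<and>\<^sub>f contract (X l) \<phi>)))"
    by (simp only:)
  also have "\<dots> = (\<Sum>l\<in>{1..6}. \<Sum>k\<in>{1..6}. \<Sum>m\<in>{1..6}. cscale (- complex_of_real (struct l k m)) (covector (\<epsilon> k) \<and>\<^sub>f (covector (\<epsilon> m) \<and>\<^sub>f contract (X l) \<phi>)))"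
    by (rule sum.swap)
  also have "\<dots> = - alg_d \<phi>"
    unfolding alg_d_def quad_def sum_negf[symmetric] cform.scale_minus_left ..
  finally show ?thesis .
qed

text \<open>
  The Koszul formula on left-invariant fields: the derivatives of the coefficients along the invariant frame
  and the bracket terms. The latter come from differentiating the trivialization itself.
\<close>

lemma D_eq:
  assumes "smooth_form u"
  shows "D u x = (\<Sum>k\<in>{1..6}. covector (\<epsilon> k) \<and>\<^sub>f dir (M x (X k)) u x) + alg_d (u x)"
proof
  fix vs
  note alt = smooth_form_alternating[OF assms]
  define F where "F v = dir (M x v) u x - (\<lambda>ws. der (cocycle v) ws (u x))" for v
  have d: "frechet_derivative (\<lambda>y. unhat u y (map (M x) ws)) (at x) (M x v) = F v ws" for v ws
  proof -
    have "(\<lambda>y. unhat u y (map (M x) ws)) = (\<lambda>y. u y (map (M (x - y)) ws))"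
      by (simp add: unhat_def pull_def o_def M_M fun_eq_iff)
    then show ?thesis
      by (simp add: frechet_derivative_eqI[OF twist_has_derivative[OF assms]] F_def cocycle_M)
  qed
  have der_lin: "linear (\<lambda>v. der (cocycle v) ws \<phi>)" if "alternating \<phi>" for ws \<phi>
    using that
  proof (induction ws arbitrary: \<phi>)
    case (Cons w ws)
    have "linear (\<lambda>v. \<phi> (cocycle v w # ws))"
      using linear_compose[OF linear_cocycle_left alternating_linear_append[OF Cons.prems, of "[]" ws]] by (simp add: o_def)
    then show ?case using Cons.IH[OF alternating_contract[OF Cons.prems]] by (simp add: linear_compose_add)
  qed (simp add: linear_zero)
  have lin: "linear (\<lambda>v. F v ws)" for ws
  proof -
    have "linear (\<lambda>v. dir (M x v) u x ws)"
      using linear_compose[OF linear_M dir_linear[OF assms]] by (simp add: o_def)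
    then show ?thesis using der_lin[OF alt] by (simp add: F_def linear_compose_sub)
  qed
  have "D u x vs = (\<Sum>i<length vs. (- 1) ^ i * F (vs ! i) (take i vs @ drop (Suc i) vs))"
    by (simp add: D_def hat_def pull_def ext_d_def take_map drop_map d flip: map_append)
  also have "\<dots> = (\<Sum>k\<in>{1..6}. covector (\<epsilon> k) \<and>\<^sub>f F (X k)) vs"
    by (rule alternating_sum_conv_wedge[OF expand]) (auto simp: lin)
  also have "(\<Sum>k\<in>{1..6}. covector (\<epsilon> k) \<and>\<^sub>f F (X k)) = (\<Sum>k\<in>{1..6}. covector (\<epsilon> k) \<and>\<^sub>f dir (M x (X k)) u x) + alg_d (u x)"
    unfolding F_def wedge_diff_right sum_subtractf der_struct[OF alt] by simp
  finally show "D u x vs = ((\<Sum>k\<in>{1..6}. covector (\<epsilon> k) \<and>\<^sub>f dir (M x (X k)) u x) + alg_d (u x)) vs" .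
qed

lemma smooth_form_D: "smooth_form u \<Longrightarrow> smooth_form (D u)"
  by (simp add: D_def smooth_form_hat smooth_form_ext_d smooth_form_unhat)

lemma D_D: "smooth_form u \<Longrightarrow> D (D u) = 0"
  by (simp add: D_def unhat_hat ext_d_ext_d smooth_form_unhat hat_zero)

lemma D_const: "alternating \<phi> \<Longrightarrow> D (\<lambda>x. \<phi>) x = alg_d \<phi>"
  by (simp add: D_eq smooth_form_const dir_const wedge_zero_right)

lemma quad_zero: "quad a 0 = 0"
  unfolding quad_def by (simp add: wedge_zero_right)

lemma contract_X_covector: "l \<in> {1..6} \<Longrightarrow> m \<in> {1..6} \<Longrightarrow> contract (X l) (covector (\<epsilon> m)) = (if l = m then unit_form else 0)"
  by (auto simp: contract_covector dual)

lemma alg_d_covector: assumes "m \<in> {1..6}" shows "alg_d (covector (\<epsilon> m)) = quad (struct m) unit_form"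
proof -
  have "alg_d (covector (\<epsilon> m)) = (\<Sum>l\<in>{1..6}. if l = m then quad (struct m) unit_form else 0)"
    unfolding alg_d_def by (rule sum.cong) (auto simp only: contract_X_covector assms quad_zero if_True if_False split: if_split)
  then show ?thesis using assms by (simp add: sum.delta)
qed

end

text \<open>The structure constants of the complex Heisenberg algebra; \<open>quad\<close> of the table for \<open>l\<close> is \<open>d \<epsilon>\<^sup>l\<close>.\<close>

fun iwasawa_table :: "nat \<Rightarrow> nat \<Rightarrow> nat \<Rightarrow> real" where
  "iwasawa_table l k m =
    (if l = 5 then (if k = 1 \<and> m = 3 then 1 else if k = 2 \<and> m = 4 then - 1 else 0)
     else if l = 6 then (if k = 1 \<and> m = 4 \<or> k = 2 \<and> m = 3 then 1 else 0) else 0)"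

locale iwasawa_coframe = heisenberg_coframe +
  assumes structure_equations: "\<And>l. l \<in> {1..6} \<Longrightarrow> alg_d (covector (\<epsilon> l)) = quad (iwasawa_table l) unit_form"
begin

text \<open>
  The structure equations determine the two-forms \<open>d \<epsilon>\<^sup>l\<close> through their values on the frame, so
  \<open>alg_d = (\<epsilon>\<^sup>1\<^sup>3 - \<epsilon>\<^sup>2\<^sup>4) \<iota>\<^sub>5 + (\<epsilon>\<^sup>1\<^sup>4 + \<epsilon>\<^sup>2\<^sup>3) \<iota>\<^sub>6\<close>, which is \<open>d0\<close> in complex modes.
\<close>

lemma alg_d_eq_d0: assumes "alternating \<phi>" shows "alg_d \<phi> = d0 \<phi>"
proof -
  have q: "quad (struct l) \<psi> = quad (iwasawa_table l) \<psi>" if l: "l \<in> {1..6}" for l \<psi>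
  proof (rule quad_cong)
    fix p q :: nat assume pq: "p \<in> {1..6}" "q \<in> {1..6}"
    from alg_d_covector[OF l] structure_equations[OF l]
    have "quad (struct l) unit_form [X p, X q] = quad (iwasawa_table l) unit_form [X p, X q]" by simp
    then show "struct l p q - struct l q p = iwasawa_table l p q - iwasawa_table l q p"
      by (simp only: quad_unit_eval[OF pq] of_real_eq_iff)
  qed
  have "alg_d \<phi> = (\<Sum>l\<in>{1..6}. quad (iwasawa_table l) (contract (X l) \<phi>))"
    unfolding alg_d_def by (rule sum.cong) (auto simp: q)
  also have "\<dots> = d0 \<phi>"
    unfolding atLeastAtMost_1_6 quad_def d0_def del0_def delb0_def
    by (simp add: real_modes assms alternating_contract alternating_covector_wedge mode_alternating
         alternating_add alternating_diff alternating_cscale alternating_minus mode_linear)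
       (simp add: fun_eq_iff cscale_apply field_simps)
  finally show ?thesis .
qed

end


section \<open>Averaging to invariant forms\<close>

definition central_dirs :: "V set" where "central_dirs = {axis 3 1, axis 3 \<i>}"
definition central :: "V \<Rightarrow> bool" where "central b \<longleftrightarrow> (\<forall>x. cocycle x b = 0 \<and> cocycle b x = 0)"

locale iwasawa_lattice = iwasawa_coframe +
  fixes G :: "V set"
  assumes units: "c \<in> {1, \<i>} \<Longrightarrow> axis i c \<in> G"
begin

text \<open>
  Trivialized forms on the quotient whose coefficients are constant along the directions in \<open>Z\<close>.
  A lattice direction is \<open>admissible\<close> if translation by it is compatible with the deck group and the
  invariant frame, which the central directions are always, and all others are on
  fields that do not depend on the central coordinate.
\<close>

definition inv_fields :: "V set \<Rightarrow> V form_field set" where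
  "inv_fields Z = {u. smooth_form u \<and> (\<forall>g\<in>G. \<forall>x. u (left_translation g x) = u x) \<and> (\<forall>b\<in>Z. \<forall>x. dir b u x = 0)}"

definition admissible :: "V \<Rightarrow> V set \<Rightarrow> bool" where
  "admissible b Z \<longleftrightarrow> b \<in> G \<and> (central b \<or> central_dirs \<subseteq> Z)"

lemma inv_fields_smooth: "u \<in> inv_fields Z \<Longrightarrow> smooth_form u"
  and inv_fields_invariant: "u \<in> inv_fields Z \<Longrightarrow> g \<in> G \<Longrightarrow> u (left_translation g x) = u x"
  and inv_fields_dir: "u \<in> inv_fields Z \<Longrightarrow> b \<in> Z \<Longrightarrow> dir b u x = 0"
  and inv_fields_mono: "Z \<subseteq> Z' \<Longrightarrow> inv_fields Z' \<subseteq> inv_fields Z"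
  by (auto simp: inv_fields_def)

lemma inv_fields_clifford_op: "clifford_op T \<Longrightarrow> u \<in> inv_fields Z \<Longrightarrow> (\<lambda>x. T (u x)) \<in> inv_fields Z"
  by (simp add: inv_fields_def smooth_form_clifford_op dir_clifford_op clifford_op_zero) (simp add: zero_fun_def)

lemma inv_fields_add: "u \<in> inv_fields Z \<Longrightarrow> w \<in> inv_fields Z \<Longrightarrow> (\<lambda>x. u x + w x) \<in> inv_fields Z"
  by (simp add: inv_fields_def smooth_form_add dir_add)

lemma inv_fields_diff: "u \<in> inv_fields Z \<Longrightarrow> w \<in> inv_fields Z \<Longrightarrow> (\<lambda>x. u x - w x) \<in> inv_fields Z"
  by (simp add: inv_fields_def smooth_form_diff dir_diff)

lemma inv_fields_const: "alternating \<phi> \<Longrightarrow> (\<lambda>x. \<phi>) \<in> inv_fields Z"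
  by (simp add: inv_fields_def smooth_form_const dir_const)


lemma dir_cocycle:
  assumes "central_dirs \<subseteq> Z" "u \<in> inv_fields Z" shows "dir (cocycle x v) u y = 0"
proof -
  have "dir (axis 3 1) u y = 0" "dir (axis 3 \<i>) u y = 0"
    using inv_fields_dir[OF assms(2)] assms(1) by (auto simp: central_dirs_def)
  then show ?thesis
    unfolding cocycle_basis by (simp only: dir_direction[OF inv_fields_smooth[OF assms(2)]] cform.scale_zero_right add_0)
qed

lemma admissible_dir:
  assumes "admissible b Z" "u \<in> inv_fields Z"
  shows "dir (M x b) u y = dir b u y" "dir (M (x + t *\<^sub>R b) v) u y = dir (M x v) u y"
proof -
  have "dir (cocycle x b) u y = 0 \<and> dir (cocycle b v) u y = 0"
    using assms dir_cocycle[of Z u] dir_direction(3)[OF inv_fields_smooth[OF assms(2)]] by (auto simp: admissible_def central_def)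
  note h = this[THEN conjunct1] this[THEN conjunct2]
  show "dir (M x b) u y = dir b u y" by (simp add: M_def dir_direction[OF inv_fields_smooth[OF assms(2)]] h)
  have "M (x + t *\<^sub>R b) v = M x v + t *\<^sub>R cocycle b v" by (rule V_eqI) (simp_all add: M_def cocycle_nth algebra_simps)
  then show "dir (M (x + t *\<^sub>R b) v) u y = dir (M x v) u y"
    by (simp add: dir_direction[OF inv_fields_smooth[OF assms(2)]] h)
qed

lemma admissible_shift:
  assumes "admissible b Z" "u \<in> inv_fields Z"
  shows "u (y + cocycle g (t *\<^sub>R b)) = u y" "u (y + cocycle b v) = u y"
proof -
  have 1: "u (y + cocycle x v) = u y" if "central_dirs \<subseteq> Z" for x v
    using dir_zero_constant_along[OF inv_fields_smooth[OF assms(2)] dir_cocycle[OF that assms(2)], of y 1] by simp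
  have 2: "cocycle g (t *\<^sub>R b) = 0" "cocycle b v = 0" if "central b"
    using that linear_scale[OF linear_cocycle] by (auto simp: central_def)
  show "u (y + cocycle g (t *\<^sub>R b)) = u y" "u (y + cocycle b v) = u y"
    using assms(1) 1 2 by (auto simp: admissible_def)
qed

lemma admissible_periodic: assumes "admissible b Z" "u \<in> inv_fields Z" shows "u (y + b) = u y"
proof -
  have "u y = u (left_translation b y)" using inv_fields_invariant[OF assms(2)] assms(1) by (simp add: admissible_def)
  also have "left_translation b y = (y + b) + cocycle b y" by (simp add: left_translation_eq M_def)
  finally show ?thesis using admissible_shift(2)[OF assms] by simp
qed

lemma Avg_inv_fields:
  assumes "admissible b Z" "u \<in> inv_fields Z" "continuous_on UNIV q" shows "Avg q b u \<in> inv_fields Z"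
  unfolding inv_fields_def
proof (intro CollectI conjI ballI allI)
  show "smooth_form (Avg q b u)" by (intro smooth_form_Avg inv_fields_smooth[OF assms(2)] assms(3))
next
  fix g x assume g: "g \<in> G"
  have "u (left_translation g x + t *\<^sub>R b) = u (x + t *\<^sub>R b)" for t
  proof -
    have "u (x + t *\<^sub>R b) = u (left_translation g (x + t *\<^sub>R b))" using inv_fields_invariant[OF assms(2) g] by simp
    also have "left_translation g (x + t *\<^sub>R b) = (left_translation g x + t *\<^sub>R b) + cocycle g (t *\<^sub>R b)"
      by (simp add: left_translation_eq M_def linear_add[OF linear_cocycle])
    finally show ?thesis using admissible_shift(1)[OF assms(1,2)] by simp
  qed
  then show "Avg q b u (left_translation g x) = Avg q b u x"
    by (auto simp: fun_eq_iff Avg_apply wavg_def)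
next
  fix c x assume "c \<in> Z"
  then have "dir c u = (\<lambda>x. 0)" using inv_fields_dir[OF assms(2)] by blast
  then show "dir c (Avg q b u) x = 0"
    by (simp add: dir_Avg[OF inv_fields_smooth[OF assms(2)] assms(3)]) (simp add: fun_eq_iff Avg_apply wavg_def)
qed

lemma D_eq_d0:
  assumes "smooth_form u"
  shows "D u x = (\<Sum>k\<in>{1..6}. covector (\<epsilon> k) \<and>\<^sub>f dir (M x (X k)) u x) + d0 (u x)"
  by (simp add: D_eq[OF assms] alg_d_eq_d0[OF smooth_form_alternating[OF assms]])

lemma D_add: "smooth_form u \<Longrightarrow> smooth_form w \<Longrightarrow> D (\<lambda>x. u x + w x) x = D u x + D w x"
  by (simp add: D_eq_d0 smooth_form_add dir_add wedge_add_right sum.distrib clifford_op_additive[OF op_d0])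

lemma D_minus: "smooth_form u \<Longrightarrow> D (\<lambda>x. - u x) x = - D u x"
  using dir_clifford_op[OF clifford_op_uminus[OF clifford_op_id], of u]
  by (simp add: D_eq_d0 smooth_form_minus wedge_minus_right sum_negf clifford_op_minus[OF op_d0])

lemma D_diff: "smooth_form u \<Longrightarrow> smooth_form w \<Longrightarrow> D (\<lambda>x. u x - w x) x = D u x - D w x"
  using D_add[of u "\<lambda>x. - w x" x] D_minus[of w x] by (simp add: smooth_form_minus)

lemma D_constant: "alternating \<phi> \<Longrightarrow> D (\<lambda>x. \<phi>) x = d0 \<phi>"
  by (simp add: D_const alg_d_eq_d0)

lemma D_Avg:
  assumes "admissible b Z" "u \<in> inv_fields Z" "continuous_on UNIV q" shows "D (Avg q b u) = Avg q b (D u)"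
proof
  fix x
  note s = inv_fields_smooth[OF assms(2)]
  define T where "T k \<phi> = covector (\<epsilon> k) \<and>\<^sub>f \<phi>" for k \<phi>
  have T: "clifford_op (T k)" for k unfolding T_def[abs_def] by (rule op_covector_wedge)
  define w where "w y = (\<Sum>k\<in>{1..6}. T k (dir (M x (X k)) u y))" for y
  have w: "smooth_form w" unfolding w_def by (intro smooth_form_sum smooth_form_clifford_op[OF T] smooth_form_dir s)
  have Asum: "Avg q b (\<lambda>y. \<Sum>k\<in>I. f k y) x = (\<Sum>k\<in>I. Avg q b (f k) x)" if "\<And>k. smooth_form (f k)" for f and I :: "nat set"
  proof (induction I rule: infinite_finite_induct)
    case (insert i I)
    have "Avg q b (\<lambda>y. f i y + (\<Sum>k\<in>I. f k y)) x = Avg q b (f i) x + Avg q b (\<lambda>y. \<Sum>k\<in>I. f k y) x"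
      by (intro Avg_add that smooth_form_sum assms(3))
    then show "Avg q b (\<lambda>y. \<Sum>k\<in>insert i I. f k y) x = (\<Sum>k\<in>insert i I. Avg q b (f k) x)" using insert by simp
  qed (simp_all add: fun_eq_iff Avg_apply wavg_def)
  have "Avg q b (D u) x = Avg q b (\<lambda>y. w y + d0 (u y)) x"
    by (rule Avg_cong) (simp add: D_eq_d0[OF s] admissible_dir(2)[OF assms(1,2)] w_def T_def)
  also have "\<dots> = Avg q b w x + d0 (Avg q b u x)"
    by (simp add: Avg_add[OF w smooth_form_clifford_op[OF op_d0 s] assms(3)] Avg_clifford_op[OF op_d0 s assms(3)])
  also have "Avg q b w x = (\<Sum>k\<in>{1..6}. Avg q b (\<lambda>y. T k (dir (M x (X k)) u y)) x)"
    unfolding w_def by (intro Asum smooth_form_clifford_op[OF T] smooth_form_dir s)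
  also have "\<dots> = (\<Sum>k\<in>{1..6}. T k (dir (M x (X k)) (Avg q b u) x))"
    by (intro sum.cong refl) (simp add: Avg_clifford_op[OF T smooth_form_dir[OF s] assms(3)] dir_Avg[OF s assms(3)])
  finally show "D (Avg q b u) x = Avg q b (D u) x"
    by (simp only: D_eq_d0[OF smooth_form_Avg[OF s assms(3)]] T_def)
qed

text \<open>
  The Lie derivative along the invariant field \<open>b\<close> of forms with constant coefficients.
\<close>

definition lie :: "V \<Rightarrow> V form \<Rightarrow> V form" where "lie b \<phi> = contract b (d0 \<phi>) + d0 (contract b \<phi>)"

lemma op_lie: "clifford_op (lie b)"
  unfolding lie_def[abs_def] by (intro clifford_op_add clifford_op_contract op_d0 clifford_op_comp[OF op_d0] clifford_op_id)

text \<open>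
  \<open>lie b\<close> trades \<open>\<zeta>\<close>, \<open>\<zeta>'\<close> for combinations of the other generators, and there are only two of them to
  trade.
\<close>

lemma lie_nilpotent: assumes "alternating \<phi>" shows "lie b (lie b (lie b \<phi>)) = 0"
proof -
  obtain x y where xy: "\<And>\<phi>. alternating \<phi> \<Longrightarrow> cliffordC ((b, 0), 0) \<phi> = (\<Sum>k\<in>{1..6}. cscale (x k) (C k \<phi>) + cscale (y k) (W k \<phi>))"
    using mode_expansion[of "((b, 0), 0)"] by blast
  have c0: "covector 0 = (0 :: V form)" by (auto simp: fun_eq_iff covector_def split: list.split)
  have cl: "cliffordC ((b, 0), 0) \<phi> = contract b \<phi>" if "alternating \<phi>" for \<phi>
    by (simp add: cliffordC_def clifford_def c0 wedge_zero_left alternating_contract_linear(3)[OF that])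
  \<comment> \<open>\<open>p\<close> and \<open>q\<close> are contractions of \<open>\<theta> \<and> \<eta>\<close> and its conjugate with \<open>b\<close>.\<close>
  define p where "p \<phi> = cscale (x 1) (W 2 \<phi>) - cscale (x 2) (W 1 \<phi>)" for \<phi>
  define q where "q \<phi> = cscale (x 4) (W 5 \<phi>) - cscale (x 5) (W 4 \<phi>)" for \<phi>
  have e: "contract b \<phi> = cscale (x 1) (C 1 \<phi>) + cscale (y 1) (W 1 \<phi>) + cscale (x 2) (C 2 \<phi>) + cscale (y 2) (W 2 \<phi>)
      + cscale (x 3) (C 3 \<phi>) + cscale (y 3) (W 3 \<phi>) + cscale (x 4) (C 4 \<phi>) + cscale (y 4) (W 4 \<phi>)
      + cscale (x 5) (C 5 \<phi>) + cscale (y 5) (W 5 \<phi>) + cscale (x 6) (C 6 \<phi>) + cscale (y 6) (W 6 \<phi>)"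
    if "alternating \<phi>" for \<phi>
    using xy[OF that] cl[OF that] unfolding atLeastAtMost_1_6 by (simp add: add.assoc)
  have y: "y 3 = 0 \<and> y 6 = 0"
  proof -
    have u: "contract b unit_form = 0" by (rule contract_unit_form)
    have "C 3 (contract b unit_form) = cscale (y 3) unit_form" "C 6 (contract b unit_form) = cscale (y 6) unit_form"
      by (simp_all add: e alternating_unit_form normal_order C_unit_form)
    then show ?thesis unfolding u clifford_op_zero[OF op_C] by (auto simp: fun_eq_iff cscale_apply unit_form_def split: if_splits)
  qed
  have l: "lie b \<phi> = p (C 3 \<phi>) + q (C 6 \<phi>)" if "alternating \<phi>" for \<phi>
    using that unfolding lie_def d0_def del0_def delb0_def p_def q_def
    by (simp add: e mode_alternating alternating_add normal_order y) (simp add: fun_eq_iff cscale_apply algebra_simps)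
  show ?thesis
    by (simp add: l assms p_def q_def mode_alternating alternating_add alternating_diff alternating_cscale normal_order)
qed

lemma cartan:
  assumes "smooth_form u"
  shows "D (\<lambda>x. contract b (u x)) x + contract b (D u x) = dir (M x b) u x + lie b (u x)"
proof -
  have lin: "dir (M x b) u x = (\<Sum>k\<in>{1..6}. cscale (complex_of_real (blinfun_apply (\<epsilon> k) b)) (dir (M x (X k)) u x))"
  proof
    fix vs
    have "linear (\<lambda>v. dir (M x v) u x vs)" using linear_compose[OF linear_M dir_linear[OF assms]] by (simp add: o_def)
    from linear_frame_expansion[of \<epsilon> X "{1..6}" "\<lambda>v. dir (M x v) u x" vs b, OF expand _ this]
    show "dir (M x b) u x vs = (\<Sum>k\<in>{1..6}. cscale (complex_of_real (blinfun_apply (\<epsilon> k) b)) (dir (M x (X k)) u x)) vs"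
      by (simp add: sum_fun_apply cscale_apply)
  qed
  show ?thesis
    unfolding D_eq_d0[OF assms] D_eq_d0[OF smooth_form_contract[OF assms]] dir_contract[OF assms] lin lie_def
      contract_add contract_sum contract_covector_wedge sum_subtractf
    by simp
qed

abbreviation "mean \<equiv> Avg (\<lambda>_. 1)"

lemma mean_inv_fields: assumes "admissible b Z" "u \<in> inv_fields Z" shows "mean b u \<in> inv_fields (insert b Z)"
proof -
  have "dir b (mean b u) x = 0" for x
    using Avg_dir_periodic(1)[OF inv_fields_smooth[OF assms(2)] admissible_periodic[OF assms]]
    by (simp add: dir_Avg[OF inv_fields_smooth[OF assms(2)]])
  then show ?thesis using Avg_inv_fields[OF assms, of "\<lambda>_. 1"] by (auto simp: inv_fields_def)
qed

text \<open>
  The primitive along \<open>b\<close> of \<open>u - mean b u\<close>, normalized to have mean zero.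
\<close>

definition prim :: "V \<Rightarrow> V form_field \<Rightarrow> V form_field" where
  "prim b u = (\<lambda>x. Avg (\<lambda>t. t - 1/2) b u x - mean b (Avg (\<lambda>t. t - 1/2) b u) x)"

lemma prim_facts:
  assumes g: "admissible b Z" and u: "u \<in> inv_fields Z"
  shows "prim b u \<in> inv_fields Z" "dir b (prim b u) x = u x - mean b u x" "mean b (prim b u) x = 0"
    "D u = 0 \<Longrightarrow> D (prim b u) = 0" "clifford_op T \<Longrightarrow> prim b (\<lambda>x. T (u x)) = (\<lambda>x. T (prim b u x))"
proof -
  have q: "continuous_on UNIV (\<lambda>t :: real. t - 1/2)" "continuous_on UNIV (\<lambda>t :: real. 1 :: real)" by (intro continuous_intros)+
  let ?P = "Avg (\<lambda>t. t - 1/2) b u"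
  have P: "?P \<in> inv_fields Z" by (rule Avg_inv_fields[OF g u q(1)])
  have A: "mean b ?P \<in> inv_fields Z" by (rule Avg_inv_fields[OF g P q(2)])
  have A': "mean b ?P \<in> inv_fields (insert b Z)" by (rule mean_inv_fields[OF g P])
  show "prim b u \<in> inv_fields Z" unfolding prim_def by (rule inv_fields_diff[OF P A])
  have "dir b ?P x = u x - mean b u x"
    using Avg_dir_periodic(2)[OF inv_fields_smooth[OF u] admissible_periodic[OF g u]] by (simp add: dir_Avg[OF inv_fields_smooth[OF u] q(1)])
  then show "dir b (prim b u) x = u x - mean b u x"
    unfolding prim_def by (simp add: dir_diff inv_fields_smooth[OF P] inv_fields_smooth[OF A] inv_fields_dir[OF A'])
  show "mean b (prim b u) x = 0"
    unfolding prim_def using Avg_const_along[OF inv_fields_smooth[OF A] inv_fields_dir[OF A']]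
    by (simp add: Avg_diff inv_fields_smooth[OF P] inv_fields_smooth[OF A])
  show "D (prim b u) = 0" if "D u = 0"
  proof -
    have "D ?P = 0" unfolding D_Avg[OF g u q(1)] that by (simp add: fun_eq_iff Avg_apply wavg_def)
    moreover from this have "D (mean b ?P) = 0" unfolding D_Avg[OF g P q(2)] by (simp add: fun_eq_iff Avg_apply wavg_def)
    ultimately show ?thesis unfolding prim_def by (intro ext) (simp add: D_diff inv_fields_smooth[OF P] inv_fields_smooth[OF A])
  qed
  show "prim b (\<lambda>x. T (u x)) = (\<lambda>x. T (prim b u x))" if T: "clifford_op T"
  proof -
    have "Avg (\<lambda>t. t - 1/2) b (\<lambda>x. T (u x)) = (\<lambda>x. T (?P x))"
      using Avg_clifford_op[OF T inv_fields_smooth[OF u] q(1)] by blast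
    then show ?thesis unfolding prim_def
      by (simp add: Avg_clifford_op[OF T inv_fields_smooth[OF P]] clifford_op_diff[OF T])
  qed
qed

text \<open>
  By Cartan's formula a closed field \<open>u\<close> of mean zero differs from \<open>- lie b (prim b u)\<close> by an exact
  one. The remainder is of the same kind and is killed by a lower power of \<open>lie b\<close>.
\<close>

lemma exact_if_mean_zero:
  assumes g: "admissible b Z" and "u \<in> inv_fields Z" "D u = 0" "\<And>x. mean b u x = 0" "\<And>x. (lie b ^^ m) (u x) = 0"
  shows "\<exists>w\<in>inv_fields Z. u = D w"
  using assms(2-)
proof (induction m arbitrary: u)
  case 0
  have "u = (\<lambda>x. 0)"
    by (rule ext) (use 0(4) in \<open>simp only: funpow.simps id_apply\<close>)
  moreover have "D (\<lambda>x. 0) = (\<lambda>x. 0)"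
    by (rule ext) (simp add: D_constant alternating_zero clifford_op_zero[OF op_d0])
  ultimately show "\<exists>w\<in>inv_fields Z. u = D w"
    using inv_fields_const[OF alternating_zero, of Z] by (intro bexI[of _ "\<lambda>x. 0"]) (simp_all only:)
next
  case (Suc m)
  note s = inv_fields_smooth[OF Suc.prems(1)]
  note p = prim_facts[OF g Suc.prems(1)]
  have Dp: "D (prim b u) x = 0" for x using p(4)[OF Suc.prems(2)] by simp
  define v where "v = (\<lambda>x. lie b (prim b u x))"
  define w where "w = (\<lambda>x. contract b (prim b u x))"
  have v: "v \<in> inv_fields Z" unfolding v_def by (rule inv_fields_clifford_op[OF op_lie p(1)])
  have w: "w \<in> inv_fields Z" unfolding w_def by (rule inv_fields_clifford_op[OF clifford_op_contract[OF clifford_op_id] p(1)])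
  have Du: "D u = 0" by (rule Suc.prems(2))
  have mz: "mean b u x = 0" for x by (rule Suc.prems(3))
  have eq: "u x = D w x - v x" for x
    using cartan[OF inv_fields_smooth[OF p(1)], of b x] p(2)[of x] admissible_dir(1)[OF g p(1), of x x]
    by (simp add: Dp contract_zero w_def v_def mz)
  have pow: "clifford_op (lie b ^^ m)" for m
  proof (induction m)
    case 0 then show ?case using clifford_op_id by (simp add: id_def)
  next
    case (Suc m) then show ?case using clifford_op_comp[OF op_lie Suc] by (simp add: o_def)
  qed
  have "D v x = 0" for x
  proof -
    have "v = (\<lambda>x. D w x - u x)" using eq by (auto simp: fun_eq_iff)
    then have "D v x = D (D w) x - D u x" by (simp add: D_diff smooth_form_D[OF inv_fields_smooth[OF w]] s)
    then show ?thesis by (simp add: D_D[OF inv_fields_smooth[OF w]] Du)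
  qed
  then have "D v = 0" by auto
  moreover have "mean b v x = 0" for x
    unfolding v_def by (simp add: Avg_clifford_op[OF op_lie inv_fields_smooth[OF p(1)]] p(3) clifford_op_zero[OF op_lie])
  moreover have "(lie b ^^ m) (v x) = 0" for x
  proof -
    have "(lie b ^^ m) (v x) = (lie b ^^ Suc m) (prim b u x)" by (simp add: v_def funpow_swap1)
    also have "\<dots> = prim b (\<lambda>x. (lie b ^^ Suc m) (u x)) x" using p(5)[OF pow[of "Suc m"]] by metis
    also have "\<dots> = 0" unfolding Suc.prems(4) by (simp add: prim_def fun_eq_iff Avg_apply wavg_def)
    finally show ?thesis .
  qed
  ultimately obtain v' where v': "v' \<in> inv_fields Z" "v = D v'" using Suc.IH[OF v] by blast
  have "u = D (\<lambda>x. w x - v' x)"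
    using eq by (intro ext) (simp add: D_diff inv_fields_smooth[OF w] inv_fields_smooth[OF v'(1)] v'(2))
  then show ?case using inv_fields_diff[OF w v'(1)] by blast
qed

lemma closed_minus_mean:
  assumes g: "admissible b Z" and u: "u \<in> inv_fields Z" "D u = 0"
  shows "\<exists>w\<in>inv_fields Z. (\<lambda>x. u x - mean b u x) = D w"
proof (rule exact_if_mean_zero[OF g, where m = 3])
  have A: "mean b u \<in> inv_fields Z" by (rule Avg_inv_fields[OF g u(1)]) simp
  have A': "mean b u \<in> inv_fields (insert b Z)" by (rule mean_inv_fields[OF g u(1)])
  show d: "(\<lambda>x. u x - mean b u x) \<in> inv_fields Z" by (rule inv_fields_diff[OF u(1) A])
  have "D (mean b u) = 0" using D_Avg[OF g u(1), of "\<lambda>_. 1"] u(2) by (simp add: fun_eq_iff Avg_apply wavg_def)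
  then show "D (\<lambda>x. u x - mean b u x) = 0"
    using u(2) by (intro ext) (simp add: D_diff inv_fields_smooth[OF u(1)] inv_fields_smooth[OF A])
  show "mean b (\<lambda>x. u x - mean b u x) x = 0" for x
    using Avg_const_along[OF inv_fields_smooth[OF A] inv_fields_dir[OF A']]
    by (simp add: Avg_diff inv_fields_smooth[OF u(1)] inv_fields_smooth[OF A])
  show "(lie b ^^ 3) (u x - mean b u x) = 0" for x
    using lie_nilpotent[OF smooth_form_alternating[OF inv_fields_smooth[OF d]]] by (simp add: eval_nat_numeral)
qed


primrec mean_list :: "V list \<Rightarrow> V form_field \<Rightarrow> V form_field" where
  "mean_list [] u = u"
| "mean_list (b # bs) u = mean_list bs (mean b u)"

primrec admissible_list :: "V list \<Rightarrow> V set \<Rightarrow> bool" where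
  "admissible_list [] Z = True"
| "admissible_list (b # bs) Z = (admissible b Z \<and> admissible_list bs (insert b Z))"

lemma mean_list_inv_fields: "admissible_list bs Z \<Longrightarrow> u \<in> inv_fields Z \<Longrightarrow> mean_list bs u \<in> inv_fields (set bs \<union> Z)"
proof (induction bs arbitrary: u Z)
  case (Cons b bs)
  then show ?case using Cons.IH[of "insert b Z" "mean b u"] mean_inv_fields[of b Z u] by simp
qed simp

lemma D_mean_list: "admissible_list bs Z \<Longrightarrow> u \<in> inv_fields Z \<Longrightarrow> D (mean_list bs u) = mean_list bs (D u)"
proof (induction bs arbitrary: u Z)
  case (Cons b bs)
  then show ?case using Cons.IH[of "insert b Z" "mean b u"] mean_inv_fields[of b Z u] by (simp add: D_Avg[of b Z u])
qed simp

lemma mean_list_clifford_op: "clifford_op T \<Longrightarrow> smooth_form u \<Longrightarrow> mean_list bs (\<lambda>x. T (u x)) = (\<lambda>x. T (mean_list bs u x))"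
proof (induction bs arbitrary: u)
  case (Cons b bs)
  have "mean b (\<lambda>x. T (u x)) = (\<lambda>x. T (mean b u x))"
    using Avg_clifford_op[OF Cons.prems(1,2), of "\<lambda>_. 1"] by auto
  then show ?case using Cons.IH[OF Cons.prems(1) smooth_form_Avg[OF Cons.prems(2)]] by simp
qed simp

lemma mean_list_add: "smooth_form u \<Longrightarrow> smooth_form w \<Longrightarrow> mean_list bs (\<lambda>x. u x + w x) = (\<lambda>x. mean_list bs u x + mean_list bs w x)"
proof (induction bs arbitrary: u w)
  case (Cons b bs)
  have "mean b (\<lambda>x. u x + w x) = (\<lambda>x. mean b u x + mean b w x)"
    using Avg_add[OF Cons.prems, of "\<lambda>_. 1"] by auto
  then show "mean_list (b # bs) (\<lambda>x. u x + w x) = (\<lambda>x. mean_list (b # bs) u x + mean_list (b # bs) w x)"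
    using Cons.IH[OF smooth_form_Avg[OF Cons.prems(1), of "\<lambda>_. 1" b] smooth_form_Avg[OF Cons.prems(2), of "\<lambda>_. 1" b]]
    by (simp only: mean_list.simps continuous_on_const)
qed simp

lemma closed_minus_mean_list:
  "admissible_list bs Z \<Longrightarrow> u \<in> inv_fields Z \<Longrightarrow> D u = 0 \<Longrightarrow> \<exists>w\<in>inv_fields Z. (\<lambda>x. u x - mean_list bs u x) = D w"
proof (induction bs arbitrary: u Z)
  case Nil
  have "D (\<lambda>x. 0) = (\<lambda>x. 0)"
    by (rule ext) (simp only: D_constant[OF alternating_zero] clifford_op_zero[OF op_d0])
  then show "\<exists>w\<in>inv_fields Z. (\<lambda>x. u x - mean_list [] u x) = D w"
    using inv_fields_const[OF alternating_zero] by (intro bexI[of _ "\<lambda>x. 0"]) auto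
next
  case (Cons b bs)
  then have g: "admissible b Z" and gs: "admissible_list bs (insert b Z)" by auto
  note A = mean_inv_fields[OF g Cons.prems(2)]
  have "D (mean b u) = 0" using D_Avg[OF g Cons.prems(2), of "\<lambda>_. 1"] Cons.prems(3) by (simp add: fun_eq_iff Avg_apply wavg_def)
  from Cons.IH[OF gs A this] obtain w2 where w2: "w2 \<in> inv_fields Z" "(\<lambda>x. mean b u x - mean_list bs (mean b u) x) = D w2"
    using inv_fields_mono[of Z "insert b Z"] by blast
  obtain w1 where w1: "w1 \<in> inv_fields Z" "(\<lambda>x. u x - mean b u x) = D w1"
    using closed_minus_mean[OF g Cons.prems(2,3)] by blast
  have "(\<lambda>x. u x - mean_list (b # bs) u x) = D (\<lambda>x. w1 x + w2 x)"
  proof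
    fix x
    have "D (\<lambda>x. w1 x + w2 x) x = (u x - mean b u x) + (mean b u x - mean_list bs (mean b u) x)"
      using fun_cong[OF w1(2), of x] fun_cong[OF w2(2), of x] by (simp only: D_add[OF inv_fields_smooth[OF w1(1)] inv_fields_smooth[OF w2(1)]])
    then show "u x - mean_list (b # bs) u x = D (\<lambda>x. w1 x + w2 x) x" by simp
  qed
  then show "\<exists>w\<in>inv_fields Z. (\<lambda>x. u x - mean_list (b # bs) u x) = D w" using inv_fields_add[OF w1(1) w2(1)] by blast
qed

text \<open>
  The central directions come first, as the others become admissible only after them.
\<close>

definition axes :: "V list" where "axes = [axis 3 1, axis 3 \<i>, axis 1 1, axis 1 \<i>, axis 2 1, axis 2 \<i>]"

lemma admissible_list_axes: "admissible_list axes {}"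
proof -
  have "central (axis 3 c)" for c by (auto simp: central_def intro!: V_eqI simp: cocycle_nth) (auto simp: axis_def)
  then show ?thesis by (simp add: axes_def admissible_def units central_dirs_def)
qed

lemma inv_fields_axes_constant: assumes "u \<in> inv_fields (set axes)" shows "u x = u 0"
proof -
  have s: "u (y + t *\<^sub>R b) = u y" if "b \<in> set axes" for y t b
    by (rule dir_zero_constant_along[OF inv_fields_smooth[OF assms] inv_fields_dir[OF assms that]])
  have "x = 0 + Re (x $ 3) *\<^sub>R axis 3 1 + Im (x $ 3) *\<^sub>R axis 3 \<i> + Re (x $ 1) *\<^sub>R axis 1 1 + Im (x $ 1) *\<^sub>R axis 1 \<i>
     + Re (x $ 2) *\<^sub>R axis 2 1 + Im (x $ 2) *\<^sub>R axis 2 \<i>"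
    by (rule V_eqI) (simp_all add: axis_def complex_eq_iff)
  moreover have "u \<dots> = u 0" by (simp only: s axes_def list.set insert_iff simp_thms)
  ultimately show ?thesis by simp
qed

definition harmonic :: "V form_field \<Rightarrow> V form_field" where
  "harmonic u = (\<lambda>x. hproj (mean_list axes u x))"

lemma mean_list_axes_constant: assumes "u \<in> inv_fields {}" obtains \<phi> where "alternating \<phi>" "mean_list axes u = (\<lambda>x. \<phi>)"
proof -
  have "mean_list axes u \<in> inv_fields (set axes)" using mean_list_inv_fields[OF admissible_list_axes assms] by simp
  then show ?thesis
    using that[of "mean_list axes u 0"] inv_fields_axes_constant inv_fields_smooth smooth_form_alternating by blast
qed

lemma harmonic_inv_fields: "u \<in> inv_fields {} \<Longrightarrow> harmonic u \<in> inv_fields {}"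
  and D_harmonic: "u \<in> inv_fields {} \<Longrightarrow> D (harmonic u) = 0"
proof -
  assume "u \<in> inv_fields {}"
  then obtain \<phi> where \<phi>: "alternating \<phi>" "mean_list axes u = (\<lambda>x. \<phi>)" by (rule mean_list_axes_constant)
  then have h: "harmonic u = (\<lambda>x. hproj \<phi>)" by (simp add: harmonic_def)
  have a: "alternating (hproj \<phi>)" by (rule clifford_op_alternating[OF op_hproj \<phi>(1)])
  show "harmonic u \<in> inv_fields {}" unfolding h by (rule inv_fields_const[OF a])
  show "D (harmonic u) = 0" unfolding h by (rule ext) (simp add: D_constant[OF a] d0_hproj[OF \<phi>(1)])
qed

lemma harmonic_D: "u \<in> inv_fields {} \<Longrightarrow> harmonic (D u) = 0"
proof -
  assume u: "u \<in> inv_fields {}"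
  then obtain \<phi> where \<phi>: "alternating \<phi>" "mean_list axes u = (\<lambda>x. \<phi>)" by (rule mean_list_axes_constant)
  have "mean_list axes (D u) = D (\<lambda>x. \<phi>)" using D_mean_list[OF admissible_list_axes u] \<phi>(2) by simp
  also have "\<dots> = (\<lambda>x. d0 \<phi>)" by (rule ext) (rule D_constant[OF \<phi>(1)])
  finally show "harmonic (D u) = 0" by (simp add: harmonic_def hproj_d0[OF \<phi>(1)] zero_fun_def)
qed

lemma harmonic_add: "smooth_form u \<Longrightarrow> smooth_form w \<Longrightarrow> harmonic (\<lambda>x. u x + w x) = (\<lambda>x. harmonic u x + harmonic w x)"
  unfolding harmonic_def by (subst mean_list_add) (simp_all only: clifford_op_additive[OF op_hproj])

lemma harmonic_clifford_op:
  assumes "clifford_op T" "u \<in> inv_fields {}" "\<And>\<phi>. alternating \<phi> \<Longrightarrow> T (hproj \<phi>) = hproj (T \<phi>)"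
  shows "harmonic (\<lambda>x. T (u x)) = (\<lambda>x. T (harmonic u x))"
proof -
  obtain \<phi> where \<phi>: "alternating \<phi>" "mean_list axes u = (\<lambda>x. \<phi>)" using assms(2) by (rule mean_list_axes_constant)
  show ?thesis unfolding harmonic_def mean_list_clifford_op[OF assms(1) inv_fields_smooth[OF assms(2)]] \<phi>(2) by (simp add: assms(3)[OF \<phi>(1)])
qed

lemma closed_minus_harmonic:
  assumes "u \<in> inv_fields {}" "D u = 0" shows "\<exists>w\<in>inv_fields {}. (\<lambda>x. u x - harmonic u x) = D w"
proof -
  obtain \<phi> where \<phi>: "alternating \<phi>" "mean_list axes u = (\<lambda>x. \<phi>)" using assms(1) by (rule mean_list_axes_constant)
  obtain w1 where w1: "w1 \<in> inv_fields {}" "(\<lambda>x. u x - mean_list axes u x) = D w1"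
    using closed_minus_mean_list[OF admissible_list_axes assms] by blast
  have "d0 \<phi> = 0"
  proof -
    have "(\<lambda>x. d0 \<phi>) = D (mean_list axes u)" unfolding \<phi>(2) by (rule ext) (rule D_constant[OF \<phi>(1), symmetric])
    also have "\<dots> = mean_list axes (\<lambda>x. 0)" unfolding D_mean_list[OF admissible_list_axes assms(1)] assms(2) by (simp add: zero_fun_def)
    also have "\<dots> = (\<lambda>x. 0)" using mean_list_clifford_op[OF clifford_op_null smooth_form_zero, of axes] by simp
    finally show ?thesis by metis
  qed
  note c = closed_minus_hproj[OF \<phi>(1) this]
  define \<psi> where "\<psi> = adjb \<phi> + adj (\<phi> - (delb0 (adjb \<phi>) + adjb (delb0 \<phi>)))"
  have \<psi>: "alternating \<psi>" unfolding \<psi>_def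
    by (intro alternating_add alternating_diff lap_alternating \<phi>(1))
  have "(\<lambda>x. u x - harmonic u x) = D (\<lambda>x. w1 x + \<psi>)"
  proof
    fix x
    have "D (\<lambda>x. w1 x + \<psi>) x = (u x - mean_list axes u x) + (\<phi> - hproj \<phi>)"
      using fun_cong[OF w1(2), of x]
      by (simp only: D_add[OF inv_fields_smooth[OF w1(1)] smooth_form_const[OF \<psi>]] D_constant[OF \<psi>] c[folded \<psi>_def])
    then show "u x - harmonic u x = D (\<lambda>x. w1 x + \<psi>) x" by (simp add: \<phi>(2) harmonic_def)
  qed
  then show ?thesis using inv_fields_add[OF w1(1) inv_fields_const[OF \<psi>]] by blast
qed

end


section \<open>From a harmonic projection to cohomology\<close>

text \<open>
  The cohomological conclusions, deduced from an operator \<open>H\<close> that kills exact forms, has closed values,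
  preserves the grading and is the identity on cohomology.
\<close>

locale harmonic_decomposition =
  fixes \<Delta> :: "('v::euclidean_space \<Rightarrow> 'v) set" and J :: "'v gendo"
    and P :: "int \<Rightarrow> 'v form_field \<Rightarrow> 'v form_field" and H :: "'v form_field \<Rightarrow> 'v form_field"
  assumes half_dim: "half_dim TYPE('v) = 3"
    and zero_forms: "0 \<in> forms \<Delta>"
    and add_forms: "\<omega> \<in> forms \<Delta> \<Longrightarrow> \<eta> \<in> forms \<Delta> \<Longrightarrow> \<omega> + \<eta> \<in> forms \<Delta>"
    and minus_forms: "\<omega> \<in> forms \<Delta> \<Longrightarrow> - \<omega> \<in> forms \<Delta>"
    and d_forms: "\<omega> \<in> forms \<Delta> \<Longrightarrow> ext_d \<omega> \<in> forms \<Delta>"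
    and d_add: "\<omega> \<in> forms \<Delta> \<Longrightarrow> \<eta> \<in> forms \<Delta> \<Longrightarrow> ext_d (\<omega> + \<eta>) = ext_d \<omega> + ext_d \<eta>"
    and d_d: "\<omega> \<in> forms \<Delta> \<Longrightarrow> ext_d (ext_d \<omega>) = 0"
    and component: "\<omega> \<in> forms \<Delta> \<Longrightarrow> (\<lambda>x. U_component (J x) k (\<omega> x)) = P k \<omega>"
    and P_forms: "\<omega> \<in> forms \<Delta> \<Longrightarrow> P k \<omega> \<in> forms \<Delta>"
    and P_add: "\<omega> \<in> forms \<Delta> \<Longrightarrow> \<eta> \<in> forms \<Delta> \<Longrightarrow> P k (\<omega> + \<eta>) = P k \<omega> + P k \<eta>"
    and P_sum: "\<omega> \<in> forms \<Delta> \<Longrightarrow> (\<Sum>k\<in>{-3..3}. P k \<omega>) = \<omega>"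
    and P_P: "\<omega> \<in> forms \<Delta> \<Longrightarrow> P k (P l \<omega>) = (if k = l then P k \<omega> else 0)"
    and P_outside: "\<omega> \<in> forms \<Delta> \<Longrightarrow> k \<notin> {-3..3} \<Longrightarrow> P k \<omega> = 0"
    and P_d_P: "\<omega> \<in> forms \<Delta> \<Longrightarrow> m \<noteq> k + 1 \<Longrightarrow> m \<noteq> k - 1 \<Longrightarrow> P m (ext_d (P k \<omega>)) = 0"
    and U_sections_eq: "U_sections \<Delta> J k = {\<omega> \<in> forms \<Delta>. P k \<omega> = \<omega>}"
    and H_forms: "\<omega> \<in> forms \<Delta> \<Longrightarrow> H \<omega> \<in> forms \<Delta>"
    and H_add: "\<omega> \<in> forms \<Delta> \<Longrightarrow> \<eta> \<in> forms \<Delta> \<Longrightarrow> H (\<omega> + \<eta>) = H \<omega> + H \<eta>"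
    and d_H: "\<omega> \<in> forms \<Delta> \<Longrightarrow> ext_d (H \<omega>) = 0"
    and H_d: "\<omega> \<in> forms \<Delta> \<Longrightarrow> H (ext_d \<omega>) = 0"
    and H_P: "\<omega> \<in> forms \<Delta> \<Longrightarrow> H (P k \<omega>) = P k (H \<omega>)"
    and H_cohomologous: "\<omega> \<in> forms \<Delta> \<Longrightarrow> ext_d \<omega> = 0 \<Longrightarrow> \<exists>\<eta>\<in>forms \<Delta>. \<omega> = H \<omega> + ext_d \<eta>"
begin

abbreviation "F \<equiv> forms \<Delta>"
abbreviation "cl \<equiv> dR_class \<Delta>"

lemma sum_forms: "(\<And>i. i \<in> I \<Longrightarrow> f i \<in> F) \<Longrightarrow> sum f I \<in> F"
  by (induction I rule: infinite_finite_induct) (simp_all only: sum.infinite sum.empty sum.insert zero_forms add_forms insert_iff simp_thms not_False_eq_True)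

lemma additive_zero:
  fixes T :: "'v form_field \<Rightarrow> 'v form_field"
  assumes "\<And>\<omega> \<eta>. \<omega> \<in> F \<Longrightarrow> \<eta> \<in> F \<Longrightarrow> T (\<omega> + \<eta>) = T \<omega> + T \<eta>" shows "T 0 = 0"
  using assms[OF zero_forms zero_forms] by (metis add_cancel_right_right add_0)

lemma additive_sum:
  fixes T :: "'v form_field \<Rightarrow> 'v form_field"
  assumes T: "\<And>\<omega> \<eta>. \<omega> \<in> F \<Longrightarrow> \<eta> \<in> F \<Longrightarrow> T (\<omega> + \<eta>) = T \<omega> + T \<eta>" and "\<And>i. i \<in> I \<Longrightarrow> f i \<in> F"
  shows "T (sum f I) = (\<Sum>i\<in>I. T (f i))"
  using assms(2)
proof (induction I rule: infinite_finite_induct)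
  case (insert i I)
  have "T (f i + sum f I) = T (f i) + T (sum f I)" by (rule T) (use insert.prems in \<open>auto intro: sum_forms\<close>)
  then show "T (sum f (insert i I)) = (\<Sum>i\<in>insert i I. T (f i))" using insert by (simp only: sum.insert insert_iff simp_thms)
qed (simp_all only: sum.infinite sum.empty additive_zero[OF T] not_False_eq_True)

lemma additive_minus:
  fixes T :: "'v form_field \<Rightarrow> 'v form_field"
  assumes T: "\<And>\<omega> \<eta>. \<omega> \<in> F \<Longrightarrow> \<eta> \<in> F \<Longrightarrow> T (\<omega> + \<eta>) = T \<omega> + T \<eta>" and "\<omega> \<in> F"
  shows "T (- \<omega>) = - T \<omega>"
  using T[OF assms(2) minus_forms[OF assms(2)]] additive_zero[OF T] by (metis add.right_inverse minus_unique)

lemma d_zero: "ext_d (0 :: 'v form_field) = 0"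
  by (rule additive_zero[of ext_d]) (rule d_add)

lemma P_zero: "P k 0 = 0"
  by (rule additive_zero[of "P k"]) (rule P_add)

lemma cl_add: "cl a + cl b = cl (a + b)"
proof (intro set_eqI iffI)
  fix w assume "w \<in> cl a + cl b"
  then obtain s t where "w = (a + ext_d s) + (b + ext_d t)" "s \<in> F" "t \<in> F"
    by (auto simp only: set_plus_def dR_class_def mem_Collect_eq)
  then have "w = (a + b) + ext_d (s + t)" "s + t \<in> F" by (simp_all only: d_add add_forms ac_simps)
  then show "w \<in> cl (a + b)" unfolding dR_class_def by blast
next
  fix w assume "w \<in> cl (a + b)"
  then obtain s where s: "w = (a + b) + ext_d s" "s \<in> F" unfolding dR_class_def by blast
  have "w = (a + ext_d s) + (b + ext_d 0)" by (simp only: s d_zero ac_simps add_0_right add_0)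
  moreover have "a + ext_d s \<in> cl a" "b + ext_d 0 \<in> cl b" using s(2) zero_forms unfolding dR_class_def by blast+
  ultimately show "w \<in> cl a + cl b" unfolding set_plus_def by blast
qed

lemma cl_eqI: assumes "\<eta> \<in> F" shows "cl (a + ext_d \<eta>) = cl a"
proof (intro set_eqI iffI)
  fix w assume "w \<in> cl (a + ext_d \<eta>)"
  then obtain s where s: "w = (a + ext_d \<eta>) + ext_d s" "s \<in> F" unfolding dR_class_def by blast
  then have "w = a + ext_d (\<eta> + s)" by (simp only: d_add assms ac_simps)
  then show "w \<in> cl a" using add_forms[OF assms s(2)] unfolding dR_class_def by blast
next
  fix w assume "w \<in> cl a"
  then obtain s where s: "w = a + ext_d s" "s \<in> F" unfolding dR_class_def by blast
  have "ext_d (- \<eta> + s) = - ext_d \<eta> + ext_d s"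
    by (simp only: d_add[OF minus_forms[OF assms] s(2)] additive_minus[of ext_d, OF d_add assms])
  then have "w = (a + ext_d \<eta>) + ext_d (- \<eta> + s)" by (simp add: s(1))
  then show "w \<in> cl (a + ext_d \<eta>)" using add_forms[OF minus_forms[OF assms] s(2)] unfolding dR_class_def by blast
qed

lemma self_mem_cl: "a \<in> cl a"
  unfolding dR_class_def using zero_forms d_zero by (metis (mono_tags, lifting) add_0_right mem_Collect_eq)

lemma cl_eqD: "cl a = cl b \<Longrightarrow> \<exists>\<eta>\<in>F. a = b + ext_d \<eta>"
  using self_mem_cl[of a] unfolding dR_class_def by blast

lemma cl_H: "\<omega> \<in> F \<Longrightarrow> ext_d \<omega> = 0 \<Longrightarrow> cl (H \<omega>) = cl \<omega>"
  using H_cohomologous[of \<omega>] cl_eqI by metis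

text \<open>
  Adding \<open>cl 0\<close> does not change a nonempty sum of classes and makes the empty sum the zero class.
\<close>

lemma cl_sum: "finite I \<Longrightarrow> cl 0 + (\<Sum>k\<in>I. cl (a k)) = cl (\<Sum>k\<in>I. a k)"
proof (induction I rule: finite_induct)
  case empty
  show "cl 0 + (\<Sum>k\<in>{}. cl (a k)) = cl (\<Sum>k\<in>{}. a k)" by (simp only: sum.empty add_0_right)
next
  case (insert i I)
  have "cl 0 + (cl (a i) + (\<Sum>k\<in>I. cl (a k))) = cl (a i) + (cl 0 + (\<Sum>k\<in>I. cl (a k)))" by (rule add.left_commute)
  also have "\<dots> = cl (a i + (\<Sum>k\<in>I. a k))" by (simp only: insert.IH cl_add)
  finally show "cl 0 + (\<Sum>k\<in>insert i I. cl (a k)) = cl (\<Sum>k\<in>insert i I. a k)" using insert by (simp only: sum.insert not_False_eq_True)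
qed

lemma cl_sum_support:
  "finite K \<Longrightarrow> cl 0 + (\<Sum>k\<in>K. f k) = cl 0 + (\<Sum>k\<in>{k \<in> K. f k \<noteq> cl 0}. f k)"
proof (induction K rule: finite_induct)
  case (insert i K)
  show ?case
  proof (cases "f i = cl 0")
    case True
    have "{k \<in> insert i K. f k \<noteq> cl 0} = {k \<in> K. f k \<noteq> cl 0}" using True by auto
    moreover have "cl 0 + (\<Sum>k\<in>insert i K. f k) = (cl 0 + cl 0) + (\<Sum>k\<in>K. f k)"
      using insert True by (simp only: sum.insert not_False_eq_True add.assoc)
    ultimately show ?thesis using insert.IH by (simp only: cl_add add_0)
  next
    case False
    have "{k \<in> insert i K. f k \<noteq> cl 0} = insert i {k \<in> K. f k \<noteq> cl 0}" using False by auto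
    then have "cl 0 + (\<Sum>k\<in>{k \<in> insert i K. f k \<noteq> cl 0}. f k) = f i + (cl 0 + (\<Sum>k\<in>{k \<in> K. f k \<noteq> cl 0}. f k))"
      using insert.hyps by (simp add: add.left_commute)
    moreover have "cl 0 + (\<Sum>k\<in>insert i K. f k) = f i + (cl 0 + (\<Sum>k\<in>K. f k))"
      using insert.hyps by (simp add: add.left_commute)
    ultimately show ?thesis using insert.IH by (simp only:)
  qed
qed simp

lemma GH_dR_iff: "c \<in> GH_dR \<Delta> \<longleftrightarrow> (\<exists>a\<in>F. ext_d a = 0 \<and> c = cl a)"
  unfolding GH_dR_def by blast

lemma GH_sub_iff: "c \<in> GH_sub \<Delta> J k \<longleftrightarrow> (\<exists>b\<in>F. ext_d b = 0 \<and> P k b = b \<and> c = cl b)"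
proof
  assume "c \<in> GH_sub \<Delta> J k"
  then obtain a b where a: "c = cl a" and b: "b \<in> c" "ext_d b = 0" "b \<in> F" "P k b = b"
    unfolding GH_sub_def GH_dR_def U_sections_eq by blast
  from b(1) a obtain \<eta> where "b = a + ext_d \<eta>" "\<eta> \<in> F" unfolding dR_class_def by blast
  then have "c = cl b" using a cl_eqI by simp
  then show "\<exists>b\<in>F. ext_d b = 0 \<and> P k b = b \<and> c = cl b" using b by blast
next
  assume "\<exists>b\<in>F. ext_d b = 0 \<and> P k b = b \<and> c = cl b"
  then show "c \<in> GH_sub \<Delta> J k"
    unfolding GH_sub_def GH_dR_def U_sections_eq using self_mem_cl by blast
qed

lemma P_H_closed: "\<omega> \<in> F \<Longrightarrow> ext_d (P k (H \<omega>)) = 0"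
  using d_H[OF P_forms, of \<omega> k] H_P[of \<omega> k] by simp

theorem pure_and_full: "pure_and_full \<Delta> J"
  unfolding pure_and_full_def
proof (intro ballI)
  fix c assume "c \<in> GH_dR \<Delta>"
  then obtain a where a: "a \<in> F" "ext_d a = 0" "c = cl a" unfolding GH_dR_iff by blast
  define f where "f k = cl (P k (H a))" for k
  note HF = H_forms[OF a(1)]
  have f0: "f k = cl 0" if "k \<notin> {-3..3}" for k using P_outside[OF HF that] by (simp only: f_def)
  have supp: "{k \<in> {-3..3}. f k \<noteq> cl 0} = {k. f k \<noteq> cl 0}" using f0 by blast
  have sub: "f k \<in> GH_sub \<Delta> J k" for k
    unfolding GH_sub_iff f_def using P_forms[OF HF, of k] P_H_closed[OF a(1), of k] P_P[OF HF, of k k] by auto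
  have fin: "finite {k. f k \<noteq> cl 0}"
    by (rule finite_subset[of _ "{-3..3}"]) (use f0 in blast, simp)
  have total: "c = cl 0 + (\<Sum>k | f k \<noteq> cl 0. f k)"
  proof -
    have "c = cl (\<Sum>k\<in>{-3..3}. P k (H a))" using a(3) cl_H[OF a(1,2)] P_sum[OF HF] by simp
    also have "\<dots> = cl 0 + (\<Sum>k\<in>{-3..3}. f k)" unfolding f_def by (rule cl_sum[symmetric]) simp
    also have "\<dots> = cl 0 + (\<Sum>k | f k \<noteq> cl 0. f k)" unfolding supp[symmetric] by (rule cl_sum_support) simp
    finally show ?thesis .
  qed
  show "\<exists>!f. (\<forall>k. f k \<in> GH_sub \<Delta> J k) \<and> finite {k. f k \<noteq> cl 0} \<and> c = cl 0 + (\<Sum>k | f k \<noteq> cl 0. f k)"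
  proof (rule ex1I[of _ f])
    show "(\<forall>k. f k \<in> GH_sub \<Delta> J k) \<and> finite {k. f k \<noteq> cl 0} \<and> c = cl 0 + (\<Sum>k | f k \<noteq> cl 0. f k)"
      using sub fin total by blast
  next
    fix g assume g: "(\<forall>k. g k \<in> GH_sub \<Delta> J k) \<and> finite {k. g k \<noteq> cl 0} \<and> c = cl 0 + (\<Sum>k | g k \<noteq> cl 0. g k)"
    then have "\<forall>k. \<exists>b\<in>F. ext_d b = 0 \<and> P k b = b \<and> g k = cl b" unfolding GH_sub_iff by blast
    then obtain b where b: "\<And>k. b k \<in> F" "\<And>k. ext_d (b k) = 0" "\<And>k. P k (b k) = b k" "\<And>k. g k = cl (b k)" by metis
    define I where "I = {k. g k \<noteq> cl 0}"
    have I: "finite I" using g by (simp only: I_def)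
    have "c = cl 0 + (\<Sum>k\<in>I. g k)" using g by (simp only: I_def)
    also have "\<dots> = cl (\<Sum>k\<in>I. b k)" unfolding b(4) by (rule cl_sum[OF I])
    finally obtain \<eta> where \<eta>: "\<eta> \<in> F" "a = (\<Sum>k\<in>I. b k) + ext_d \<eta>" using cl_eqD a(3) by metis
    have sF: "(\<Sum>k\<in>I. b k) \<in> F" by (rule sum_forms) (rule b(1))
    have "H a = H (\<Sum>k\<in>I. b k) + H (ext_d \<eta>)" unfolding \<eta>(2) by (rule H_add[OF sF d_forms[OF \<eta>(1)]])
    then have Ha: "H a = (\<Sum>k\<in>I. H (b k))"
      using additive_sum[of H I b, OF H_add b(1)] by (simp only: H_d[OF \<eta>(1)] add_0_right)
    have PH: "P k (H a) = (if k \<in> I then H (b k) else 0)" for k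
    proof -
      have "P k (H a) = (\<Sum>l\<in>I. P k (H (b l)))"
        unfolding Ha by (rule additive_sum[of "P k"]) (auto intro: H_forms b(1) P_add)
      also have "\<dots> = (\<Sum>l\<in>I. if l = k then H (b l) else 0)"
      proof (rule sum.cong)
        fix l
        have "P k (H (b l)) = P k (P l (H (b l)))" using b(3)[of l] H_P[OF b(1), of l l] by simp
        also have "\<dots> = (if k = l then P k (H (b l)) else 0)" by (rule P_P[OF H_forms[OF b(1)]])
        finally show "P k (H (b l)) = (if l = k then H (b l) else 0)"
          using H_P[OF b(1), of l l] b(3)[of l] by (metis)
      qed simp
      also have "\<dots> = (if k \<in> I then H (b k) else 0)" by (simp only: sum.delta[OF I])
      finally show ?thesis .
    qed
    show "g = f"
    proof
      fix k
      show "g k = f k"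
      proof (cases "k \<in> I")
        case True
        then show ?thesis using cl_H[OF b(1,2), of k] by (simp only: f_def PH if_True b(4))
      next
        case False
        then show ?thesis by (simp add: f_def PH I_def)
      qed
    qed
  qed
qed

lemma shift_eq:
  assumes "\<omega> \<in> F" shows "shift_d J r \<omega> = (\<Sum>k\<in>{-3..3}. P (k + r) (ext_d (P k \<omega>)))"
  unfolding shift_d_def half_dim
proof (rule sum.cong)
  fix k
  have "(\<lambda>y. U_component (J y) k (\<omega> y)) = P k \<omega>" by (rule component[OF assms])
  then show "(\<lambda>x. U_component (J x) (k + r) (ext_d (\<lambda>y. U_component (J y) k (\<omega> y)) x)) = P (k + r) (ext_d (P k \<omega>))"
    using component[OF d_forms[OF P_forms[OF assms]], of "k + r"] by simp
qed simp

lemma shift_forms: "\<omega> \<in> F \<Longrightarrow> shift_d J r \<omega> \<in> F"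
  by (simp only: shift_eq) (intro sum_forms P_forms d_forms; assumption)

lemma d_P_split:
  assumes "\<omega> \<in> F" shows "ext_d (P k \<omega>) = P (k + 1) (ext_d (P k \<omega>)) + P (k - 1) (ext_d (P k \<omega>))"
proof -
  let ?e = "ext_d (P k \<omega>)"
  have e: "?e \<in> F" by (intro d_forms P_forms assms)
  have "?e = (\<Sum>m\<in>{-3..3}. P m ?e)" using P_sum[OF e] by simp
  also have "\<dots> = (\<Sum>m\<in>{-3..3} \<union> {k + 1, k - 1}. P m ?e)"
    by (rule sum.mono_neutral_left) (use P_outside[OF e] in auto)
  also have "\<dots> = (\<Sum>m\<in>{k + 1, k - 1}. P m ?e)"
    by (rule sum.mono_neutral_right) (use P_d_P[OF assms] in auto)
  finally show ?thesis by simp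
qed

lemma d_split: assumes "\<omega> \<in> F" shows "ext_d \<omega> = del J \<omega> + delbar J \<omega>"
proof -
  have "ext_d \<omega> = ext_d (\<Sum>k\<in>{-3..3}. P k \<omega>)" by (simp only: P_sum[OF assms])
  also have "\<dots> = (\<Sum>k\<in>{-3..3}. ext_d (P k \<omega>))" by (rule additive_sum[of ext_d]) (auto intro: d_add P_forms assms)
  also have "\<dots> = (\<Sum>k\<in>{-3..3}. P (k + 1) (ext_d (P k \<omega>)) + P (k - 1) (ext_d (P k \<omega>)))"
    by (rule sum.cong[OF refl]) (rule d_P_split[OF assms])
  finally show ?thesis by (simp add: del_def delbar_def shift_eq[OF assms] sum.distrib)
qed

lemma P_delbar: assumes "\<omega> \<in> F" "l \<in> {-3..3}" shows "P l (delbar J \<omega>) = P l (ext_d (P (l + 1) \<omega>))"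
proof -
  have e: "ext_d (P k \<omega>) \<in> F" for k by (intro d_forms P_forms assms)
  have "P l (delbar J \<omega>) = (\<Sum>k\<in>{-3..3}. P l (P (k - 1) (ext_d (P k \<omega>))))"
    unfolding delbar_def shift_eq[OF assms(1)] using additive_sum[of "P l" "{-3..3}" "\<lambda>k. P (k + - 1) (ext_d (P k \<omega>))", OF P_add P_forms[OF e]] by simp
  also have "\<dots> = (\<Sum>k\<in>{-3..3}. if k = l + 1 then P l (ext_d (P (l + 1) \<omega>)) else 0)"
    by (rule sum.cong[OF refl]) (auto simp: P_P[OF e])
  also have "\<dots> = P l (ext_d (P (l + 1) \<omega>))"
  proof (cases "l + 1 \<in> {-3..3}")
    case False
    have "P (l + 1) \<omega> = 0" by (rule P_outside[OF assms(1) False])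
    then have "P l (ext_d (P (l + 1) \<omega>)) = 0" by (simp only: d_zero P_zero)
    then show ?thesis by (simp only: if_cancel sum.neutral_const)
  qed (simp add: sum.delta)
  finally show ?thesis .
qed

text \<open>
  The part of \<open>d d = 0\<close> of degree \<open>-2\<close>.
\<close>

lemma delbar_delbar: assumes "\<omega> \<in> F" shows "delbar J (delbar J \<omega>) = 0"
proof -
  have D: "delbar J \<omega> \<in> F" unfolding delbar_def by (rule shift_forms[OF assms])
  have "P (l + - 1) (ext_d (P l (delbar J \<omega>))) = 0" if l: "l \<in> {-3..3}" for l
  proof -
    let ?e = "ext_d (P (l + 1) \<omega>)"
    have e: "?e \<in> F" by (intro d_forms P_forms assms)
    have s: "?e = P (l + 2) ?e + P l ?e" using d_P_split[OF assms, of "l + 1"] by (simp add: add.assoc)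
    have "0 = P (l - 1) (ext_d ?e)" by (simp only: d_d[OF P_forms[OF assms]] P_zero)
    also have "ext_d ?e = ext_d (P (l + 2) ?e) + ext_d (P l ?e)"
      by (subst s) (rule d_add[OF P_forms[OF e] P_forms[OF e]])
    also have "P (l - 1) \<dots> = P (l - 1) (ext_d (P (l + 2) ?e)) + P (l - 1) (ext_d (P l ?e))"
      by (intro P_add d_forms P_forms e)
    also have "P (l - 1) (ext_d (P (l + 2) ?e)) = 0" by (rule P_d_P[OF e]) auto
    finally have "P (l - 1) (ext_d (P l ?e)) = 0" by (metis add_0)
    then show ?thesis unfolding P_delbar[OF assms l] by (simp only: add_uminus_conv_diff)
  qed
  moreover have "delbar J (delbar J \<omega>) = (\<Sum>l\<in>{-3..3}. P (l + - 1) (ext_d (P l (delbar J \<omega>))))"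
    using shift_eq[OF D, of "- 1"] by (simp only: delbar_def)
  ultimately show ?thesis by (simp only: sum.neutral_const cong: sum.cong)
qed

lemma BC_to_dR_class: assumes "a \<in> F" shows "BC_to_dR \<Delta> (BC_class \<Delta> J a) = cl a"
proof -
  have e: "cl (a + del J (delbar J b)) = cl a" if "b \<in> F" for b
  proof -
    have D: "delbar J b \<in> F" unfolding delbar_def by (rule shift_forms[OF that])
    have "del J (delbar J b) = ext_d (delbar J b)" using d_split[OF D] delbar_delbar[OF that] by simp
    then show ?thesis using cl_eqI[OF D] by simp
  qed
  have "BC_to_dR \<Delta> (BC_class \<Delta> J a) = (\<Union>b\<in>F. cl (a + del J (delbar J b)))"
    unfolding BC_to_dR_def BC_class_def by blast
  also have "\<dots> = (\<Union>b\<in>F. cl a)" by (rule SUP_cong[OF refl]) (rule e)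
  also have "\<dots> = cl a" using zero_forms by auto
  finally show ?thesis .
qed

theorem BC_surjective: "BC_to_dR \<Delta> ` GH_BC \<Delta> J = GH_dR \<Delta>"
proof (intro set_eqI iffI)
  fix c assume "c \<in> BC_to_dR \<Delta> ` GH_BC \<Delta> J"
  then obtain a where a: "a \<in> F" "del J a = 0" "delbar J a = 0" "c = BC_to_dR \<Delta> (BC_class \<Delta> J a)"
    unfolding GH_BC_def by blast
  then have "ext_d a = 0" using d_split[OF a(1)] by simp
  then show "c \<in> GH_dR \<Delta>" using a(1,4) BC_to_dR_class[OF a(1)] GH_dR_iff by blast
next
  fix c assume "c \<in> GH_dR \<Delta>"
  then obtain a where a: "a \<in> F" "ext_d a = 0" "c = cl a" unfolding GH_dR_iff by blast
  have "shift_d J r (H a) = 0" for r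
    unfolding shift_eq[OF H_forms[OF a(1)]] P_H_closed[OF a(1)] P_zero by simp
  then have "H a \<in> {a \<in> F. del J a = 0 \<and> delbar J a = 0}"
    using H_forms[OF a(1)] by (simp add: del_def delbar_def)
  moreover have "c = BC_to_dR \<Delta> (BC_class \<Delta> J (H a))"
    using BC_to_dR_class[OF H_forms[OF a(1)]] cl_H[OF a(1,2)] a(3) by simp
  ultimately show "c \<in> BC_to_dR \<Delta> ` GH_BC \<Delta> J" unfolding GH_BC_def by blast
qed

end


section \<open>Dual frames and change of base point\<close>

text \<open>
  The \<open>k\<close>-th coordinate functional of the basis \<open>\<epsilon>\<close> of the dual space is evaluation at a vector.
\<close>

lemma exists_dual_frame:
  fixes \<epsilon> :: "nat \<Rightarrow> ('v::euclidean_space \<Rightarrow>\<^sub>L real)"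
  assumes inj: "inj_on \<epsilon> {1..6}" and ind: "independent (\<epsilon> ` {1..6})" and sp: "span (\<epsilon> ` {1..6}) = UNIV"
  shows "\<exists>X. coframe \<epsilon> X"
proof -
  have "\<exists>c. linear c \<and> (\<forall>\<xi>\<in>\<epsilon> ` {1..6}. c \<xi> = (if \<xi> = \<epsilon> k then 1 else 0 :: real))" for k
    by (rule linear_independent_extend[OF ind])
  then obtain c where c: "\<And>k. linear (c k)" "\<And>k \<xi>. \<xi> \<in> \<epsilon> ` {1..6} \<Longrightarrow> c k \<xi> = (if \<xi> = \<epsilon> k then 1 else 0 :: real)" by metis
  define X where "X k = (\<Sum>b\<in>Basis. c k (blinfun_inner_left b) *\<^sub>R b)" for k
  have ev: "blinfun_apply \<xi> (X k) = c k \<xi>" for \<xi> k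
  proof -
    have "\<xi> = (\<Sum>b\<in>Basis. blinfun_apply \<xi> b *\<^sub>R blinfun_inner_left b)"
    proof (rule blinfun_eqI)
      fix v
      have "blinfun_apply \<xi> v = blinfun_apply \<xi> (\<Sum>b\<in>Basis. (v \<bullet> b) *\<^sub>R b)" by (simp only: euclidean_representation)
      then show "blinfun_apply \<xi> v = blinfun_apply (\<Sum>b\<in>Basis. blinfun_apply \<xi> b *\<^sub>R blinfun_inner_left b) v"
        by (simp add: blinfun.sum_right blinfun.scaleR_right blinfun.sum_left blinfun.scaleR_left inner_commute mult.commute)
    qed
    then have "c k \<xi> = c k (\<Sum>b\<in>Basis. blinfun_apply \<xi> b *\<^sub>R blinfun_inner_left b)" by (rule arg_cong)
    then show ?thesis
      by (simp add: X_def linear_sum[OF c(1)] linear_scale[OF c(1)] blinfun.sum_right blinfun.scaleR_right mult.commute)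
  qed
  have dual: "blinfun_apply (\<epsilon> i) (X j) = (if i = j then 1 else 0)" if "i \<in> {1..6}" "j \<in> {1..6}" for i j
    unfolding ev using c(2)[of "\<epsilon> i" j] inj_on_eq_iff[OF inj that] that by simp
  have "(\<Sum>k\<in>{1..6}. blinfun_apply (\<epsilon> k) v *\<^sub>R X k) = v" for v
  proof -
    define w where "w = v - (\<Sum>k\<in>{1..6}. blinfun_apply (\<epsilon> k) v *\<^sub>R X k)"
    have "blinfun_apply (\<epsilon> j) w = 0" if j: "j \<in> {1..6}" for j
    proof -
      have "(\<Sum>k\<in>{1..6}. blinfun_apply (\<epsilon> k) v * blinfun_apply (\<epsilon> j) (X k)) = (\<Sum>k\<in>{1..6}. if k = j then blinfun_apply (\<epsilon> k) v else 0)"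
        by (rule sum.cong) (auto simp: dual[OF j])
      then show ?thesis using j by (simp add: w_def blinfun.diff_right blinfun.sum_right blinfun.scaleR_right)
    qed
    then have "\<epsilon> ` {1..6} \<subseteq> {\<xi>. blinfun_apply \<xi> w = 0}" by auto
    moreover have "subspace {\<xi>. blinfun_apply \<xi> w = 0}"
      by (auto simp: subspace_def blinfun.add_left blinfun.scaleR_left)
    ultimately have "span (\<epsilon> ` {1..6}) \<subseteq> {\<xi>. blinfun_apply \<xi> w = 0}" by (rule span_minimal)
    then have "blinfun_apply (blinfun_inner_left w) w = 0" using sp by blast
    then show ?thesis by (simp add: w_def)
  qed
  then show ?thesis using dual by (intro exI[of _ X]) unfold_locales
qed

lemma pull_cliffordC:
  assumes "\<And>v. blinfun_apply \<xi>' v = blinfun_apply \<xi> (T v)" "\<And>v. blinfun_apply \<eta>' v = blinfun_apply \<eta> (T v)"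
  shows "pull T (cliffordC ((T p, \<xi>), (T q, \<eta>)) \<phi>) = cliffordC ((p, \<xi>'), (q, \<eta>')) (pull T \<phi>)"
  by (simp add: cliffordC_def clifford_def pull_add pull_cscale pull_contract pull_wedge
      pull_covector[OF assms(1)] pull_covector[OF assms(2)])

text \<open>
  A linear map that carries one coframe to another intertwines all operators built from them; it will be the
  differential of a left translation.
\<close>

locale coframe_map = A: coframe \<epsilon> X + B: coframe \<epsilon>' X' for \<epsilon> \<epsilon>' :: "nat \<Rightarrow> ('v::euclidean_space \<Rightarrow>\<^sub>L real)" and X X' +
  fixes T :: "'v \<Rightarrow> 'v"
  assumes linear: "linear T"
    and covectors: "\<And>k v. k \<in> {1..6} \<Longrightarrow> blinfun_apply (\<epsilon> k) v = blinfun_apply (\<epsilon>' k) (T v)"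
    and vectors: "\<And>k. k \<in> {1..6} \<Longrightarrow> X' k = T (X k)"
begin

lemma pull_W: "k \<in> {1..6} \<Longrightarrow> pull T (B.W k \<phi>) = A.W k (pull T \<phi>)"
proof -
  assume k: "k \<in> {1..6}"
  have "pull T (cliffordC ((T 0, \<epsilon>' i), (T 0, \<epsilon>' j)) \<phi>) = cliffordC ((0, \<epsilon> i), (0, \<epsilon> j)) (pull T \<phi>)"
    "pull T (cliffordC ((T 0, \<epsilon>' i), (T 0, - \<epsilon>' j)) \<phi>) = cliffordC ((0, \<epsilon> i), (0, - \<epsilon> j)) (pull T \<phi>)"
    if "i \<in> {1..6}" "j \<in> {1..6}" for i j
  proof -
    have m: "blinfun_apply (- \<epsilon> j) v = blinfun_apply (- \<epsilon>' j) (T v)" for v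
      by (simp only: blinfun.minus_left covectors[OF that(2)])
    show "pull T (cliffordC ((T 0, \<epsilon>' i), (T 0, \<epsilon>' j)) \<phi>) = cliffordC ((0, \<epsilon> i), (0, \<epsilon> j)) (pull T \<phi>)"
      by (rule pull_cliffordC[OF covectors[OF that(1)] covectors[OF that(2)]])
    show "pull T (cliffordC ((T 0, \<epsilon>' i), (T 0, - \<epsilon>' j)) \<phi>) = cliffordC ((0, \<epsilon> i), (0, - \<epsilon> j)) (pull T \<phi>)"
      by (rule pull_cliffordC[OF covectors[OF that(1)] m])
  qed
  note h = this
  show ?thesis
  proof (cases "k \<le> 3")
    case True
    have "2 * k - 1 \<in> {1..6}" "2 * k \<in> {1..6}" using k True by auto
    from h(1)[OF this] show ?thesis
      using True by (simp add: A.W_def B.W_def A.wedge_mode_def B.wedge_mode_def linear_0[OF linear])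
  next
    case False
    have "2 * k - 7 \<in> {1..6}" "2 * k - 6 \<in> {1..6}" using k False by auto
    from h(2)[OF this] show ?thesis
      using False by (simp add: A.W_def B.W_def A.wedge_mode_def B.wedge_mode_def linear_0[OF linear])
  qed
qed

lemma pull_C: "k \<in> {1..6} \<Longrightarrow> pull T (B.C k \<phi>) = A.C k (pull T \<phi>)"
proof -
  assume k: "k \<in> {1..6}"
  have "pull T (cliffordC ((T (r *\<^sub>R X i), 0), (T (s *\<^sub>R X j), 0)) \<phi>) = cliffordC ((r *\<^sub>R X i, 0), (s *\<^sub>R X j, 0)) (pull T \<phi>)" for i j r s
    by (rule pull_cliffordC) simp_all
  then have "pull T (cliffordC ((r *\<^sub>R X' i, 0), (s *\<^sub>R X' j, 0)) \<phi>) = cliffordC ((r *\<^sub>R X i, 0), (s *\<^sub>R X j, 0)) (pull T \<phi>)"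
    if "i \<in> {1..6}" "j \<in> {1..6}" for i j r s
    using that by (simp add: vectors linear_scale[OF linear])
  note h = this
  show ?thesis
  proof (cases "k \<le> 3")
    case True
    have "2 * k - 1 \<in> {1..6}" "2 * k \<in> {1..6}" using k True by auto
    from h[OF this, of "1/2" "- (1/2)"] show ?thesis
      using True by (simp only: A.C_def B.C_def A.contract_mode_def B.contract_mode_def if_True)
  next
    case False
    have "2 * k - 7 \<in> {1..6}" "2 * k - 6 \<in> {1..6}" using k False by auto
    from h[OF this, of "1/2" "1/2"] show ?thesis
      using False by (simp only: A.C_def B.C_def A.contract_mode_def B.contract_mode_def if_False)
  qed
qed

lemma pull_K: "pull T (B.K \<phi>) = A.K (pull T \<phi>)"
  by (simp add: A.K_def B.K_def pull_add pull_diff pull_cscale pull_W pull_C)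

lemma pull_proj: "pull T (B.proj k \<phi>) = A.proj k (pull T \<phi>)"
proof -
  have "pull T (B.lagrange k ls \<phi>) = A.lagrange k ls (pull T \<phi>)" for ls
    by (induction ls) (simp_all add: pull_cscale pull_diff pull_K)
  then show ?thesis unfolding A.proj_def B.proj_def .
qed

end

context coframe begin

lemma covector_wedge_unit: "covector \<xi> \<and>\<^sub>f unit_form = covector \<xi>"
  by (rule form_eqI) (simp_all add: covector_wedge_Nil contract_covector_wedge contract_covector contract_unit_form
     wedge_zero_right, simp add: covector_def)

text \<open>
  The exponent is nilpotent of order three, so the series has three terms.
\<close>

lemma symplectic_exp_wedge:
  "form_exp (cscale \<i> (- (covector (\<epsilon> 3) \<and>\<^sub>f covector (\<epsilon> 6)) - covector (\<epsilon> 4) \<and>\<^sub>f covector (\<epsilon> 5)))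
     \<and>\<^sub>f (covector (\<epsilon> 1) + cscale \<i> (covector (\<epsilon> 2))) = vacuum"
proof -
  let ?B = "cscale \<i> (- (covector (\<epsilon> 3) \<and>\<^sub>f covector (\<epsilon> 6)) - covector (\<epsilon> 4) \<and>\<^sub>f covector (\<epsilon> 5))"
  have B: "?B \<and>\<^sub>f \<phi> = two_form_op \<phi>" if "alternating \<phi>" for \<phi>
  proof -
    have "?B \<and>\<^sub>f \<phi> = cscale \<i> (- (covector (\<epsilon> 3) \<and>\<^sub>f (covector (\<epsilon> 6) \<and>\<^sub>f \<phi>)) - covector (\<epsilon> 4) \<and>\<^sub>f (covector (\<epsilon> 5) \<and>\<^sub>f \<phi>))"
      by (simp only: wedge_cscale_left diff_conv_add_uminus wedge_add_left wedge_minus_left covector_wedge_assoc)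
    also have "\<dots> = two_form_op \<phi>"
      unfolding two_form_op_def
      unfolding real_modes(9,11,12)[OF that] 
      by (subst real_modes, (intro alternating_cscale alternating_add alternating_diff mode_alternating that)[1])+
         (simp add: mode_linear normal_order that, simp add: fun_eq_iff cscale_apply field_simps)
    finally show ?thesis .
  qed
  have alt2: "alternating (two_form_op \<phi>)" if "alternating \<phi>" for \<phi>
    unfolding two_form_op_def by (intro alternating_diff alternating_cscale mode_alternating that)
  have nil: "two_form_op (two_form_op (two_form_op unit_form)) = 0"
  proof -
    have "two_form_op (two_form_op unit_form) = cscale (- 1/2) (W 2 (W 3 (W 5 (W 6 unit_form))))"
      unfolding two_form_op_def
      by (simp add: normal_order alternating_unit_form del: mult_2) (simp add: fun_eq_iff cscale_apply algebra_simps)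
    then show ?thesis unfolding two_form_op_def by (simp add: normal_order alternating_unit_form)
  qed
  let ?p = "\<lambda>k. ((\<lambda>\<psi>. ?B \<and>\<^sub>f \<psi>) ^^ k) unit_form"
  note u = alternating_unit_form
  have p: "?p 0 = unit_form" "?p 1 = two_form_op unit_form" "?p 2 = two_form_op (two_form_op unit_form)"
    by (simp_all add: B u alt2 numeral_2_eq_2)
  have p3: "?p (k + 3) = 0" for k
  proof (induction k)
    case 0
    have "?p (Suc (Suc (Suc 0))) = 0" by (simp add: B u alt2 nil)
    moreover have "0 + 3 = Suc (Suc (Suc 0))" by simp
    ultimately show "?p (0 + 3) = 0" by (simp only:)
  next
    case (Suc k)
    have ih: "?p (k + 3) = 0" by (rule Suc.IH)
    show "?p (Suc k + 3) = 0" by (simp only: add_Suc funpow.simps o_apply ih wedge_zero_right)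
  qed
  have "form_exp ?B = unit_form + two_form_op unit_form + cscale (1/2) (two_form_op (two_form_op unit_form))"
  proof
    fix vs
    have z: "?p k vs / fact k = 0" if "k \<notin> {..<3}" for k
      using p3[of "k - 3"] that by simp
    have "form_exp ?B vs = (\<Sum>k<3. ?p k vs / fact k)"
      unfolding form_exp_def by (rule suminf_finite) (use z in auto)
    also have "\<dots> = ?p 0 vs / fact 0 + ?p 1 vs / fact 1 + ?p 2 vs / fact 2"
      by (simp only: lessThan_Suc eval_nat_numeral sum.insert) (simp add: eval_nat_numeral del: funpow.simps)
    also have "\<dots> = (unit_form + two_form_op unit_form + cscale (1/2) (two_form_op (two_form_op unit_form))) vs"
      unfolding p by (simp add: cscale_apply)
    finally show "form_exp ?B vs = (unit_form + two_form_op unit_form + cscale (1/2) (two_form_op (two_form_op unit_form))) vs" .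
  qed
  moreover have "two_form_op unit_form \<and>\<^sub>f \<psi> = two_form_op \<psi>" "two_form_op (two_form_op unit_form) \<and>\<^sub>f \<psi> = two_form_op (two_form_op \<psi>)"
    if "alternating \<psi>" for \<psi>
  proof -
    have 2: "?B \<and>\<^sub>f \<phi> \<and>\<^sub>f \<psi> = (?B \<and>\<^sub>f \<phi>) \<and>\<^sub>f \<psi>" for \<phi> :: "'v form"
      by (simp only: wedge_cscale_left diff_conv_add_uminus wedge_add_left wedge_minus_left covector_wedge_assoc)
    show 3: "two_form_op unit_form \<and>\<^sub>f \<psi> = two_form_op \<psi>"
      using 2[of unit_form] by (simp add: B u that unit_form_wedge)
    show "two_form_op (two_form_op unit_form) \<and>\<^sub>f \<psi> = two_form_op (two_form_op \<psi>)"
      using 2[of "two_form_op unit_form"] by (simp add: B u alt2 that 3)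
  qed
  moreover have "covector (\<epsilon> 1) + cscale \<i> (covector (\<epsilon> 2)) = W 1 unit_form"
  proof -
    have "covector (\<epsilon> 1) + cscale \<i> (covector (\<epsilon> 2)) = covector (\<epsilon> (Suc 0)) \<and>\<^sub>f unit_form + cscale \<i> (covector (\<epsilon> 2) \<and>\<^sub>f unit_form)"
      by (simp add: covector_wedge_unit)
    also have "\<dots> = W 1 unit_form"
      unfolding real_modes[OF u] by (simp add: fun_eq_iff cscale_apply field_simps)
    finally show ?thesis .
  qed
  ultimately show ?thesis
    using clifford_op_alternating[OF op_W u, of 1]
    by (simp only: vacuum_def Let_def wedge_add_left wedge_cscale_left unit_form_wedge)
qed

end

context vacuum_structure begin

lemma proj_eig_self: "\<phi> \<in> eig k \<Longrightarrow> proj k \<phi> = \<phi>"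
  using lagrange_eig[of \<phi> k k "[-3..3]"] by (auto simp: proj_def)

lemma proj_eig_other: assumes "\<phi> \<in> eig l" "l \<noteq> m" shows "proj m \<phi> = 0"
proof (cases "l \<in> {-3..3}")
  case True then show ?thesis using proj_eig[OF assms(1) True, of m] assms(2) by simp
next
  case False
  then have "\<phi> = 0" using U_outside U_eq_eig assms(1) by blast
  then show ?thesis by (simp add: clifford_op_zero[OF op_proj])
qed

lemma proj_mem_eig: "alternating \<phi> \<Longrightarrow> proj k \<phi> \<in> eig k"
  using proj_mem_U U_eq_eig by blast

lemma proj_proj: "alternating \<phi> \<Longrightarrow> proj k (proj l \<phi>) = (if k = l then proj k \<phi> else 0)"
  using proj_eig_self[OF proj_mem_eig] proj_eig_other[OF proj_mem_eig] by auto

lemma hproj_proj: assumes "alternating \<phi>" shows "proj k (hproj \<phi>) = hproj (proj k \<phi>)"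
proof -
  have "hproj \<phi> = hproj (\<Sum>l\<in>{-3..3}. proj l \<phi>)" by (simp only: sum_proj[OF assms])
  also have "\<dots> = (\<Sum>l\<in>{-3..3}. hproj (proj l \<phi>))" by (rule clifford_op_sum[OF op_hproj])
  finally have "proj k (hproj \<phi>) = (if k \<in> {-3..3} then hproj (proj k \<phi>) else 0)"
    using proj_U_sum[of "\<lambda>l. hproj (proj l \<phi>)" "{-3..3}" k] eig_hproj[OF proj_mem_eig[OF assms]] U_eq_eig by simp
  then show ?thesis using proj_outside[OF assms, of k] clifford_op_zero[OF op_hproj] by auto
qed

lemma proj_wedge_zero:
  assumes "\<phi> \<in> eig k" "m \<noteq> k + 1" "m \<noteq> k - 1" "i \<in> {1..6}"
  shows "proj m (covector (\<epsilon> i) \<and>\<^sub>f \<phi>) = 0"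
proof -
  have W: "proj m (W l \<phi>) = 0" if l: "l \<in> {1..6}" for l
  proof -
    obtain a b s t where ab: "a \<in> {1..6}" "b \<in> {1..6}" "W l \<phi> = cscale s (up a \<phi>) + cscale t (down b \<phi>)"
      using mode_split(1)[OF l] by blast
    show ?thesis
      unfolding ab(3) clifford_op_additive[OF op_proj] clifford_op_homogeneous[OF op_proj]
      using proj_eig_other[OF eig_up[OF ab(1) assms(1)], of m] proj_eig_other[OF eig_down[OF ab(2) assms(1)], of m] assms by simp
  qed
  have "i = 1 \<or> i = 2 \<or> i = 3 \<or> i = 4 \<or> i = 5 \<or> i = 6" using assms(4) by auto
  then show ?thesis
    by (elim disjE; simp only: One_nat_def real_modes[OF eig_alternating[OF assms(1)]];
        simp add: clifford_op_homogeneous[OF op_proj] clifford_op_additive[OF op_proj] clifford_op_diff[OF op_proj] clifford_op_minus[OF op_proj] W W[of 1, simplified])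
qed

lemma proj_d0_zero:
  assumes "\<phi> \<in> eig k" "m \<noteq> k + 1" "m \<noteq> k - 1" shows "proj m (d0 \<phi>) = 0"
  unfolding d0_def clifford_op_additive[OF op_proj]
  using proj_eig_other[OF eig_del0[OF assms(1)], of m] proj_eig_other[OF eig_delb0[OF assms(1)], of m] assms by simp

end


section \<open>The Iwasawa manifold\<close>

definition deck_points :: "V set" where "deck_points = {g. heis g \<in> GL3_Gauss}"

lemma unit_mem_deck_points: assumes "c \<in> {1, \<i>}" shows "axis i c \<in> deck_points"
proof -
  have c: "c \<in> Gauss_ints" "- c \<in> Gauss_ints" "0 \<in> Gauss_ints" "1 \<in> Gauss_ints"
    using assms by (auto simp: Gauss_ints_def)
  have ax: "axis i a $ k \<in> Gauss_ints" if "a \<in> Gauss_ints" for a :: complex and k :: 3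
    using that c(3) by (simp add: axis_def)
  have ent: "heis (axis i a) $ p $ q \<in> Gauss_ints" if "a \<in> Gauss_ints" for a p q
    using exhaust_3[of p] exhaust_3[of q] ax[OF that] c by (auto simp: heis_def)
  have mul: "heis (axis i a) ** heis (axis i (- a)) = mat 1" for a
    using exhaust_3[of i] by (auto simp: vec_eq_iff forall_3 matrix_matrix_mult_def sum_3 heis_def mat_def axis_def)
  show ?thesis
    unfolding deck_points_def GL3_Gauss_def mem_Collect_eq
    using ent[OF c(1)] ent[OF c(2)] mul[of c] mul[of "- c"] by (intro conjI exI[of _ "heis (axis i (- c))"]) auto
qed

lemma left_translation_zero: "left_translation x 0 = x"
  by (rule V_eqI) (simp_all add: left_translation_eq M_def cocycle_nth)

lemma pullback_left_translation: "hat (pullback (left_translation g) \<omega>) x = hat \<omega> (left_translation g x)"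
proof -
  have "M (left_translation g x) = (\<lambda>v. M g (M x v))" by (rule ext) (rule M_left_translation)
  then show ?thesis by (simp add: hat_def pull_def pullback_def frechet_left_translation o_def)
qed

lemma forms_iff_hat:
  "\<omega> \<in> forms (left_translation ` G) \<longleftrightarrow> smooth_form (hat \<omega>) \<and> (\<forall>g\<in>G. \<forall>x. hat \<omega> (left_translation g x) = hat \<omega> x)"
proof -
  have "smooth_form \<omega> \<longleftrightarrow> smooth_form (hat \<omega>)"
    using smooth_form_hat[of \<omega>] smooth_form_unhat[of "hat \<omega>"] by (auto simp: unhat_hat)
  moreover have "pullback F \<omega> = \<omega> \<longleftrightarrow> hat (pullback F \<omega>) = hat \<omega>" for F
    by (metis unhat_hat)
  ultimately show ?thesis
    by (auto simp: forms_def pullback_left_translation fun_eq_iff)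
qed

lemma half_dim_V: "half_dim TYPE(V) = 3"
  by (simp add: half_dim_def)

text \<open>
  The canonical bundle determines the spaces \<open>U\<^sup>k\<close>, hence all notions derived from \<open>J\<close>.
\<close>

locale iwasawa_structure =
  fixes e :: "nat \<Rightarrow> V \<Rightarrow> (V \<Rightarrow>\<^sub>L real)" and \<rho> :: "V form_field" and J :: "V gendo"
  assumes coframe: "left_invariant_coframe e"
    and closed: "\<And>k. k \<in> {1, 2, 3, 4} \<Longrightarrow> ext_d (\<lambda>x. covector (e k x)) = 0"
    and d5: "ext_d (\<lambda>x. covector (e 5 x)) = (\<lambda>x. covector (e 1 x) \<and>\<^sub>f covector (e 3 x) - covector (e 2 x) \<and>\<^sub>f covector (e 4 x))"
    and d6: "ext_d (\<lambda>x. covector (e 6 x)) = (\<lambda>x. covector (e 1 x) \<and>\<^sub>f covector (e 4 x) + covector (e 2 x) \<and>\<^sub>f covector (e 3 x))"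
    and \<rho>: "\<And>x. \<rho> x =
      form_exp (cscale \<i> (- (covector (e 3 x) \<and>\<^sub>f covector (e 6 x)) - covector (e 4 x) \<and>\<^sub>f covector (e 5 x)))
        \<and>\<^sub>f (covector (e 1 x) + cscale \<i> (covector (e 2 x)))"
    and canonical: "canonical_bundle_generated_by J \<rho>"
begin

definition "\<epsilon> k = e k 0"
definition "X = (SOME X. coframe \<epsilon> X)"

lemma coframe_0: "coframe \<epsilon> X"
proof -
  have "inj_on (\<lambda>k. e k 0) {1..6} \<and> independent ((\<lambda>k. e k 0) ` {1..6}) \<and> span ((\<lambda>k. e k 0) ` {1..6}) = UNIV"
    using coframe unfolding left_invariant_coframe_def by blast
  then have "\<exists>X. coframe \<epsilon> X" unfolding \<epsilon>_def[abs_def] by (intro exists_dual_frame) auto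
  then show ?thesis unfolding X_def by (rule someI_ex)
qed

lemma e_invariant: assumes "k \<in> {1..6}" shows "blinfun_apply (e k x) (M x v) = blinfun_apply (\<epsilon> k) v"
proof -
  have "(\<lambda>x. covector (e k x)) \<in> forms (range left_translation)"
    using coframe assms unfolding left_invariant_coframe_def by blast
  then have "pullback (left_translation x) (\<lambda>x. covector (e k x)) = (\<lambda>x. covector (e k x))"
    unfolding forms_def by blast
  then have "pullback (left_translation x) (\<lambda>x. covector (e k x)) 0 [v] = covector (e k 0) [v]" by (rule arg_cong)
  then show ?thesis by (simp add: pullback_def covector_def frechet_left_translation left_translation_zero \<epsilon>_def)
qed

lemma e_eq: "k \<in> {1..6} \<Longrightarrow> blinfun_apply (e k x) v = blinfun_apply (\<epsilon> k) (M (- x) v)"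
  using e_invariant[of k x "M (- x) v"] by (simp add: M_cancel)

lemma coframe_at: "coframe (\<lambda>k. e k x) (\<lambda>k. M x (X k))"
proof -
  interpret A: coframe \<epsilon> X by (rule coframe_0)
  show ?thesis
  proof
    fix i j :: nat assume "i \<in> {1..6}" "j \<in> {1..6}"
    then show "blinfun_apply (e i x) (M x (X j)) = (if i = j then 1 else 0)" by (simp only: e_invariant A.dual)
  next
    fix v
    have "(\<Sum>k\<in>{1..6}. blinfun_apply (e k x) v *\<^sub>R M x (X k)) = (\<Sum>k\<in>{1..6}. M x (blinfun_apply (\<epsilon> k) (M (- x) v) *\<^sub>R X k))"
      by (rule sum.cong) (simp_all only: e_eq linear_scale[OF linear_M])
    also have "\<dots> = M x (\<Sum>k\<in>{1..6}. blinfun_apply (\<epsilon> k) (M (- x) v) *\<^sub>R X k)"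
      by (rule linear_sum[OF linear_M, symmetric])
    finally show "(\<Sum>k\<in>{1..6}. blinfun_apply (e k x) v *\<^sub>R M x (X k)) = v" by (simp only: A.expand M_cancel)
  qed
qed

sublocale heisenberg_coframe \<epsilon> X
  by (simp add: heisenberg_coframe_def coframe_0)

lemma unhat_covector: "k \<in> {1..6} \<Longrightarrow> unhat (\<lambda>x. covector (\<epsilon> k)) = (\<lambda>x. covector (e k x))"
  unfolding unhat_def by (intro ext) (simp add: pull_covector[OF e_eq])

lemma pull_covector_e: "k \<in> {1..6} \<Longrightarrow> pull (M x) (covector (e k x)) = covector (\<epsilon> k)"
  by (rule pull_covector) (simp add: e_invariant)

sublocale iwasawa_coframe \<epsilon> X
proof
  fix l :: nat assume l: "l \<in> {1..6}"
  have alt: "alternating (covector (\<epsilon> l))"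
    using alternating_covector_wedge[OF alternating_unit_form, of "\<epsilon> l"] by (simp only: covector_wedge_unit)
  have "alg_d (covector (\<epsilon> l)) = D (\<lambda>x. covector (\<epsilon> l)) 0" by (rule D_const[OF alt, symmetric])
  also have "\<dots> = pull (M 0) (ext_d (\<lambda>x. covector (e l x)) 0)"
    by (simp only: D_def hat_def unhat_covector[OF l])
  also have "\<dots> = quad (iwasawa_table l) unit_form"
  proof -
    have "l \<in> {1, 2, 3, 4} \<or> l = 5 \<or> l = 6" using l by auto
    then show ?thesis
    proof (elim disjE)
      assume "l \<in> {1, 2, 3, 4}"
      then show ?thesis using closed[of l] by (auto simp: quad_def pull_zero)
    next
      assume l: "l = 5"
      have "pull (M 0) (ext_d (\<lambda>x. covector (e 5 x)) 0) = covector (\<epsilon> 1) \<and>\<^sub>f covector (\<epsilon> 3) - covector (\<epsilon> 2) \<and>\<^sub>f covector (\<epsilon> 4)"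
        unfolding d5 by (simp add: pull_diff pull_wedge pull_covector_e)
      also have "\<dots> = quad (iwasawa_table 5) unit_form"
        unfolding quad_def atLeastAtMost_1_6 by (simp add: covector_wedge_unit)
      finally show ?thesis by (simp only: l)
    next
      assume l: "l = 6"
      have "pull (M 0) (ext_d (\<lambda>x. covector (e 6 x)) 0) = covector (\<epsilon> 1) \<and>\<^sub>f covector (\<epsilon> 4) + covector (\<epsilon> 2) \<and>\<^sub>f covector (\<epsilon> 3)"
        unfolding d6 by (simp add: pull_add pull_wedge pull_covector_e)
      also have "\<dots> = quad (iwasawa_table 6) unit_form"
        unfolding quad_def atLeastAtMost_1_6 by (simp add: covector_wedge_unit)
      finally show ?thesis by (simp only: l)
    qed
  qed
  finally show "alg_d (covector (\<epsilon> l)) = quad (iwasawa_table l) unit_form" .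
qed

sublocale iwasawa_lattice \<epsilon> X deck_points
  by unfold_locales (rule unit_mem_deck_points)

lemma vacuum_structure_at: "vacuum_structure (\<lambda>k. e k x) (\<lambda>k. M x (X k)) (J x)"
proof -
  interpret B: coframe "\<lambda>k. e k x" "\<lambda>k. M x (X k)" by (rule coframe_at)
  have r: "\<rho> x = B.vacuum" unfolding \<rho> by (rule B.symplectic_exp_wedge)
  show ?thesis
    using canonical unfolding canonical_bundle_generated_by_def
    by unfold_locales (auto simp: half_dim_V r[symmetric])
qed

lemma M_zero_eq: "(\<lambda>k. M 0 (X k)) = X" by (simp add: M_zero)

sublocale vacuum_structure \<epsilon> X "J 0"
  using vacuum_structure_at[of 0] unfolding M_zero_eq \<epsilon>_def[symmetric] by (simp add: \<epsilon>_def[abs_def])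

lemma coframe_map_at: "coframe_map \<epsilon> (\<lambda>k. e k x) X (\<lambda>k. M x (X k)) (M x)"
  unfolding coframe_map_def coframe_map_axioms_def
  using coframe_0 coframe_at linear_M e_invariant by simp

definition "P k \<omega> = unhat (\<lambda>x. proj k (hat \<omega> x))"
definition "H \<omega> = unhat (harmonic (hat \<omega>))"

lemma Iwasawa_deck_eq: "Iwasawa_deck = left_translation ` deck_points"
  by (simp add: Iwasawa_deck_def deck_points_def)

lemma mem_forms: "\<omega> \<in> forms Iwasawa_deck \<longleftrightarrow> hat \<omega> \<in> inv_fields {}"
  by (simp add: Iwasawa_deck_eq forms_iff_hat inv_fields_def)

lemma hat_eqI: "hat \<omega> = hat \<eta> \<Longrightarrow> \<omega> = \<eta>"
  by (metis unhat_hat)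

lemma hat_d: "hat (ext_d \<omega>) = D (hat \<omega>)" by (simp add: D_def unhat_hat)
lemma hat_P: "hat (P k \<omega>) = (\<lambda>x. proj k (hat \<omega> x))" by (simp add: P_def hat_unhat)
lemma hat_H: "hat (H \<omega>) = harmonic (hat \<omega>)" by (simp add: H_def hat_unhat)
lemma hat_add: "hat (\<omega> + \<eta>) = (\<lambda>x. hat \<omega> x + hat \<eta> x)" by (simp add: hat_def pull_add)
lemma hat_minus: "hat (- \<omega>) = (\<lambda>x. - hat \<omega> x)" by (simp add: hat_def pull_def fun_eq_iff)
lemma hat_sum: "hat (sum f I) = (\<lambda>x. \<Sum>i\<in>I. hat (f i) x)" by (simp add: hat_def sum_fun_apply pull_sum)
lemma hat_zero': "hat 0 = (\<lambda>x. 0)" using hat_zero by (simp only: zero_fun_def)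

lemma hat_alternating: "\<omega> \<in> forms Iwasawa_deck \<Longrightarrow> alternating (hat \<omega> x)"
  and forms_alternating: "\<omega> \<in> forms Iwasawa_deck \<Longrightarrow> alternating (\<omega> x)"
  using inv_fields_smooth smooth_form_alternating by (auto simp: mem_forms) (simp add: forms_def mem_forms[symmetric] smooth_form_alternating)

lemma proj_at:
  assumes "\<omega> \<in> forms Iwasawa_deck"
  shows "U_component (J x) k (\<omega> x) = P k \<omega> x"
    and "\<omega> x \<in> U_space (J x) k \<longleftrightarrow> P k \<omega> x = \<omega> x"
proof -
  interpret B: vacuum_structure "\<lambda>k. e k x" "\<lambda>k. M x (X k)" "J x" by (rule vacuum_structure_at)
  interpret m: coframe_map \<epsilon> "\<lambda>k. e k x" X "\<lambda>k. M x (X k)" "M x" by (rule coframe_map_at)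
  note alt = forms_alternating[OF assms, of x]
  have "P k \<omega> x = pull (M (- x)) (proj k (pull (M x) (\<omega> x)))" by (simp add: P_def unhat_def hat_def)
  also have "\<dots> = B.proj k (\<omega> x)"
    by (simp only: m.pull_proj[symmetric] pull_pull M_cancel pull_id)
  finally have p: "P k \<omega> x = B.proj k (\<omega> x)" .
  show "U_component (J x) k (\<omega> x) = P k \<omega> x" by (simp add: B.U_component_eq_proj[OF alt] p)
  show "\<omega> x \<in> U_space (J x) k \<longleftrightarrow> P k \<omega> x = \<omega> x"
    unfolding p using B.proj_eig_self B.U_eq_eig B.proj_mem_U[OF alt, of k] by metis
qed

lemma D_inv_fields: assumes "u \<in> inv_fields {}" shows "D u \<in> inv_fields {}"
proof -
  note s = inv_fields_smooth[OF assms]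
  have "D u (left_translation g x) = D u x" if g: "g \<in> deck_points" for g x
  proof -
    have "dir (M (left_translation g x) v) u (left_translation g x) = dir (M x v) u x" for v
    proof
      fix vs
      let ?f = "\<lambda>y. u y vs"
      have "(?f \<circ> left_translation g has_derivative frechet_derivative ?f (at (left_translation g x)) \<circ> M g) (at x)"
        by (rule diff_chain_at[OF left_translation_has_derivative smooth_has_derivative[OF smooth_form_coeff[OF s]]])
      moreover have "?f \<circ> left_translation g = ?f" using inv_fields_invariant[OF assms g] by (simp add: fun_eq_iff)
      ultimately have "frechet_derivative ?f (at x) = frechet_derivative ?f (at (left_translation g x)) \<circ> M g"
        using frechet_derivative_eqI by metis
      then show "dir (M (left_translation g x) v) u (left_translation g x) vs = dir (M x v) u x vs"
        by (simp add: dir_apply M_left_translation)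
    qed
    then show ?thesis by (simp only: D_eq_d0[OF s] inv_fields_invariant[OF assms g])
  qed
  then show ?thesis by (simp add: inv_fields_def smooth_form_D[OF s])
qed

text \<open>
  The differential of a field in \<open>U\<^sup>k\<close> has components in \<open>U\<^sup>k\<^sup>+\<^sup>1\<close> and \<open>U\<^sup>k\<^sup>-\<^sup>1\<close> only: derivatives of
  coefficients preserve the degree, and exterior multiplication and \<open>d0\<close> change it by one.
\<close>

lemma proj_D_proj:
  assumes "u \<in> inv_fields {}" "m \<noteq> k + 1" "m \<noteq> k - 1" shows "proj m (D (\<lambda>x. proj k (u x)) x) = 0"
proof -
  note s = inv_fields_smooth[OF assms(1)]
  have e: "proj k \<phi> \<in> eig k" if "alternating \<phi>" for \<phi> by (rule proj_mem_eig[OF that])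
  have "proj m (covector (\<epsilon> i) \<and>\<^sub>f dir v (\<lambda>x. proj k (u x)) x) = 0" if "i \<in> {1..6}" for i v
    unfolding dir_clifford_op[OF op_proj s]
    by (rule proj_wedge_zero[OF e assms(2,3) that]) (rule smooth_form_alternating[OF smooth_form_dir[OF s]])
  then have "(\<Sum>i\<in>{1..6}. proj m (covector (\<epsilon> i) \<and>\<^sub>f dir (M x (X i)) (\<lambda>x. proj k (u x)) x)) = 0" by (intro sum.neutral) blast
  moreover have "proj m (d0 (proj k (u x))) = 0"
    by (rule proj_d0_zero[OF e assms(2,3)]) (rule smooth_form_alternating[OF s])
  ultimately show ?thesis
    by (simp only: D_eq_d0[OF smooth_form_clifford_op[OF op_proj s]] clifford_op_additive[OF op_proj] clifford_op_sum[OF op_proj] add_0)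
qed

sublocale harmonic_decomposition Iwasawa_deck J P H
proof
  fix \<omega> \<eta> :: "V form_field" and k l m :: int
  show "half_dim TYPE(V) = 3" by (rule half_dim_V)
  show "0 \<in> forms Iwasawa_deck" unfolding mem_forms hat_zero' by (rule inv_fields_const[OF alternating_zero])
  show "U_sections Iwasawa_deck J k = {\<omega> \<in> forms Iwasawa_deck. P k \<omega> = \<omega>}"
    unfolding U_sections_def by (auto simp: proj_at(2) fun_eq_iff)
  assume \<omega>: "\<omega> \<in> forms Iwasawa_deck"
  then have w: "hat \<omega> \<in> inv_fields {}" by (simp only: mem_forms)
  note sw = inv_fields_smooth[OF w] and aw = hat_alternating[OF \<omega>]
  show "- \<omega> \<in> forms Iwasawa_deck" unfolding mem_forms hat_minus by (rule inv_fields_clifford_op[OF clifford_op_uminus[OF clifford_op_id] w])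
  show "ext_d \<omega> \<in> forms Iwasawa_deck" unfolding mem_forms hat_d by (rule D_inv_fields[OF w])
  show "ext_d (ext_d \<omega>) = 0" by (rule hat_eqI) (simp only: hat_d D_D[OF sw] hat_zero)
  show "(\<lambda>x. U_component (J x) k (\<omega> x)) = P k \<omega>" by (rule ext) (rule proj_at(1)[OF \<omega>])
  show "P k \<omega> \<in> forms Iwasawa_deck" unfolding mem_forms hat_P by (rule inv_fields_clifford_op[OF op_proj w])
  show "(\<Sum>k\<in>{-3..3}. P k \<omega>) = \<omega>" by (rule hat_eqI) (simp only: hat_sum hat_P sum_proj[OF aw])
  show "P k (P l \<omega>) = (if k = l then P k \<omega> else 0)"
    by (rule hat_eqI) (cases "k = l"; simp only: refl if_True if_False hat_P hat_zero' proj_proj[OF aw])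
  show "P k \<omega> = 0" if "k \<notin> {-3..3}" by (rule hat_eqI) (simp only: hat_P proj_outside[OF aw that] hat_zero')
  show "P m (ext_d (P k \<omega>)) = 0" if "m \<noteq> k + 1" "m \<noteq> k - 1"
    by (rule hat_eqI) (simp only: hat_P hat_d proj_D_proj[OF w that] hat_zero')
  show "H \<omega> \<in> forms Iwasawa_deck" unfolding mem_forms hat_H by (rule harmonic_inv_fields[OF w])
  show "ext_d (H \<omega>) = 0" by (rule hat_eqI) (simp only: hat_d hat_H D_harmonic[OF w] hat_zero)
  show "H (ext_d \<omega>) = 0" by (rule hat_eqI) (simp only: hat_d hat_H harmonic_D[OF w] hat_zero)
  show "H (P k \<omega>) = P k (H \<omega>)"
    by (rule hat_eqI) (simp only: hat_P hat_H harmonic_clifford_op[OF op_proj w hproj_proj])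
  show "\<exists>\<eta>\<in>forms Iwasawa_deck. \<omega> = H \<omega> + ext_d \<eta>" if "ext_d \<omega> = 0"
  proof -
    have "D (hat \<omega>) = 0" using that by (simp only: hat_d[symmetric] hat_zero)
    from closed_minus_harmonic[OF w this] obtain v where v: "v \<in> inv_fields {}" "(\<lambda>x. hat \<omega> x - harmonic (hat \<omega>) x) = D v" by blast
    have "\<omega> = H \<omega> + ext_d (unhat v)"
    proof (rule hat_eqI)
      have "hat \<omega> x = harmonic (hat \<omega>) x + D v x" for x using fun_cong[OF v(2), of x] by (simp add: eq_diff_eq algebra_simps)
      then have "hat \<omega> = (\<lambda>x. harmonic (hat \<omega>) x + D v x)" by (rule ext)
      then show "hat \<omega> = hat (H \<omega> + ext_d (unhat v))" by (simp only: hat_add hat_H hat_d hat_unhat)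
    qed
    moreover have "unhat v \<in> forms Iwasawa_deck" using v(1) by (simp only: mem_forms hat_unhat)
    ultimately show ?thesis by blast
  qed
  assume \<eta>: "\<eta> \<in> forms Iwasawa_deck"
  then have n: "hat \<eta> \<in> inv_fields {}" by (simp only: mem_forms)
  note sn = inv_fields_smooth[OF n]
  show "\<omega> + \<eta> \<in> forms Iwasawa_deck" unfolding mem_forms hat_add by (rule inv_fields_add[OF w n])
  show "ext_d (\<omega> + \<eta>) = ext_d \<omega> + ext_d \<eta>" by (rule hat_eqI) (simp only: hat_d hat_add, rule ext, rule D_add[OF sw sn])
  show "P k (\<omega> + \<eta>) = P k \<omega> + P k \<eta>" by (rule hat_eqI) (simp only: hat_P hat_add clifford_op_additive[OF op_proj])
  show "H (\<omega> + \<eta>) = H \<omega> + H \<eta>" by (rule hat_eqI) (simp only: hat_H hat_add harmonic_add[OF sw sn])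
qed

end

theorem mainTheorem7:
  fixes e :: "nat \<Rightarrow> complex ^ 3 \<Rightarrow> ((complex ^ 3) \<Rightarrow>\<^sub>L real)"
    and E :: "nat \<Rightarrow> (complex ^ 3) form_field"
    and \<rho> :: "(complex ^ 3) form_field"
    and J :: "(complex ^ 3) gendo"
  assumes coframe: "left_invariant_coframe e"
    and E: "\<And>k x. E k x = covector (e k x)"
    and de14: "\<And>k. k \<in> {1, 2, 3, 4} \<Longrightarrow> ext_d (E k) = 0"
    and de5: "ext_d (E 5) = (\<lambda>x. E 1 x \<and>\<^sub>f E 3 x - E 2 x \<and>\<^sub>f E 4 x)"
    and de6: "ext_d (E 6) = (\<lambda>x. E 1 x \<and>\<^sub>f E 4 x + E 2 x \<and>\<^sub>f E 3 x)"
    and \<rho>: "\<And>x. \<rho> x =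
      form_exp (cscale \<i> (- (E 3 x \<and>\<^sub>f E 6 x) - E 4 x \<and>\<^sub>f E 5 x))
        \<and>\<^sub>f (E 1 x + cscale \<i> (E 2 x))"
    and J: "generalized_complex Iwasawa_deck J"
    and J_left_invariant: "invariant_endo (range left_translation) J"
    and canonical: "canonical_bundle_generated_by J \<rho>"
  shows "pure_and_full Iwasawa_deck J \<and>
    BC_to_dR Iwasawa_deck ` GH_BC Iwasawa_deck J = GH_dR Iwasawa_deck"
proof -
  have E': "E k = (\<lambda>x. covector (e k x))" for k by (rule ext) (rule E)
  interpret iwasawa_structure e \<rho> J
    using coframe de14 de5 de6 \<rho> canonical unfolding E' by (rule iwasawa_structure.intro)
  show ?thesis using pure_and_full BC_surjective by blast
qed

end
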